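(* Let $R\in\operatorname{End}_{\mathcal{C}_\sigma}(V\tilde\otimes V)$ be a solution of the $\sigma$-dynamical Yang-Baxter equation $R_{12}R_{23}R_{12}=R_{23}R_{12}R_{23}$. Let $A:V\to V\otimes B$ be a linear map (invertible, so that the inverses below make sense). Set $R^A=A_2^{-1}A_1^{-1}RA_1A_2$. Suppose that $R^A(V\otimes V)\subset V\otimes V\otimes\mathbb{F}$. Then $R^A$ satisfies the Yang-Baxter equation $R^A_{12}R^A_{23}R^A_{12}=R^A_{23}R^A_{12}R^A_{23}$.
   Context: $\mathbb{F}$ is a field, $H$ is a commutative cocommutative Hopf algebra over $\mathbb{F}$, and $B$ is an $H$-module algebra with structure map $\sigma:H\otimes B\to B$. The category $\mathcal{C}_\sigma$ has as objects the right $H$-comodules, and as morphisms $\hom_{\mathcal{C}_\sigma}(V,W)=\hom_H(V,W\otimes B)$, the $H$-comodule maps, where $B$ is given the trivial comodule structure. Composition of morphisms is given by the natural embedding of $\hom_H(V,W\otimes B)$ inside $\hom_H(V\otimes B,W\otimes B)$, sending $f$ to the map $v\otimes b\mapsto f(v)b$. Linear maps $V\to W\otimes B$ that need not be comodule maps are composed in the same way, and inverses are taken with respect to this composition, the identity being $v\mapsto v\otimes1$. $V$ is an object of $\mathcal{C}_\sigma$. For an $H$-comodule $W$ with coaction $w\mapsto w_0\otimes w_1$, define $\tau:B\otimes W\to W\otimes B$ by $\tau(b\otimes w)=w_0\otimes\sigma(w_1\otimes b)$. For linear maps $f:V\to V'\otimes B$ and $g:W\to W'\otimes B$ ($V,V',W,W'$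 being $H$-comodules) define $f\tilde\otimes g:V\otimes W\to V'\otimes W'\otimes B$ by $$f\tilde\otimes g=(1\otimes m_B)(1\otimes\tau\otimes1)(f\otimes g),$$ where $m_B$ is the multiplication of $B$ and $\tau:B\otimes W'\to W'\otimes B$. On objects, $V\tilde\otimes W$ is the usual tensor product of comodules $V\otimes W$. For $R\in\operatorname{End}_{\mathcal{C}_\sigma}(V\tilde\otimes V)$ set $R_{12}=R\tilde\otimes1$ and $R_{23}=1\tilde\otimes R$ in $\operatorname{End}_{\mathcal{C}_\sigma}(V\tilde\otimes V\tilde\otimes V)$. For a linear map $A:V\to V\otimes B$ set $A_1=A\tilde\otimes1$ and $A_2=1\tilde\otimes A$, linear maps $V\otimes V\to V\otimes V\otimes B$. $\mathbb{F}\subset B$ denotes the scalars $\mathbb{F}\cdot1_B$, so that $V\otimes V\otimes\mathbb{F}$ is identified with $V\otimes V$ and $R^A$ is regarded as a linear operator on $V\otimes V$; in the Yang-Baxter equation for $R^A$, $R^A_{12}=R^A\otimes1$ and $R^A_{23}=1\otimes R^A$ in $\operatorname{End}(V\otimes V\otimes V)$.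
   Formalization: B is additionally assumed commutative (and nonzero, as 𝔽 ⊂ B requires); without commutativity the claim fails, e.g. for H = 𝔽, B = Mat_2(𝔽), V = 𝔽², char 𝔽 ≠ 2. *)

theory Defs
  imports "HOL-Algebra.Module" "HOL-Algebra.AbelCoset"
begin

section \<open>Tensor products of vector spaces\<close>

definition free_module :: "('f, 'm) ring_scheme \<Rightarrow> 'x set \<Rightarrow> ('f, 'x \<Rightarrow> 'f) module" where
  "free_module F X =
     \<lparr> carrier = {f. (\<forall>x\<in>X. f x \<in> carrier F) \<and> (\<forall>x. x \<notin> X \<longrightarrow> f x = \<zero>\<^bsub>F\<^esub>) \<and> finite {x. f x \<noteq> \<zero>\<^bsub>F\<^esub>}},
       monoid.mult = undefined, one = undefined,
       zero = (\<lambda>x. \<zero>\<^bsub>F\<^esub>), add = (\<lambda>f g x. f x \<oplus>\<^bsub>F\<^esub> g x),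
       smult = (\<lambda>a f x. a \<otimes>\<^bsub>F\<^esub> f x) \<rparr>"

definition free_gen :: "('f, 'm) ring_scheme \<Rightarrow> 'x \<Rightarrow> 'x \<Rightarrow> 'f" where
  "free_gen F x = (\<lambda>y. if y = x then \<one>\<^bsub>F\<^esub> else \<zero>\<^bsub>F\<^esub>)"

definition submodule_span :: "('f, 'm) ring_scheme \<Rightarrow> ('f, 'v, 'n) module_scheme \<Rightarrow> 'v set \<Rightarrow> 'v set" where
  "submodule_span F M A = \<Inter>{N. submodule N F M \<and> A \<subseteq> N}"

definition quotient_module :: "('f, 'v, 'n) module_scheme \<Rightarrow> 'v set \<Rightarrow> ('f, 'v set) module" where
  "quotient_module M N =
     \<lparr> carrier = a_rcosets\<^bsub>M\<^esub> N, monoid.mult = undefined, one = undefined,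
       zero = N, add = (\<lambda>X Y. X <+>\<^bsub>M\<^esub> Y),
       smult = (\<lambda>a X. \<Union>x\<in>X. N +>\<^bsub>M\<^esub> (a \<odot>\<^bsub>M\<^esub> x)) \<rparr>"

definition tensor_relators ::
  "('f, 'm) ring_scheme \<Rightarrow> ('f, 'v, 'n) module_scheme \<Rightarrow> ('f, 'w, 'p) module_scheme \<Rightarrow> ('v \<times> 'w \<Rightarrow> 'f) set" where
  "tensor_relators F V W =
    (let M = free_module F (carrier V \<times> carrier W); e = (\<lambda>v w. free_gen F (v, w)) in
       {e (v \<oplus>\<^bsub>V\<^esub> v') w \<ominus>\<^bsub>M\<^esub> (e v w \<oplus>\<^bsub>M\<^esub> e v' w) | v v' w. v \<in> carrier V \<and> v' \<in> carrier V \<and> w \<in> carrier W}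
     \<union> {e v (w \<oplus>\<^bsub>W\<^esub> w') \<ominus>\<^bsub>M\<^esub> (e v w \<oplus>\<^bsub>M\<^esub> e v w') | v w w'. v \<in> carrier V \<and> w \<in> carrier W \<and> w' \<in> carrier W}
     \<union> {e (a \<odot>\<^bsub>V\<^esub> v) w \<ominus>\<^bsub>M\<^esub> a \<odot>\<^bsub>M\<^esub> e v w | a v w. a \<in> carrier F \<and> v \<in> carrier V \<and> w \<in> carrier W}
     \<union> {e v (a \<odot>\<^bsub>W\<^esub> w) \<ominus>\<^bsub>M\<^esub> a \<odot>\<^bsub>M\<^esub> e v w | a v w. a \<in> carrier F \<and> v \<in> carrier V \<and> w \<in> carrier W})"

definition tensor_null ::
  "('f, 'm) ring_scheme \<Rightarrow> ('f, 'v, 'n) module_scheme \<Rightarrow> ('f, 'w, 'p) module_scheme \<Rightarrow> ('v \<times> 'w \<Rightarrow> 'f) set" where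
  "tensor_null F V W = submodule_span F (free_module F (carrier V \<times> carrier W)) (tensor_relators F V W)"

definition tensor ::
  "('f, 'm) ring_scheme \<Rightarrow> ('f, 'v, 'n) module_scheme \<Rightarrow> ('f, 'w, 'p) module_scheme \<Rightarrow> ('f, ('v \<times> 'w \<Rightarrow> 'f) set) module" where
  "tensor F V W = quotient_module (free_module F (carrier V \<times> carrier W)) (tensor_null F V W)"

definition tens ::
  "('f, 'm) ring_scheme \<Rightarrow> ('f, 'v, 'n) module_scheme \<Rightarrow> ('f, 'w, 'p) module_scheme \<Rightarrow> 'v \<Rightarrow> 'w \<Rightarrow> ('v \<times> 'w \<Rightarrow> 'f) set" where
  "tens F V W v w = tensor_null F V W +>\<^bsub>free_module F (carrier V \<times> carrier W)\<^esub> free_gen F (v, w)"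

text \<open>
  For a bilinear map \<open>\<beta>\<close> into \<open>U\<close>, \<open>tlift F U \<beta>\<close> is the linear map on the tensor product sending
  \<open>v \<otimes> w\<close> to \<open>\<beta> v w\<close>.  It is evaluated on an arbitrary representing formal sum; the result does not
  depend on the choice when \<open>\<beta>\<close> is bilinear.  In Sweedler style, \<open>tlift F U \<beta> (\<rho> v)\<close> is
  \<open>\<beta> v\<^sub>0 v\<^sub>1\<close>, summation understood.
\<close>

definition tlift ::
  "('f, 'm) ring_scheme \<Rightarrow> ('f, 'u, 'n) module_scheme \<Rightarrow> ('v \<Rightarrow> 'w \<Rightarrow> 'u) \<Rightarrow> ('v \<times> 'w \<Rightarrow> 'f) set \<Rightarrow> 'u" where
  "tlift F U \<beta> X =
    (let f = (SOME f. f \<in> X) in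
       \<Oplus>\<^bsub>U\<^esub>p\<in>{p. f p \<noteq> \<zero>\<^bsub>F\<^esub>}. f p \<odot>\<^bsub>U\<^esub> \<beta> (fst p) (snd p))"

definition linear_maps ::
  "('f, 'm) ring_scheme \<Rightarrow> ('f, 'v, 'n) module_scheme \<Rightarrow> ('f, 'w, 'p) module_scheme \<Rightarrow> ('v \<Rightarrow> 'w) set" where
  "linear_maps F V W =
    {f \<in> carrier V \<rightarrow> carrier W.
       (\<forall>x\<in>carrier V. \<forall>y\<in>carrier V. f (x \<oplus>\<^bsub>V\<^esub> y) = f x \<oplus>\<^bsub>W\<^esub> f y) \<and>
       (\<forall>a\<in>carrier F. \<forall>x\<in>carrier V. f (a \<odot>\<^bsub>V\<^esub> x) = a \<odot>\<^bsub>W\<^esub> f x)}"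

text \<open>\<open>tmap F V W f g\<close> is \<open>f \<otimes> g\<close>, where \<open>V\<close> and \<open>W\<close> are the codomains of \<open>f\<close> and \<open>g\<close>.\<close>

definition tmap ::
  "('f, 'm) ring_scheme \<Rightarrow> ('f, 'v, 'n) module_scheme \<Rightarrow> ('f, 'w, 'p) module_scheme \<Rightarrow>
   ('x \<Rightarrow> 'v) \<Rightarrow> ('y \<Rightarrow> 'w) \<Rightarrow> ('x \<times> 'y \<Rightarrow> 'f) set \<Rightarrow> ('v \<times> 'w \<Rightarrow> 'f) set" where
  "tmap F V W f g = tlift F (tensor F V W) (\<lambda>x y. tens F V W (f x) (g y))"

definition tswap ::
  "('f, 'm) ring_scheme \<Rightarrow> ('f, 'v, 'n) module_scheme \<Rightarrow> ('f, 'w, 'p) module_scheme \<Rightarrow>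
   ('v \<times> 'w \<Rightarrow> 'f) set \<Rightarrow> ('w \<times> 'v \<Rightarrow> 'f) set" where
  "tswap F V W = tlift F (tensor F W V) (\<lambda>v w. tens F W V w v)"

definition tassoc ::
  "('f, 'm) ring_scheme \<Rightarrow> ('f, 'u, 'n) module_scheme \<Rightarrow> ('f, 'v, 'p) module_scheme \<Rightarrow> ('f, 'w, 'q) module_scheme \<Rightarrow>
   (('u \<times> 'v \<Rightarrow> 'f) set \<times> 'w \<Rightarrow> 'f) set \<Rightarrow> ('u \<times> ('v \<times> 'w \<Rightarrow> 'f) set \<Rightarrow> 'f) set" where
  "tassoc F U V W =
    (let T = tensor F U (tensor F V W) in
       tlift F T (\<lambda>x w. tlift F T (\<lambda>u v. tens F U (tensor F V W) u (tens F V W v w)) x))"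

definition tassoc_inv ::
  "('f, 'm) ring_scheme \<Rightarrow> ('f, 'u, 'n) module_scheme \<Rightarrow> ('f, 'v, 'p) module_scheme \<Rightarrow> ('f, 'w, 'q) module_scheme \<Rightarrow>
   ('u \<times> ('v \<times> 'w \<Rightarrow> 'f) set \<Rightarrow> 'f) set \<Rightarrow> (('u \<times> 'v \<Rightarrow> 'f) set \<times> 'w \<Rightarrow> 'f) set" where
  "tassoc_inv F U V W =
    (let T = tensor F (tensor F U V) W in
       tlift F T (\<lambda>u y. tlift F T (\<lambda>v w. tens F (tensor F U V) W (tens F U V u v) w) y))"


section \<open>Hopf algebras, comodules, module algebras\<close>

text \<open>The library's locale \<open>algebra\<close> is restricted to commutative algebras.\<close>

locale assoc_algebra = R?: field F + module F A + A?: ring A for F (structure) and A (structure) +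
  assumes smult_mult_left:
      "\<lbrakk>a \<in> carrier F; x \<in> carrier A; y \<in> carrier A\<rbrakk> \<Longrightarrow> (a \<odot>\<^bsub>A\<^esub> x) \<otimes>\<^bsub>A\<^esub> y = a \<odot>\<^bsub>A\<^esub> (x \<otimes>\<^bsub>A\<^esub> y)"
    and smult_mult_right:
      "\<lbrakk>a \<in> carrier F; x \<in> carrier A; y \<in> carrier A\<rbrakk> \<Longrightarrow> x \<otimes>\<^bsub>A\<^esub> (a \<odot>\<^bsub>A\<^esub> y) = a \<odot>\<^bsub>A\<^esub> (x \<otimes>\<^bsub>A\<^esub> y)"

definition tensor_algebra ::
  "('f, 'm) ring_scheme \<Rightarrow> ('f, 'v, 'n) module_scheme \<Rightarrow> ('f, 'w, 'p) module_scheme \<Rightarrow> ('f, ('v \<times> 'w \<Rightarrow> 'f) set) module" where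
  "tensor_algebra F A B =
    (let T = tensor F A B in
     T \<lparr> monoid.mult := (\<lambda>X Y. tlift F T (\<lambda>a b. tlift F T (\<lambda>c d.
            tens F A B (a \<otimes>\<^bsub>A\<^esub> c) (b \<otimes>\<^bsub>B\<^esub> d)) Y) X),
         one := tens F A B \<one>\<^bsub>A\<^esub> \<one>\<^bsub>B\<^esub> \<rparr>)"

record ('f, 'h) hopf = "('f, 'h) module" +
  comult :: "'h \<Rightarrow> ('h \<times> 'h \<Rightarrow> 'f) set"
  counit :: "'h \<Rightarrow> 'f"
  antipode :: "'h \<Rightarrow> 'h"

locale hopf_algebra = assoc_algebra F H for F :: "('f, 'm) ring_scheme" (structure)
    and H :: "('f, 'h, 'n) hopf_scheme" (structure) +
  assumes comult_linear: "comult H \<in> linear_maps F H (tensor F H H)"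
    and comult_hom: "comult H \<in> ring_hom H (tensor_algebra F H H)"
    and counit_linear: "\<lbrakk>a \<in> carrier F; h \<in> carrier H\<rbrakk> \<Longrightarrow> counit H (a \<odot>\<^bsub>H\<^esub> h) = a \<otimes>\<^bsub>F\<^esub> counit H h"
    and counit_hom: "counit H \<in> ring_hom H F"
    and antipode_linear: "antipode H \<in> linear_maps F H H"
    and coassoc: "h \<in> carrier H \<Longrightarrow>
      tassoc F H H H (tmap F (tensor F H H) H (comult H) (\<lambda>k. k) (comult H h)) =
      tmap F H (tensor F H H) (\<lambda>k. k) (comult H) (comult H h)"
    and counit_left: "h \<in> carrier H \<Longrightarrow> tlift F H (\<lambda>g k. counit H g \<odot>\<^bsub>H\<^esub> k) (comult H h) = h"
    and counit_right: "h \<in> carrier H \<Longrightarrow> tlift F H (\<lambda>g k. counit H k \<odot>\<^bsub>H\<^esub> g) (comult H h) = h"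
    and antipode_left: "h \<in> carrier H \<Longrightarrow>
      tlift F H (\<lambda>g k. antipode H g \<otimes>\<^bsub>H\<^esub> k) (comult H h) = counit H h \<odot>\<^bsub>H\<^esub> \<one>\<^bsub>H\<^esub>"
    and antipode_right: "h \<in> carrier H \<Longrightarrow>
      tlift F H (\<lambda>g k. g \<otimes>\<^bsub>H\<^esub> antipode H k) (comult H h) = counit H h \<odot>\<^bsub>H\<^esub> \<one>\<^bsub>H\<^esub>"

locale comm_cocomm_hopf_algebra = hopf_algebra F H for F (structure) and H (structure) +
  assumes comm: "\<lbrakk>g \<in> carrier H; h \<in> carrier H\<rbrakk> \<Longrightarrow> g \<otimes>\<^bsub>H\<^esub> h = h \<otimes>\<^bsub>H\<^esub> g"
    and cocomm: "h \<in> carrier H \<Longrightarrow> tswap F H H (comult H h) = comult H h"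

record ('f, 'v, 'h) comodule = "('f, 'v) module" +
  coact :: "'v \<Rightarrow> ('v \<times> 'h \<Rightarrow> 'f) set"

locale right_comodule = module F V for F :: "('f, 'm) ring_scheme" (structure)
    and H :: "('f, 'h, 'n) hopf_scheme" and V :: "('f, 'v, 'h, 'p) comodule_scheme" (structure) +
  assumes coact_linear: "coact V \<in> linear_maps F V (tensor F V H)"
    and coact_coassoc: "v \<in> carrier V \<Longrightarrow>
      tassoc F V H H (tmap F (tensor F V H) H (coact V) (\<lambda>h. h) (coact V v)) =
      tmap F V (tensor F H H) (\<lambda>w. w) (comult H) (coact V v)"
    and coact_counit: "v \<in> carrier V \<Longrightarrow> tlift F V (\<lambda>w h. counit H h \<odot>\<^bsub>V\<^esub> w) (coact V v) = v"

definition comodule_maps ::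
  "('f, 'm) ring_scheme \<Rightarrow> ('f, 'h, 'n) hopf_scheme \<Rightarrow> ('f, 'v, 'h, 'p) comodule_scheme \<Rightarrow>
   ('f, 'w, 'h, 'q) comodule_scheme \<Rightarrow> ('v \<Rightarrow> 'w) set" where
  "comodule_maps F H V W =
    {f \<in> linear_maps F V W. \<forall>v\<in>carrier V. coact W (f v) = tmap F W H f (\<lambda>h. h) (coact V v)}"

definition with_coaction ::
  "('f, 'v, 'p) module_scheme \<Rightarrow> ('v \<Rightarrow> ('v \<times> 'h \<Rightarrow> 'f) set) \<Rightarrow> ('f, 'v, 'h) comodule" where
  "with_coaction M \<rho> =
     \<lparr> carrier = carrier M, monoid.mult = monoid.mult M, one = one M, zero = zero M, add = add M,
       smult = smult M, coact = \<rho> \<rparr>"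

definition trivial_comodule ::
  "('f, 'm) ring_scheme \<Rightarrow> ('f, 'h, 'n) hopf_scheme \<Rightarrow> ('f, 'v, 'p) module_scheme \<Rightarrow> ('f, 'v, 'h) comodule" where
  "trivial_comodule F H M = with_coaction M (\<lambda>v. tens F M H v \<one>\<^bsub>H\<^esub>)"

text \<open>The coaction of the tensor product is \<open>v \<otimes> w \<mapsto> v\<^sub>0 \<otimes> w\<^sub>0 \<otimes> v\<^sub>1 w\<^sub>1\<close>.\<close>

definition tensor_comodule ::
  "('f, 'm) ring_scheme \<Rightarrow> ('f, 'h, 'n) hopf_scheme \<Rightarrow> ('f, 'v, 'h, 'p) comodule_scheme \<Rightarrow>
   ('f, 'w, 'h, 'q) comodule_scheme \<Rightarrow> ('f, ('v \<times> 'w \<Rightarrow> 'f) set, 'h) comodule" where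
  "tensor_comodule F H V W =
    (let T = tensor F (tensor F V W) H in
     with_coaction (tensor F V W)
       (tlift F T (\<lambda>v w. tlift F T (\<lambda>v0 g. tlift F T (\<lambda>w0 h.
          tens F (tensor F V W) H (tens F V W v0 w0) (g \<otimes>\<^bsub>H\<^esub> h))
        (coact W w)) (coact V v))))"

locale module_algebra = assoc_algebra F B for F :: "('f, 'm) ring_scheme" (structure)
    and H :: "('f, 'h, 'n) hopf_scheme" and B :: "('f, 'b, 'p) module_scheme" (structure)
    and \<sigma> :: "('h \<times> 'b \<Rightarrow> 'f) set \<Rightarrow> 'b" +
  assumes action_linear: "\<sigma> \<in> linear_maps F (tensor F H B) B"
    and action_one: "b \<in> carrier B \<Longrightarrow> \<sigma> (tens F H B \<one>\<^bsub>H\<^esub> b) = b"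
    and action_mult: "\<lbrakk>g \<in> carrier H; h \<in> carrier H; b \<in> carrier B\<rbrakk> \<Longrightarrow>
      \<sigma> (tens F H B (g \<otimes>\<^bsub>H\<^esub> h) b) = \<sigma> (tens F H B g (\<sigma> (tens F H B h b)))"
    and action_on_one: "h \<in> carrier H \<Longrightarrow> \<sigma> (tens F H B h \<one>\<^bsub>B\<^esub>) = counit H h \<odot>\<^bsub>B\<^esub> \<one>\<^bsub>B\<^esub>"
    and action_on_mult: "\<lbrakk>h \<in> carrier H; b \<in> carrier B; c \<in> carrier B\<rbrakk> \<Longrightarrow>
      \<sigma> (tens F H B h (b \<otimes>\<^bsub>B\<^esub> c)) =
      tlift F B (\<lambda>h1 h2. \<sigma> (tens F H B h1 b) \<otimes>\<^bsub>B\<^esub> \<sigma> (tens F H B h2 c)) (comult H h)"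


section \<open>The category \<open>\<C>\<^sub>\<sigma>\<close>\<close>

definition dyn_hom ::
  "('f, 'm) ring_scheme \<Rightarrow> ('f, 'h, 'n) hopf_scheme \<Rightarrow> ('f, 'b, 'r) module_scheme \<Rightarrow>
   ('f, 'v, 'h, 'p) comodule_scheme \<Rightarrow> ('f, 'w, 'h, 'q) comodule_scheme \<Rightarrow> ('v \<Rightarrow> ('w \<times> 'b \<Rightarrow> 'f) set) set" where
  "dyn_hom F H B V W = comodule_maps F H V (tensor_comodule F H W (trivial_comodule F H B))"

definition dyn_id ::
  "('f, 'm) ring_scheme \<Rightarrow> ('f, 'b, 'r) module_scheme \<Rightarrow> ('f, 'v, 'p) module_scheme \<Rightarrow>
   'v \<Rightarrow> ('v \<times> 'b \<Rightarrow> 'f) set" where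
  "dyn_id F B V = (\<lambda>v. tens F V B v \<one>\<^bsub>B\<^esub>)"

text \<open>\<open>dyn_ext F B W f\<close> is the map \<open>V \<otimes> B \<rightarrow> W \<otimes> B\<close>, \<open>v \<otimes> b \<mapsto> f(v) b\<close>, for \<open>f : V \<rightarrow> W \<otimes> B\<close>.\<close>

definition dyn_ext ::
  "('f, 'm) ring_scheme \<Rightarrow> ('f, 'b, 'r) module_scheme \<Rightarrow> ('f, 'w, 'p) module_scheme \<Rightarrow>
   ('v \<Rightarrow> ('w \<times> 'b \<Rightarrow> 'f) set) \<Rightarrow> ('v \<times> 'b \<Rightarrow> 'f) set \<Rightarrow> ('w \<times> 'b \<Rightarrow> 'f) set" where
  "dyn_ext F B W f =
     tlift F (tensor F W B) (\<lambda>v b. tmap F W B (\<lambda>w. w) (\<lambda>c. c \<otimes>\<^bsub>B\<^esub> b) (f v))"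

text \<open>\<open>dyn_comp F B W g f\<close> is the composite \<open>g f\<close> (first \<open>f\<close>), where \<open>W\<close> is the target of \<open>g\<close>.\<close>

definition dyn_comp ::
  "('f, 'm) ring_scheme \<Rightarrow> ('f, 'b, 'r) module_scheme \<Rightarrow> ('f, 'w, 'p) module_scheme \<Rightarrow>
   ('v \<Rightarrow> ('w \<times> 'b \<Rightarrow> 'f) set) \<Rightarrow> ('u \<Rightarrow> ('v \<times> 'b \<Rightarrow> 'f) set) \<Rightarrow> 'u \<Rightarrow> ('w \<times> 'b \<Rightarrow> 'f) set" where
  "dyn_comp F B W g f = dyn_ext F B W g \<circ> f"

definition is_dyn_inverse ::
  "('f, 'm) ring_scheme \<Rightarrow> ('f, 'b, 'r) module_scheme \<Rightarrow> ('f, 'v, 'p) module_scheme \<Rightarrow>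
   ('v \<Rightarrow> ('v \<times> 'b \<Rightarrow> 'f) set) \<Rightarrow> ('v \<Rightarrow> ('v \<times> 'b \<Rightarrow> 'f) set) \<Rightarrow> bool" where
  "is_dyn_inverse F B V f g \<longleftrightarrow>
     g \<in> linear_maps F V (tensor F V B) \<and>
     (\<forall>v\<in>carrier V. dyn_comp F B V g f v = dyn_id F B V v \<and> dyn_comp F B V f g v = dyn_id F B V v)"

definition dyn_invertible ::
  "('f, 'm) ring_scheme \<Rightarrow> ('f, 'b, 'r) module_scheme \<Rightarrow> ('f, 'v, 'p) module_scheme \<Rightarrow>
   ('v \<Rightarrow> ('v \<times> 'b \<Rightarrow> 'f) set) \<Rightarrow> bool" where
  "dyn_invertible F B V f \<longleftrightarrow> (\<exists>g. is_dyn_inverse F B V f g)"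

text \<open>The inverse is unique on \<open>carrier V\<close>; values elsewhere are irrelevant, hence \<open>SOME\<close>.\<close>

definition dyn_inv ::
  "('f, 'm) ring_scheme \<Rightarrow> ('f, 'b, 'r) module_scheme \<Rightarrow> ('f, 'v, 'p) module_scheme \<Rightarrow>
   ('v \<Rightarrow> ('v \<times> 'b \<Rightarrow> 'f) set) \<Rightarrow> 'v \<Rightarrow> ('v \<times> 'b \<Rightarrow> 'f) set" where
  "dyn_inv F B V f = (SOME g. is_dyn_inverse F B V f g)"

text \<open>\<open>\<tau> : B \<otimes> W \<rightarrow> W \<otimes> B\<close>, \<open>b \<otimes> w \<mapsto> w\<^sub>0 \<otimes> \<sigma>(w\<^sub>1 \<otimes> b)\<close>.\<close>

definition dyn_tau ::
  "('f, 'm) ring_scheme \<Rightarrow> ('f, 'h, 'n) hopf_scheme \<Rightarrow> ('f, 'b, 'r) module_scheme \<Rightarrow>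
   (('h \<times> 'b \<Rightarrow> 'f) set \<Rightarrow> 'b) \<Rightarrow> ('f, 'w, 'h, 'p) comodule_scheme \<Rightarrow>
   ('b \<times> 'w \<Rightarrow> 'f) set \<Rightarrow> ('w \<times> 'b \<Rightarrow> 'f) set" where
  "dyn_tau F H B \<sigma> W =
     tlift F (tensor F W B) (\<lambda>b w. tlift F (tensor F W B) (\<lambda>w0 h.
       tens F W B w0 (\<sigma> (tens F H B h b))) (coact W w))"

text \<open>
  \<open>(1 \<otimes> m\<^sub>B)(1 \<otimes> \<tau> \<otimes> 1)\<close> as a map \<open>(V \<otimes> B) \<otimes> (W \<otimes> B) \<rightarrow> (V \<otimes> W) \<otimes> B\<close>:
  with \<open>\<tau>(b \<otimes> w) = w' \<otimes> d\<close>, it sends \<open>(v \<otimes> b) \<otimes> (w \<otimes> c)\<close> to \<open>(v \<otimes> w') \<otimes> d c\<close>.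
\<close>

definition dyn_merge ::
  "('f, 'm) ring_scheme \<Rightarrow> ('f, 'h, 'n) hopf_scheme \<Rightarrow> ('f, 'b, 'r) module_scheme \<Rightarrow>
   (('h \<times> 'b \<Rightarrow> 'f) set \<Rightarrow> 'b) \<Rightarrow> ('f, 'v, 'h, 'p) comodule_scheme \<Rightarrow> ('f, 'w, 'h, 'q) comodule_scheme \<Rightarrow>
   (('v \<times> 'b \<Rightarrow> 'f) set \<times> ('w \<times> 'b \<Rightarrow> 'f) set \<Rightarrow> 'f) set \<Rightarrow> (('v \<times> 'w \<Rightarrow> 'f) set \<times> 'b \<Rightarrow> 'f) set" where
  "dyn_merge F H B \<sigma> V W =
    (let T = tensor F (tensor F V W) B in
     tlift F T (\<lambda>x y. tlift F T (\<lambda>v b. tlift F T (\<lambda>w c. tlift F T (\<lambda>w' d.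
       tens F (tensor F V W) B (tens F V W v w') (d \<otimes>\<^bsub>B\<^esub> c))
     (dyn_tau F H B \<sigma> W (tens F B W b w))) y) x))"

text \<open>\<open>dyn_tensor F H B \<sigma> V' W' f g\<close> is \<open>f \<otimes>\<^sup>~ g\<close> for \<open>f : V \<rightarrow> V' \<otimes> B\<close> and \<open>g : W \<rightarrow> W' \<otimes> B\<close>.\<close>

definition dyn_tensor ::
  "('f, 'm) ring_scheme \<Rightarrow> ('f, 'h, 'n) hopf_scheme \<Rightarrow> ('f, 'b, 'r) module_scheme \<Rightarrow>
   (('h \<times> 'b \<Rightarrow> 'f) set \<Rightarrow> 'b) \<Rightarrow> ('f, 'x, 'h, 'p) comodule_scheme \<Rightarrow> ('f, 'y, 'h, 'q) comodule_scheme \<Rightarrow>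
   ('v \<Rightarrow> ('x \<times> 'b \<Rightarrow> 'f) set) \<Rightarrow> ('w \<Rightarrow> ('y \<times> 'b \<Rightarrow> 'f) set) \<Rightarrow>
   ('v \<times> 'w \<Rightarrow> 'f) set \<Rightarrow> (('x \<times> 'y \<Rightarrow> 'f) set \<times> 'b \<Rightarrow> 'f) set" where
  "dyn_tensor F H B \<sigma> V' W' f g =
     dyn_merge F H B \<sigma> V' W' \<circ> tmap F (tensor F V' B) (tensor F W' B) f g"


section \<open>The dynamical Yang-Baxter equation and gauge transformations\<close>

text \<open>
  The triple tensor product is bracketed as \<open>(V \<otimes> V) \<otimes> V\<close>, so \<open>R\<^sub>2\<^sub>3\<close> and its non-dynamical
  counterpart are conjugated by the associator.
\<close>

definition dyn_12 ::
  "('f, 'm) ring_scheme \<Rightarrow> ('f, 'h, 'n) hopf_scheme \<Rightarrow> ('f, 'b, 'r) module_scheme \<Rightarrow>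
   (('h \<times> 'b \<Rightarrow> 'f) set \<Rightarrow> 'b) \<Rightarrow> ('f, 'v, 'h, 'p) comodule_scheme \<Rightarrow>
   (('v \<times> 'v \<Rightarrow> 'f) set \<Rightarrow> (('v \<times> 'v \<Rightarrow> 'f) set \<times> 'b \<Rightarrow> 'f) set) \<Rightarrow>
   (('v \<times> 'v \<Rightarrow> 'f) set \<times> 'v \<Rightarrow> 'f) set \<Rightarrow> ((('v \<times> 'v \<Rightarrow> 'f) set \<times> 'v \<Rightarrow> 'f) set \<times> 'b \<Rightarrow> 'f) set" where
  "dyn_12 F H B \<sigma> V R = dyn_tensor F H B \<sigma> (tensor_comodule F H V V) V R (dyn_id F B V)"

definition dyn_23 ::
  "('f, 'm) ring_scheme \<Rightarrow> ('f, 'h, 'n) hopf_scheme \<Rightarrow> ('f, 'b, 'r) module_scheme \<Rightarrow>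
   (('h \<times> 'b \<Rightarrow> 'f) set \<Rightarrow> 'b) \<Rightarrow> ('f, 'v, 'h, 'p) comodule_scheme \<Rightarrow>
   (('v \<times> 'v \<Rightarrow> 'f) set \<Rightarrow> (('v \<times> 'v \<Rightarrow> 'f) set \<times> 'b \<Rightarrow> 'f) set) \<Rightarrow>
   (('v \<times> 'v \<Rightarrow> 'f) set \<times> 'v \<Rightarrow> 'f) set \<Rightarrow> ((('v \<times> 'v \<Rightarrow> 'f) set \<times> 'v \<Rightarrow> 'f) set \<times> 'b \<Rightarrow> 'f) set" where
  "dyn_23 F H B \<sigma> V R =
     tmap F (tensor F (tensor F V V) V) B (tassoc_inv F V V V) (\<lambda>b. b) \<circ>
     dyn_tensor F H B \<sigma> V (tensor_comodule F H V V) (dyn_id F B V) R \<circ>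
     tassoc F V V V"

definition dyn_YBE ::
  "('f, 'm) ring_scheme \<Rightarrow> ('f, 'h, 'n) hopf_scheme \<Rightarrow> ('f, 'b, 'r) module_scheme \<Rightarrow>
   (('h \<times> 'b \<Rightarrow> 'f) set \<Rightarrow> 'b) \<Rightarrow> ('f, 'v, 'h, 'p) comodule_scheme \<Rightarrow>
   (('v \<times> 'v \<Rightarrow> 'f) set \<Rightarrow> (('v \<times> 'v \<Rightarrow> 'f) set \<times> 'b \<Rightarrow> 'f) set) \<Rightarrow> bool" where
  "dyn_YBE F H B \<sigma> V R \<longleftrightarrow>
    (let T = tensor F (tensor F V V) V; R12 = dyn_12 F H B \<sigma> V R; R23 = dyn_23 F H B \<sigma> V R in
     \<forall>x\<in>carrier T.
       dyn_comp F B T R12 (dyn_comp F B T R23 R12) x = dyn_comp F B T R23 (dyn_comp F B T R12 R23) x)"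

definition dyn_1 ::
  "('f, 'm) ring_scheme \<Rightarrow> ('f, 'h, 'n) hopf_scheme \<Rightarrow> ('f, 'b, 'r) module_scheme \<Rightarrow>
   (('h \<times> 'b \<Rightarrow> 'f) set \<Rightarrow> 'b) \<Rightarrow> ('f, 'v, 'h, 'p) comodule_scheme \<Rightarrow> ('v \<Rightarrow> ('v \<times> 'b \<Rightarrow> 'f) set) \<Rightarrow>
   ('v \<times> 'v \<Rightarrow> 'f) set \<Rightarrow> (('v \<times> 'v \<Rightarrow> 'f) set \<times> 'b \<Rightarrow> 'f) set" where
  "dyn_1 F H B \<sigma> V A = dyn_tensor F H B \<sigma> V V A (dyn_id F B V)"

definition dyn_2 ::
  "('f, 'm) ring_scheme \<Rightarrow> ('f, 'h, 'n) hopf_scheme \<Rightarrow> ('f, 'b, 'r) module_scheme \<Rightarrow>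
   (('h \<times> 'b \<Rightarrow> 'f) set \<Rightarrow> 'b) \<Rightarrow> ('f, 'v, 'h, 'p) comodule_scheme \<Rightarrow> ('v \<Rightarrow> ('v \<times> 'b \<Rightarrow> 'f) set) \<Rightarrow>
   ('v \<times> 'v \<Rightarrow> 'f) set \<Rightarrow> (('v \<times> 'v \<Rightarrow> 'f) set \<times> 'b \<Rightarrow> 'f) set" where
  "dyn_2 F H B \<sigma> V A = dyn_tensor F H B \<sigma> V V (dyn_id F B V) A"

definition gauge_transform ::
  "('f, 'm) ring_scheme \<Rightarrow> ('f, 'h, 'n) hopf_scheme \<Rightarrow> ('f, 'b, 'r) module_scheme \<Rightarrow>
   (('h \<times> 'b \<Rightarrow> 'f) set \<Rightarrow> 'b) \<Rightarrow> ('f, 'v, 'h, 'p) comodule_scheme \<Rightarrow> ('v \<Rightarrow> ('v \<times> 'b \<Rightarrow> 'f) set) \<Rightarrow>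
   (('v \<times> 'v \<Rightarrow> 'f) set \<Rightarrow> (('v \<times> 'v \<Rightarrow> 'f) set \<times> 'b \<Rightarrow> 'f) set) \<Rightarrow>
   ('v \<times> 'v \<Rightarrow> 'f) set \<Rightarrow> (('v \<times> 'v \<Rightarrow> 'f) set \<times> 'b \<Rightarrow> 'f) set" where
  "gauge_transform F H B \<sigma> V A R =
    (let T = tensor F V V; A1 = dyn_1 F H B \<sigma> V A; A2 = dyn_2 F H B \<sigma> V A in
     dyn_comp F B T (dyn_inv F B T A2)
       (dyn_comp F B T (dyn_inv F B T A1)
         (dyn_comp F B T R (dyn_comp F B T A1 A2))))"

text \<open>
  \<open>V \<otimes> \<F>\<close> inside \<open>V \<otimes> B\<close>, and the operator on \<open>V\<close> given by a map with values in it
  via \<open>V \<otimes> \<F> = V\<close>; the latter is well defined because \<open>v \<mapsto> v \<otimes> 1\<close> is injective if \<open>1 \<noteq> 0\<close> in \<open>B\<close>.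
\<close>

definition scalar_part ::
  "('f, 'm) ring_scheme \<Rightarrow> ('f, 'b, 'r) module_scheme \<Rightarrow> ('f, 'v, 'p) module_scheme \<Rightarrow> ('v \<times> 'b \<Rightarrow> 'f) set set" where
  "scalar_part F B V = {tens F V B v (a \<odot>\<^bsub>B\<^esub> \<one>\<^bsub>B\<^esub>) | v a. v \<in> carrier V \<and> a \<in> carrier F}"

definition scalar_op ::
  "('f, 'm) ring_scheme \<Rightarrow> ('f, 'b, 'r) module_scheme \<Rightarrow> ('f, 'v, 'p) module_scheme \<Rightarrow>
   ('v \<Rightarrow> ('v \<times> 'b \<Rightarrow> 'f) set) \<Rightarrow> 'v \<Rightarrow> 'v" where
  "scalar_op F B V f = (\<lambda>v. THE w. w \<in> carrier V \<and> f v = tens F V B w \<one>\<^bsub>B\<^esub>)"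

definition YBE ::
  "('f, 'm) ring_scheme \<Rightarrow> ('f, 'v, 'p) module_scheme \<Rightarrow> (('v \<times> 'v \<Rightarrow> 'f) set \<Rightarrow> ('v \<times> 'v \<Rightarrow> 'f) set) \<Rightarrow> bool" where
  "YBE F V S \<longleftrightarrow>
    (let S12 = tmap F (tensor F V V) V S (\<lambda>v. v);
         S23 = tassoc_inv F V V V \<circ> tmap F V (tensor F V V) (\<lambda>v. v) S \<circ> tassoc F V V V in
     \<forall>x\<in>carrier (tensor F (tensor F V V) V). (S12 \<circ> S23 \<circ> S12) x = (S23 \<circ> S12 \<circ> S23) x)"

end

theory Submission
  imports Defs
begin

text \<open>
  Let \<open>A\<^sub>1, A\<^sub>2, A\<^sub>3\<close> be \<open>A\<close> placed on the three factors of \<open>V \<otimes> V \<otimes> V\<close> by means of the twisted tensor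
  product of maps, and let \<open>X = A\<^sub>1 A\<^sub>2 A\<^sub>3\<close>.  The proof shows that \<open>X\<close> intertwines \<open>R\<^sup>A\<^sub>1\<^sub>2\<close> with \<open>R\<^sub>1\<^sub>2\<close>
  and \<open>R\<^sup>A\<^sub>2\<^sub>3\<close> with \<open>R\<^sub>2\<^sub>3\<close>; since \<open>X\<close> is injective, the equation for \<open>R\<close> passes to \<open>R\<^sup>A\<close>
  (\<open>braid_conjugate\<close>).  The definition of \<open>R\<^sup>A\<close> gives \<open>A\<^sub>1 A\<^sub>2 R\<^sup>A\<^sub>1\<^sub>2 = R\<^sub>1\<^sub>2 A\<^sub>1 A\<^sub>2\<close>, and \<open>A\<^sub>3\<close> commutes with
  \<open>R\<^sup>A\<^sub>1\<^sub>2\<close> because \<open>R\<^sup>A\<close> has scalar coefficients (\<open>on23_second_on12_commute\<close>).  Likewise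
  \<open>A\<^sub>2 A\<^sub>3 R\<^sup>A\<^sub>2\<^sub>3 = R\<^sub>2\<^sub>3 A\<^sub>2 A\<^sub>3\<close>, and \<open>A\<^sub>1\<close> commutes with \<open>R\<^sub>2\<^sub>3\<close> because \<open>R\<close> is a comodule map
  (\<open>on12_first_on23_commute\<close>).  Neither of the two commutations holds for arbitrary linear maps.

  These manipulations use two rules for the twisted tensor product: an interchange law
  \<open>(f \<otimes> g)(f' \<otimes> g') = ff' \<otimes> gg'\<close>, valid when \<open>g\<close> is a comodule map or \<open>f'\<close> has scalar coefficients
  (\<open>dyn_comp_dtensor\<close>, \<open>dyn_comp_dtensor_scalar\<close>), and associativity (\<open>dtensor_assoc\<close>).  Both are
  reduced to properties of the endomorphisms \<open>\<tau>\<^sub>b : w \<mapsto> w\<^sub>0 \<otimes> \<sigma>(w\<^sub>1 \<otimes> b)\<close>, \<open>b \<in> B\<close>, in which the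
  coaction of \<open>H\<close> no longer appears:
  \<^item> \<open>\<tau>\<^sub>1 = 1\<close> and \<open>\<tau>\<^sub>b\<^sub>c = \<tau>\<^sub>b \<tau>\<^sub>c\<close> (\<open>half_braided_comodule\<close>; counit, coassociativity and the module
    algebra axioms);
  \<^item> on \<open>V \<otimes> W\<close> the map \<open>\<tau>\<^sub>b\<close> is the twisted tensor product of the \<open>\<tau>\<^sub>b\<close> of \<open>V\<close> with the identity
    (\<open>tau_tensor\<close>; commutativity of \<open>H\<close>);
  \<^item> comodule maps commute with \<open>\<tau>\<^sub>b\<close> (\<open>tau_commuting_dyn_hom\<close>; commutativity of \<open>B\<close>).

  What is obtained in this way is an equation between maps into \<open>V \<otimes> V \<otimes> V \<otimes> B\<close>.  It descends to
  \<open>V \<otimes> V \<otimes> V\<close> because \<open>x \<mapsto> x \<otimes> 1\<close> is injective, which over a field follows from the existence of a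
  functional on \<open>B\<close> with value 1 at 1 (\<open>tens_right_injective\<close>).
\<close>

section \<open>Linear maps\<close>

lemma linear_mapsI:
  assumes "\<And>x. x \<in> carrier V \<Longrightarrow> f x \<in> carrier W"
    and "\<And>x y. \<lbrakk>x \<in> carrier V; y \<in> carrier V\<rbrakk> \<Longrightarrow> f (x \<oplus>\<^bsub>V\<^esub> y) = f x \<oplus>\<^bsub>W\<^esub> f y"
    and "\<And>a x. \<lbrakk>a \<in> carrier F; x \<in> carrier V\<rbrakk> \<Longrightarrow> f (a \<odot>\<^bsub>V\<^esub> x) = a \<odot>\<^bsub>W\<^esub> f x"
  shows "f \<in> linear_maps F V W"
  using assms by (auto simp: linear_maps_def)

lemma linear_closed: "\<lbrakk>f \<in> linear_maps F V W; x \<in> carrier V\<rbrakk> \<Longrightarrow> f x \<in> carrier W"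
  and linear_add: "\<lbrakk>f \<in> linear_maps F V W; x \<in> carrier V; y \<in> carrier V\<rbrakk> \<Longrightarrow> f (x \<oplus>\<^bsub>V\<^esub> y) = f x \<oplus>\<^bsub>W\<^esub> f y"
  and linear_smult: "\<lbrakk>f \<in> linear_maps F V W; a \<in> carrier F; x \<in> carrier V\<rbrakk> \<Longrightarrow> f (a \<odot>\<^bsub>V\<^esub> x) = a \<odot>\<^bsub>W\<^esub> f x"
  by (auto simp: linear_maps_def)

lemma linear_id: "(\<lambda>x. x) \<in> linear_maps F V V"
  by (auto intro: linear_mapsI)

lemma linear_compose: "\<lbrakk>f \<in> linear_maps F U V; g \<in> linear_maps F V W\<rbrakk> \<Longrightarrow> (\<lambda>x. g (f x)) \<in> linear_maps F U W"
  by (auto simp: linear_maps_def Pi_iff)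

lemma linear_zero:
  assumes "module F V" "module F W" "f \<in> linear_maps F V W"
  shows "f \<zero>\<^bsub>V\<^esub> = \<zero>\<^bsub>W\<^esub>"
proof -
  interpret V: module F V by fact
  interpret W: module F W by fact
  have "f (\<zero>\<^bsub>F\<^esub> \<odot>\<^bsub>V\<^esub> \<zero>\<^bsub>V\<^esub>) = \<zero>\<^bsub>F\<^esub> \<odot>\<^bsub>W\<^esub> f \<zero>\<^bsub>V\<^esub>"
    by (rule linear_smult[OF assms(3)]) auto
  then show ?thesis
    using linear_closed[OF assms(3) V.zero_closed] by simp
qed

lemma linear_minus:
  assumes "module F V" "module F W" "f \<in> linear_maps F V W" "x \<in> carrier V"
  shows "f (\<ominus>\<^bsub>V\<^esub> x) = \<ominus>\<^bsub>W\<^esub> f x"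
proof -
  interpret V: module F V by fact
  interpret W: module F W by fact
  have "f (\<ominus>\<^bsub>V\<^esub> x) \<oplus>\<^bsub>W\<^esub> f x = \<zero>\<^bsub>W\<^esub>"
    using assms by (simp add: linear_add[OF assms(3), symmetric] V.M.l_neg linear_zero)
  then show ?thesis
    using assms linear_closed[OF assms(3)] by (metis W.M.minus_equality V.M.a_inv_closed)
qed

lemma kernel_submodule:
  assumes "module F V" "module F W" "f \<in> linear_maps F V W"
  shows "submodule {x \<in> carrier V. f x = \<zero>\<^bsub>W\<^esub>} F V"
proof -
  interpret V: module F V by fact
  interpret W: module F W by fact
  show ?thesis
    using assms
    by (intro V.submoduleI) (auto simp: linear_zero linear_minus linear_add[of _ F V W] linear_smult[of _ F V W])
qed

definition bilinear_maps ::
  "('f, 'm) ring_scheme \<Rightarrow> ('f, 'v, 'n) module_scheme \<Rightarrow> ('f, 'w, 'p) module_scheme \<Rightarrow>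
   ('f, 'u, 'q) module_scheme \<Rightarrow> ('v \<Rightarrow> 'w \<Rightarrow> 'u) set" where
  "bilinear_maps F V W U =
     {\<beta>. (\<forall>v\<in>carrier V. \<beta> v \<in> linear_maps F W U) \<and> (\<forall>w\<in>carrier W. (\<lambda>v. \<beta> v w) \<in> linear_maps F V U)}"

lemma bilinear_mapsI:
  assumes "\<And>w. w \<in> carrier W \<Longrightarrow> (\<lambda>v. \<beta> v w) \<in> linear_maps F V U"
    and "\<And>v. v \<in> carrier V \<Longrightarrow> (\<lambda>w. \<beta> v w) \<in> linear_maps F W U"
  shows "\<beta> \<in> bilinear_maps F V W U"
  using assms by (auto simp: bilinear_maps_def)

lemma bilinear_left: "\<lbrakk>\<beta> \<in> bilinear_maps F V W U; w \<in> carrier W\<rbrakk> \<Longrightarrow> (\<lambda>v. \<beta> v w) \<in> linear_maps F V U"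
  and bilinear_right: "\<lbrakk>\<beta> \<in> bilinear_maps F V W U; v \<in> carrier V\<rbrakk> \<Longrightarrow> \<beta> v \<in> linear_maps F W U"
  by (auto simp: bilinear_maps_def)

lemma bilinear_closed: "\<lbrakk>\<beta> \<in> bilinear_maps F V W U; v \<in> carrier V; w \<in> carrier W\<rbrakk> \<Longrightarrow> \<beta> v w \<in> carrier U"
  using bilinear_right[of \<beta> F V W U v] linear_closed[of "\<beta> v"] by blast


section \<open>Free modules and quotients\<close>

lemma free_module_simps [simp]:
  "zero (free_module F X) = (\<lambda>x. \<zero>\<^bsub>F\<^esub>)"
  "f \<oplus>\<^bsub>free_module F X\<^esub> g = (\<lambda>x. f x \<oplus>\<^bsub>F\<^esub> g x)"
  "a \<odot>\<^bsub>free_module F X\<^esub> f = (\<lambda>x. a \<otimes>\<^bsub>F\<^esub> f x)"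
  by (auto simp: free_module_def)

lemma free_module_carrier:
  "f \<in> carrier (free_module F X) \<longleftrightarrow>
     (\<forall>x\<in>X. f x \<in> carrier F) \<and> (\<forall>x. x \<notin> X \<longrightarrow> f x = \<zero>\<^bsub>F\<^esub>) \<and> finite {x. f x \<noteq> \<zero>\<^bsub>F\<^esub>}"
  by (simp add: free_module_def)

lemma free_module_value: "\<lbrakk>cring F; f \<in> carrier (free_module F X)\<rbrakk> \<Longrightarrow> f x \<in> carrier F"
proof -
  assume "cring F" and f: "f \<in> carrier (free_module F X)"
  then interpret cring F by simp
  show ?thesis using f by (cases "x \<in> X") (auto simp: free_module_carrier)
qed

lemma free_module_module:
  assumes "cring F"
  shows "module F (free_module F X)"
proof -
  interpret cring F by fact
  note val = free_module_value[OF \<open>cring F\<close>, of _ X]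
  have addc: "(\<lambda>x. f x \<oplus>\<^bsub>F\<^esub> g x) \<in> carrier (free_module F X)"
    if "f \<in> carrier (free_module F X)" "g \<in> carrier (free_module F X)" for f g
  proof -
    have "{x. f x \<oplus>\<^bsub>F\<^esub> g x \<noteq> \<zero>\<^bsub>F\<^esub>} \<subseteq> {x. f x \<noteq> \<zero>\<^bsub>F\<^esub>} \<union> {x. g x \<noteq> \<zero>\<^bsub>F\<^esub>}" by auto
    then show ?thesis using that by (auto simp: free_module_carrier elim: finite_subset)
  qed
  have smc: "(\<lambda>x. a \<otimes>\<^bsub>F\<^esub> f x) \<in> carrier (free_module F X)"
    if "f \<in> carrier (free_module F X)" "a \<in> carrier F" for f a
  proof -
    have "{x. a \<otimes>\<^bsub>F\<^esub> f x \<noteq> \<zero>\<^bsub>F\<^esub>} \<subseteq> {x. f x \<noteq> \<zero>\<^bsub>F\<^esub>}" using that by auto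
    then show ?thesis using that by (auto simp: free_module_carrier elim: finite_subset)
  qed
  show ?thesis
  proof (rule moduleI)
    show "abelian_group (free_module F X)"
    proof (rule abelian_groupI)
      fix f assume f: "f \<in> carrier (free_module F X)"
      have "(\<lambda>x. \<ominus>\<^bsub>F\<^esub> \<one>\<^bsub>F\<^esub> \<otimes>\<^bsub>F\<^esub> f x) \<in> carrier (free_module F X)" using f by (intro smc) auto
      moreover have "(\<lambda>x. \<ominus>\<^bsub>F\<^esub> \<one>\<^bsub>F\<^esub> \<otimes>\<^bsub>F\<^esub> f x) \<oplus>\<^bsub>free_module F X\<^esub> f = \<zero>\<^bsub>free_module F X\<^esub>"
        using val[OF f] by (simp add: l_minus l_neg)
      ultimately show "\<exists>y\<in>carrier (free_module F X). y \<oplus>\<^bsub>free_module F X\<^esub> f = \<zero>\<^bsub>free_module F X\<^esub>"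
        by blast
    qed (auto simp: val a_ac addc fun_eq_iff, auto simp: free_module_carrier)
  qed (auto simp: val smc fun_eq_iff l_distr r_distr m_assoc \<open>cring F\<close>)
qed

lemma free_gen_closed: "cring F \<Longrightarrow> x \<in> X \<Longrightarrow> free_gen F x \<in> carrier (free_module F X)"
proof -
  assume "cring F" "x \<in> X"
  then interpret cring F by simp
  show ?thesis
    using \<open>x \<in> X\<close> by (auto simp: free_gen_def free_module_carrier intro: finite_subset[of _ "{x}"])
qed

text \<open>
  Removing one point of the support at a time, every finitely supported function is built up from
  multiples of basis elements.
\<close>

lemma free_module_induct [consumes 2, case_names zero add]:
  assumes "cring F" and "f \<in> carrier (free_module F X)"
    and zero: "P (\<lambda>x. \<zero>\<^bsub>F\<^esub>)"
    and add: "\<And>a x g. \<lbrakk>a \<in> carrier F; x \<in> X; g \<in> carrier (free_module F X); P g\<rbrakk> \<Longrightarrow>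
        P (a \<odot>\<^bsub>free_module F X\<^esub> free_gen F x \<oplus>\<^bsub>free_module F X\<^esub> g)"
  shows "P f"
proof -
  interpret cring F by fact
  have "P f" if "finite S" "f \<in> carrier (free_module F X)" "{x. f x \<noteq> \<zero>\<^bsub>F\<^esub>} \<subseteq> S" for S f
    using that
  proof (induction S arbitrary: f rule: finite_induct)
    case empty
    then have "f = (\<lambda>x. \<zero>\<^bsub>F\<^esub>)" by auto
    then show ?case using zero by simp
  next
    case (insert s S)
    show ?case
    proof (cases "f s = \<zero>\<^bsub>F\<^esub>")
      case True
      then show ?thesis using insert by auto
    next
      case False
      then have s: "s \<in> X" using insert.prems by (auto simp: free_module_carrier)
      let ?g = "f(s := \<zero>\<^bsub>F\<^esub>)"
      have "{x. ?g x \<noteq> \<zero>\<^bsub>F\<^esub>} \<subseteq> {x. f x \<noteq> \<zero>\<^bsub>F\<^esub>}" by auto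
      then have g: "?g \<in> carrier (free_module F X)"
        using insert.prems(1) finite_subset[of "{x. ?g x \<noteq> \<zero>\<^bsub>F\<^esub>}" "{x. f x \<noteq> \<zero>\<^bsub>F\<^esub>}"]
        by (auto simp: free_module_carrier)
      moreover have "P ?g" by (rule insert.IH[OF g]) (use insert.prems in auto)
      ultimately have "P (f s \<odot>\<^bsub>free_module F X\<^esub> free_gen F s \<oplus>\<^bsub>free_module F X\<^esub> ?g)"
        using s insert.prems by (intro add) (auto simp: free_module_value[OF \<open>cring F\<close>])
      moreover have "f s \<odot>\<^bsub>free_module F X\<^esub> free_gen F s \<oplus>\<^bsub>free_module F X\<^esub> ?g = f"
        using free_module_value[OF \<open>cring F\<close> insert.prems(1)] by (auto simp: free_gen_def)
      ultimately show ?thesis by simp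
    qed
  qed
  then show ?thesis using assms(2) by (auto simp: free_module_carrier)
qed

text \<open>
  The linear extension of a map on the basis, written with the formula that \<open>tlift\<close> applies to a
  representative of a coset.
\<close>

definition free_lift :: "('f, 'm) ring_scheme \<Rightarrow> ('f, 'u, 'n) module_scheme \<Rightarrow> ('x \<Rightarrow> 'u) \<Rightarrow> ('x \<Rightarrow> 'f) \<Rightarrow> 'u" where
  "free_lift F U \<phi> f = (\<Oplus>\<^bsub>U\<^esub>p\<in>{p. f p \<noteq> \<zero>\<^bsub>F\<^esub>}. f p \<odot>\<^bsub>U\<^esub> \<phi> p)"

text \<open>
  Allowing summation over any finite set containing the support is what makes additivity accessible:
  the supports of two functions and of their sum all lie in one finite set.
\<close>

lemma free_lift_superset:
  assumes "module F U" "f \<in> carrier (free_module F X)" "\<phi> \<in> X \<rightarrow> carrier U"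
    and "finite S" "{p. f p \<noteq> \<zero>\<^bsub>F\<^esub>} \<subseteq> S" "S \<subseteq> X"
  shows "free_lift F U \<phi> f = (\<Oplus>\<^bsub>U\<^esub>p\<in>S. f p \<odot>\<^bsub>U\<^esub> \<phi> p)"
proof -
  interpret module F U by fact
  have "cring F" by unfold_locales
  show ?thesis
    unfolding free_lift_def
    using assms free_module_value[OF \<open>cring F\<close> assms(2)] finite_subset[OF assms(5,4)]
    by (intro M.add.finprod_mono_neutral_cong) (auto simp: Pi_iff subset_iff)
qed

lemma free_lift_linear:
  assumes "module F U" "\<phi> \<in> X \<rightarrow> carrier U"
  shows "free_lift F U \<phi> \<in> linear_maps F (free_module F X) U"
proof (rule linear_mapsI)
  interpret module F U by fact
  have cr: "cring F" by unfold_locales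
  interpret Fr: module F "free_module F X" by (rule free_module_module[OF cr])
  note val = free_module_value[OF cr, of _ X]
  fix f assume f: "f \<in> carrier (free_module F X)"
  show "free_lift F U \<phi> f \<in> carrier U"
    unfolding free_lift_def using assms f
    by (intro M.finsum_closed) (auto simp: val free_module_carrier Pi_iff)
  show "free_lift F U \<phi> (a \<odot>\<^bsub>free_module F X\<^esub> f) = a \<odot>\<^bsub>U\<^esub> free_lift F U \<phi> f" if a: "a \<in> carrier F" for a
  proof -
    let ?S = "{p. f p \<noteq> \<zero>\<^bsub>F\<^esub>}"
    have fin: "finite ?S" "?S \<subseteq> X" using f by (auto simp: free_module_carrier)
    have "free_lift F U \<phi> (a \<odot>\<^bsub>free_module F X\<^esub> f) = (\<Oplus>\<^bsub>U\<^esub>p\<in>?S. (a \<otimes>\<^bsub>F\<^esub> f p) \<odot>\<^bsub>U\<^esub> \<phi> p)"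
      using a fin Fr.smult_closed[OF a f]
      by (subst free_lift_superset[OF assms(1) _ assms(2), of _ ?S]) auto
    also have "\<dots> = (\<Oplus>\<^bsub>U\<^esub>p\<in>?S. a \<odot>\<^bsub>U\<^esub> (f p \<odot>\<^bsub>U\<^esub> \<phi> p))"
      using a fin assms(2) by (intro M.finsum_cong') (auto simp: smult_assoc1 val[OF f] Pi_iff)
    also have "\<dots> = a \<odot>\<^bsub>U\<^esub> free_lift F U \<phi> f"
      unfolding free_lift_def using a fin assms(2)
      by (subst finsum_smult_ldistr) (auto simp: val[OF f] Pi_iff)
    finally show ?thesis .
  qed
  fix g assume g: "g \<in> carrier (free_module F X)"
  let ?S = "{p. f p \<noteq> \<zero>\<^bsub>F\<^esub>} \<union> {p. g p \<noteq> \<zero>\<^bsub>F\<^esub>}"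
  have fin: "finite ?S" "?S \<subseteq> X" using f g by (auto simp: free_module_carrier)
  have "free_lift F U \<phi> (f \<oplus>\<^bsub>free_module F X\<^esub> g) = (\<Oplus>\<^bsub>U\<^esub>p\<in>?S. (f p \<oplus>\<^bsub>F\<^esub> g p) \<odot>\<^bsub>U\<^esub> \<phi> p)"
    using fin Fr.M.a_closed[OF f g]
    by (subst free_lift_superset[OF assms(1) _ assms(2), of _ ?S]) auto
  also have "\<dots> = (\<Oplus>\<^bsub>U\<^esub>p\<in>?S. (f p \<odot>\<^bsub>U\<^esub> \<phi> p) \<oplus>\<^bsub>U\<^esub> (g p \<odot>\<^bsub>U\<^esub> \<phi> p))"
    using fin assms(2) by (intro M.finsum_cong') (auto simp: smult_l_distr val[OF f] val[OF g] Pi_iff)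
  also have "\<dots> = (\<Oplus>\<^bsub>U\<^esub>p\<in>?S. f p \<odot>\<^bsub>U\<^esub> \<phi> p) \<oplus>\<^bsub>U\<^esub> (\<Oplus>\<^bsub>U\<^esub>p\<in>?S. g p \<odot>\<^bsub>U\<^esub> \<phi> p)"
    using fin assms(2) by (intro M.finsum_addf) (auto simp: val[OF f] val[OF g] Pi_iff)
  also have "\<dots> = free_lift F U \<phi> f \<oplus>\<^bsub>U\<^esub> free_lift F U \<phi> g"
    using fin free_lift_superset[OF assms(1) f assms(2), of ?S] free_lift_superset[OF assms(1) g assms(2), of ?S]
    by simp
  finally show "free_lift F U \<phi> (f \<oplus>\<^bsub>free_module F X\<^esub> g) = free_lift F U \<phi> f \<oplus>\<^bsub>U\<^esub> free_lift F U \<phi> g" .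
qed

lemma free_lift_gen:
  assumes "module F U" "x \<in> X" "\<phi> \<in> X \<rightarrow> carrier U"
  shows "free_lift F U \<phi> (free_gen F x) = \<phi> x"
proof -
  interpret module F U by fact
  have cr: "cring F" by unfold_locales
  have "free_lift F U \<phi> (free_gen F x) = (\<Oplus>\<^bsub>U\<^esub>p\<in>{x}. free_gen F x p \<odot>\<^bsub>U\<^esub> \<phi> p)"
    using assms by (intro free_lift_superset[OF assms(1) _ assms(3)] free_gen_closed[OF cr]) (auto simp: free_gen_def)
  also have "\<dots> = \<phi> x"
  proof -
    have "\<phi> x \<in> carrier U" using assms by auto
    then show ?thesis
      by (subst M.finsum_insert[of "{}", simplified]) (auto simp: free_gen_def)
  qed
  finally show ?thesis .
qed

text \<open>The module axioms are equations, so they pass to any structure onto which a module maps.\<close>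

lemma module_surjection:
  assumes "module F M" and surj: "\<pi> ` carrier M = carrier Q"
    and add: "\<And>x y. \<lbrakk>x \<in> carrier M; y \<in> carrier M\<rbrakk> \<Longrightarrow> \<pi> x \<oplus>\<^bsub>Q\<^esub> \<pi> y = \<pi> (x \<oplus>\<^bsub>M\<^esub> y)"
    and zero: "\<zero>\<^bsub>Q\<^esub> = \<pi> \<zero>\<^bsub>M\<^esub>"
    and smult: "\<And>a x. \<lbrakk>a \<in> carrier F; x \<in> carrier M\<rbrakk> \<Longrightarrow> a \<odot>\<^bsub>Q\<^esub> \<pi> x = \<pi> (a \<odot>\<^bsub>M\<^esub> x)"
  shows "module F Q"
proof -
  interpret module F M by fact
  have mem: "\<pi> x \<in> carrier Q" if "x \<in> carrier M" for x using that surj by blast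
  show ?thesis
  proof (rule moduleI)
    show "cring F" by unfold_locales
    show "abelian_group Q"
    proof (rule abelian_groupI)
      fix x assume "x \<in> carrier Q"
      then obtain u where "u \<in> carrier M" "x = \<pi> u" using surj by blast
      then have "\<pi> (\<ominus>\<^bsub>M\<^esub> u) \<oplus>\<^bsub>Q\<^esub> x = \<zero>\<^bsub>Q\<^esub>" "\<pi> (\<ominus>\<^bsub>M\<^esub> u) \<in> carrier Q"
        by (auto simp: add zero M.l_neg mem)
      then show "\<exists>y\<in>carrier Q. y \<oplus>\<^bsub>Q\<^esub> x = \<zero>\<^bsub>Q\<^esub>" by blast
    qed (auto simp: surj[symmetric] zero add mem M.a_ac)
  qed (auto simp: surj[symmetric] zero add smult mem smult_l_distr smult_r_distr smult_assoc1)
qed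

context
  fixes F :: "('f, 'm) ring_scheme" and M :: "('f, 'v, 'n) module_scheme" and N
  assumes M: "module F M" and N: "submodule N F M"
begin

interpretation module F M by (rule M)

interpretation N: abelian_subgroup N M
  using N by (intro abelian_subgroupI3 additive_subgroupI) (auto simp: submodule_def M.abelian_group_axioms)

text \<open>
  Scalar multiplication on the quotient is defined as a union over a coset; all members of that union
  coincide, since \<open>N\<close> is closed under scalars.
\<close>

lemma coset_smult:
  assumes "a \<in> carrier F" "f \<in> carrier M"
  shows "(\<Union>x\<in>N +>\<^bsub>M\<^esub> f. N +>\<^bsub>M\<^esub> (a \<odot>\<^bsub>M\<^esub> x)) = N +>\<^bsub>M\<^esub> (a \<odot>\<^bsub>M\<^esub> f)"
proof -
  have "N +>\<^bsub>M\<^esub> (a \<odot>\<^bsub>M\<^esub> x) = N +>\<^bsub>M\<^esub> (a \<odot>\<^bsub>M\<^esub> f)" if x: "x \<in> N +>\<^bsub>M\<^esub> f" for x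
  proof -
    obtain n where n: "n \<in> N" "x = n \<oplus>\<^bsub>M\<^esub> f" using x by (auto simp: a_r_coset_def')
    then have nM: "n \<in> carrier M" by auto
    have "a \<odot>\<^bsub>M\<^esub> n \<in> N" by (rule submodule.smult_closed[OF N]) (use assms n in auto)
    moreover have "a \<odot>\<^bsub>M\<^esub> x = a \<odot>\<^bsub>M\<^esub> n \<oplus>\<^bsub>M\<^esub> a \<odot>\<^bsub>M\<^esub> f"
      using n nM assms by (simp add: smult_r_distr)
    ultimately have "a \<odot>\<^bsub>M\<^esub> x \<in> N +>\<^bsub>M\<^esub> (a \<odot>\<^bsub>M\<^esub> f)" by (auto simp: a_r_coset_def')
    then show ?thesis using N.a_repr_independence'[of _ "a \<odot>\<^bsub>M\<^esub> f"] assms by auto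
  qed
  then show ?thesis using N.a_rcos_self[OF assms(2)] by blast
qed

lemma quotient_module_simps:
  "carrier (quotient_module M N) = (\<lambda>f. N +>\<^bsub>M\<^esub> f) ` carrier M"
  "f \<in> carrier M \<Longrightarrow> g \<in> carrier M \<Longrightarrow>
     (N +>\<^bsub>M\<^esub> f) \<oplus>\<^bsub>quotient_module M N\<^esub> (N +>\<^bsub>M\<^esub> g) = N +>\<^bsub>M\<^esub> (f \<oplus>\<^bsub>M\<^esub> g)"
  "\<zero>\<^bsub>quotient_module M N\<^esub> = N +>\<^bsub>M\<^esub> \<zero>\<^bsub>M\<^esub>"
  "a \<in> carrier F \<Longrightarrow> f \<in> carrier M \<Longrightarrow>
     a \<odot>\<^bsub>quotient_module M N\<^esub> (N +>\<^bsub>M\<^esub> f) = N +>\<^bsub>M\<^esub> (a \<odot>\<^bsub>M\<^esub> f)"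
  by (auto simp: quotient_module_def A_RCOSETS_def' N.a_rcos_sum coset_smult N.a_subset M.a_coset_add_zero)

lemma quotient_module_module: "module F (quotient_module M N)"
  by (rule module_surjection[OF M, where \<pi> = "\<lambda>f. N +>\<^bsub>M\<^esub> f"]) (auto simp: quotient_module_simps)

lemma coset_eqI:
  assumes "f \<in> carrier M" "g \<in> carrier M" "f \<ominus>\<^bsub>M\<^esub> g \<in> N"
  shows "N +>\<^bsub>M\<^esub> f = N +>\<^bsub>M\<^esub> g"
proof -
  have "f = (f \<ominus>\<^bsub>M\<^esub> g) \<oplus>\<^bsub>M\<^esub> g" using assms by (simp add: a_minus_def M.a_assoc M.l_neg)
  then have "f \<in> N +>\<^bsub>M\<^esub> g" using assms by (auto simp: a_r_coset_def')
  then show ?thesis using N.a_repr_independence'[of f g] assms by simp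
qed

lemma coset_memD:
  assumes "f \<in> carrier M" "h \<in> N +>\<^bsub>M\<^esub> f"
  obtains n where "n \<in> N" "n \<in> carrier M" "h = n \<oplus>\<^bsub>M\<^esub> f"
  using assms N.a_subset by (auto simp: a_r_coset_def')

lemma coset_self: "f \<in> carrier M \<Longrightarrow> f \<in> N +>\<^bsub>M\<^esub> f"
  by (rule N.a_rcos_self)

end

section \<open>The universal property of the tensor product\<close>

lemma submodule_span_incl: "A \<subseteq> submodule_span F M A"
  by (auto simp: submodule_span_def)

lemma submodule_span_least: "submodule K F M \<Longrightarrow> A \<subseteq> K \<Longrightarrow> submodule_span F M A \<subseteq> K"
  by (auto simp: submodule_span_def)

lemma submodule_span_submodule:
  assumes "module F M" "A \<subseteq> carrier M"
  shows "submodule (submodule_span F M A) F M"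
proof -
  interpret module F M by fact
  show ?thesis
  proof (rule submoduleI)
    show "submodule_span F M A \<subseteq> carrier M"
      by (rule submodule_span_least[OF carrier_is_submodule assms(2)])
  qed (auto simp: submodule_span_def submoduleE dest: submodule.smult_closed
      intro: subgroup.one_closed[of _ "add_monoid M", simplified] dest: submodule.axioms(1))
qed

context
  fixes F :: "('f, 'm) ring_scheme" and V :: "('f, 'v, 'n) module_scheme" and W :: "('f, 'w, 'p) module_scheme"
  assumes V: "module F V" and W: "module F W"
begin

interpretation V: module F V by (rule V)
interpretation W: module F W by (rule W)

private abbreviation "M \<equiv> free_module F (carrier V \<times> carrier W)"
private abbreviation "N \<equiv> tensor_null F V W"

private lemma cring_F: "cring F" by unfold_locales

private lemma M_module: "module F M" by (rule free_module_module[OF cring_F])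

interpretation M: module F M by (rule M_module)

private lemma gen: "v \<in> carrier V \<Longrightarrow> w \<in> carrier W \<Longrightarrow> free_gen F (v, w) \<in> carrier M"
  by (rule free_gen_closed[OF cring_F]) auto

private lemma relators_carrier: "tensor_relators F V W \<subseteq> carrier M"
  unfolding tensor_relators_def Let_def
  by (auto simp del: free_module_simps intro!: M.M.minus_closed M.M.a_closed M.smult_closed gen)

private lemma N_submodule: "submodule N F M"
  unfolding tensor_null_def by (rule submodule_span_submodule[OF M_module relators_carrier])

private lemmas coset = coset_eqI[OF M_module N_submodule]
private lemmas quot = quotient_module_simps[OF M_module N_submodule, folded tensor_def]

lemma tensor_module: "module F (tensor F V W)"
  unfolding tensor_def by (rule quotient_module_module[OF M_module N_submodule])

text \<open>
  Each of the four families of relators is one of the identities required of a bilinear map.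
\<close>

lemma tens_bilinear: "tens F V W \<in> bilinear_maps F V W (tensor F V W)"
proof -
  have rel: "x \<in> tensor_relators F V W \<Longrightarrow> x \<in> N" for x
    unfolding tensor_null_def by (rule subsetD[OF submodule_span_incl])
  have cl: "tens F V W v w \<in> carrier (tensor F V W)" if "v \<in> carrier V" "w \<in> carrier W" for v w
    using that by (auto simp: tens_def quot gen)
  have eq: "N +>\<^bsub>M\<^esub> f = N +>\<^bsub>M\<^esub> g"
    if "f \<ominus>\<^bsub>M\<^esub> g \<in> tensor_relators F V W" "f \<in> carrier M" "g \<in> carrier M" for f g
    using that by (intro coset rel)
  have "tens F V W (v \<oplus>\<^bsub>V\<^esub> v') w = tens F V W v w \<oplus>\<^bsub>tensor F V W\<^esub> tens F V W v' w"
    if [simp]: "v \<in> carrier V" "v' \<in> carrier V" "w \<in> carrier W" for v v' w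
  proof -
    have "tens F V W (v \<oplus>\<^bsub>V\<^esub> v') w = N +>\<^bsub>M\<^esub> (free_gen F (v, w) \<oplus>\<^bsub>M\<^esub> free_gen F (v', w))"
      unfolding tens_def
    proof (rule eq)
      show "free_gen F (v \<oplus>\<^bsub>V\<^esub> v', w) \<ominus>\<^bsub>M\<^esub> (free_gen F (v, w) \<oplus>\<^bsub>M\<^esub> free_gen F (v', w)) \<in> tensor_relators F V W"
        unfolding tensor_relators_def Let_def using that by blast
    qed (simp_all add: gen M.M.a_closed del: free_module_simps)
    then show ?thesis by (simp add: quot gen tens_def del: free_module_simps)
  qed
  moreover have "tens F V W v (w \<oplus>\<^bsub>W\<^esub> w') = tens F V W v w \<oplus>\<^bsub>tensor F V W\<^esub> tens F V W v w'"
    if [simp]: "v \<in> carrier V" "w \<in> carrier W" "w' \<in> carrier W" for v w w'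
  proof -
    have "tens F V W v (w \<oplus>\<^bsub>W\<^esub> w') = N +>\<^bsub>M\<^esub> (free_gen F (v, w) \<oplus>\<^bsub>M\<^esub> free_gen F (v, w'))"
      unfolding tens_def
    proof (rule eq)
      show "free_gen F (v, w \<oplus>\<^bsub>W\<^esub> w') \<ominus>\<^bsub>M\<^esub> (free_gen F (v, w) \<oplus>\<^bsub>M\<^esub> free_gen F (v, w')) \<in> tensor_relators F V W"
        unfolding tensor_relators_def Let_def using that by blast
    qed (simp_all add: gen M.M.a_closed del: free_module_simps)
    then show ?thesis by (simp add: quot gen tens_def del: free_module_simps)
  qed
  moreover have "tens F V W (a \<odot>\<^bsub>V\<^esub> v) w = a \<odot>\<^bsub>tensor F V W\<^esub> tens F V W v w"
    if [simp]: "a \<in> carrier F" "v \<in> carrier V" "w \<in> carrier W" for a v w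
  proof -
    have "tens F V W (a \<odot>\<^bsub>V\<^esub> v) w = N +>\<^bsub>M\<^esub> (a \<odot>\<^bsub>M\<^esub> free_gen F (v, w))"
      unfolding tens_def
    proof (rule eq)
      show "free_gen F (a \<odot>\<^bsub>V\<^esub> v, w) \<ominus>\<^bsub>M\<^esub> a \<odot>\<^bsub>M\<^esub> free_gen F (v, w) \<in> tensor_relators F V W"
        unfolding tensor_relators_def Let_def using that by blast
    qed (simp_all add: gen M.smult_closed del: free_module_simps)
    then show ?thesis by (simp add: quot gen tens_def del: free_module_simps)
  qed
  moreover have "tens F V W v (a \<odot>\<^bsub>W\<^esub> w) = a \<odot>\<^bsub>tensor F V W\<^esub> tens F V W v w"
    if [simp]: "a \<in> carrier F" "v \<in> carrier V" "w \<in> carrier W" for a v w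
  proof -
    have "tens F V W v (a \<odot>\<^bsub>W\<^esub> w) = N +>\<^bsub>M\<^esub> (a \<odot>\<^bsub>M\<^esub> free_gen F (v, w))"
      unfolding tens_def
    proof (rule eq)
      show "free_gen F (v, a \<odot>\<^bsub>W\<^esub> w) \<ominus>\<^bsub>M\<^esub> a \<odot>\<^bsub>M\<^esub> free_gen F (v, w) \<in> tensor_relators F V W"
        unfolding tensor_relators_def Let_def using that by blast
    qed (simp_all add: gen M.smult_closed del: free_module_simps)
    then show ?thesis by (simp add: quot gen tens_def del: free_module_simps)
  qed
  ultimately show ?thesis
    by (intro bilinear_mapsI linear_mapsI cl) auto
qed

text \<open>
  Scalars can be absorbed into the left factor, so pure tensors generate the tensor product additively.
\<close>

lemma tensor_induct [consumes 1, case_names tens add]: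
  assumes "x \<in> carrier (tensor F V W)"
    and P: "\<And>v w. \<lbrakk>v \<in> carrier V; w \<in> carrier W\<rbrakk> \<Longrightarrow> P (tens F V W v w)"
    and add: "\<And>x y. \<lbrakk>x \<in> carrier (tensor F V W); y \<in> carrier (tensor F V W); P x; P y\<rbrakk> \<Longrightarrow>
        P (x \<oplus>\<^bsub>tensor F V W\<^esub> y)"
  shows "P x"
proof -
  obtain f where f: "f \<in> carrier M" "x = N +>\<^bsub>M\<^esub> f"
    using assms(1) by (auto simp: quot)
  have "P (N +>\<^bsub>M\<^esub> f)"
    using cring_F f(1)
  proof (induction f rule: free_module_induct)
    case zero
    have "tens F V W \<zero>\<^bsub>V\<^esub> \<zero>\<^bsub>W\<^esub> = \<zero>\<^bsub>tensor F V W\<^esub>"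
      by (rule linear_zero[OF W tensor_module bilinear_right[OF tens_bilinear]]) auto
    then have "P \<zero>\<^bsub>tensor F V W\<^esub>" using P[of "\<zero>\<^bsub>V\<^esub>" "\<zero>\<^bsub>W\<^esub>"] by simp
    then show ?case by (simp add: quot)
  next
    case (add a p g)
    obtain v w where p: "p = (v, w)" "v \<in> carrier V" "w \<in> carrier W" using add.hyps by auto
    have "N +>\<^bsub>M\<^esub> (a \<odot>\<^bsub>M\<^esub> free_gen F p \<oplus>\<^bsub>M\<^esub> g) =
        a \<odot>\<^bsub>tensor F V W\<^esub> tens F V W v w \<oplus>\<^bsub>tensor F V W\<^esub> (N +>\<^bsub>M\<^esub> g)"
      using add.hyps p gen
      by (simp add: quot tens_def M.smult_closed del: free_module_simps)
    also have "a \<odot>\<^bsub>tensor F V W\<^esub> tens F V W v w = tens F V W (a \<odot>\<^bsub>V\<^esub> v) w"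
      using p add.hyps by (simp add: linear_smult[OF bilinear_left[OF tens_bilinear]])
    finally show ?case
      using p add bilinear_closed[OF tens_bilinear] by (auto simp: quot intro!: assms(3) P)
  qed
  then show ?thesis by (simp add: f)
qed

context
  fixes U :: "('f, 'u, 'q) module_scheme" and \<beta>
  assumes U: "module F U" and \<beta>: "\<beta> \<in> bilinear_maps F V W U"
begin

interpretation U: module F U by (rule U)

private abbreviation "L \<equiv> free_lift F U (\<lambda>p. \<beta> (fst p) (snd p))"

private lemma \<beta>_closed: "(\<lambda>p. \<beta> (fst p) (snd p)) \<in> carrier V \<times> carrier W \<rightarrow> carrier U"
  using bilinear_closed[OF \<beta>] by auto

private lemma L_linear: "L \<in> linear_maps F M U"
  by (rule free_lift_linear[OF U \<beta>_closed])

private lemma L_gen: "v \<in> carrier V \<Longrightarrow> w \<in> carrier W \<Longrightarrow> L (free_gen F (v, w)) = \<beta> v w"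
  using free_lift_gen[OF U _ \<beta>_closed, of "(v, w)"] by simp

private lemma L_minus: "f \<in> carrier M \<Longrightarrow> g \<in> carrier M \<Longrightarrow> L (f \<ominus>\<^bsub>M\<^esub> g) = L f \<oplus>\<^bsub>U\<^esub> \<ominus>\<^bsub>U\<^esub> L g"
  by (simp add: a_minus_def linear_add[OF L_linear] linear_minus[OF M_module U L_linear] del: free_module_simps)

text \<open>
  Bilinearity of \<open>\<beta>\<close> says that the linear extension kills the relators; its kernel is a submodule, so it
  kills their span.
\<close>

private lemma L_null: "n \<in> N \<Longrightarrow> L n = \<zero>\<^bsub>U\<^esub>"
proof -
  have bl: "\<beta> v w \<in> carrier U" if "v \<in> carrier V" "w \<in> carrier W" for v w
    using bilinear_closed[OF \<beta>] that .
  have "L x = \<zero>\<^bsub>U\<^esub>" if "x \<in> tensor_relators F V W" for x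
    using that unfolding tensor_relators_def Let_def
    by (elim UnE CollectE exE conjE)
      (simp_all add: L_minus L_gen gen M.M.a_closed M.smult_closed bl
        linear_add[OF L_linear] linear_smult[OF L_linear]
        linear_add[OF bilinear_left[OF \<beta>]] linear_add[OF bilinear_right[OF \<beta>]]
        linear_smult[OF bilinear_left[OF \<beta>]] linear_smult[OF bilinear_right[OF \<beta>]]
        U.M.r_neg del: free_module_simps)
  then have "tensor_relators F V W \<subseteq> {x \<in> carrier M. L x = \<zero>\<^bsub>U\<^esub>}"
    using relators_carrier by blast
  then have "N \<subseteq> {x \<in> carrier M. L x = \<zero>\<^bsub>U\<^esub>}"
    unfolding tensor_null_def
    by (rule submodule_span_least[OF kernel_submodule[OF M_module U L_linear]])
  then show "n \<in> N \<Longrightarrow> L n = \<zero>\<^bsub>U\<^esub>" by blast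
qed

text \<open>
  The representative chosen by \<open>SOME\<close> differs from \<open>f\<close> by an element of the null space, where the linear
  extension vanishes.
\<close>

private lemma tlift_coset: "f \<in> carrier M \<Longrightarrow> tlift F U \<beta> (N +>\<^bsub>M\<^esub> f) = L f"
proof -
  assume f: "f \<in> carrier M"
  define g where "g = (SOME g. g \<in> N +>\<^bsub>M\<^esub> f)"
  have "g \<in> N +>\<^bsub>M\<^esub> f"
    unfolding g_def using coset_self[OF M_module N_submodule f] by (rule someI[of "\<lambda>g. g \<in> N +>\<^bsub>M\<^esub> f"])
  then obtain n where n: "n \<in> N" "n \<in> carrier M" "g = n \<oplus>\<^bsub>M\<^esub> f"
    by (rule coset_memD[OF M_module N_submodule f])
  have "tlift F U \<beta> (N +>\<^bsub>M\<^esub> f) = L g"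
    by (simp add: tlift_def free_lift_def g_def Let_def)
  also have "\<dots> = L f"
    using n f by (simp add: linear_add[OF L_linear] L_null linear_closed[OF L_linear] del: free_module_simps)
  finally show ?thesis .
qed

lemma tlift_linear: "tlift F U \<beta> \<in> linear_maps F (tensor F V W) U"
  by (rule linear_mapsI)
    (auto simp: quot tlift_coset linear_closed[OF L_linear] linear_add[OF L_linear] linear_smult[OF L_linear]
      M.M.a_closed M.smult_closed simp del: free_module_simps)

lemma tlift_tens: "\<lbrakk>v \<in> carrier V; w \<in> carrier W\<rbrakk> \<Longrightarrow> tlift F U \<beta> (tens F V W v w) = \<beta> v w"
  by (simp add: tens_def tlift_coset gen L_gen)

end

lemmas tens_closed = bilinear_closed[OF tens_bilinear]

lemma linear_tensor_eq:
  assumes f: "f \<in> linear_maps F (tensor F V W) U" and g: "g \<in> linear_maps F (tensor F V W) U"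
    and "\<And>v w. \<lbrakk>v \<in> carrier V; w \<in> carrier W\<rbrakk> \<Longrightarrow> f (tens F V W v w) = g (tens F V W v w)"
    and "x \<in> carrier (tensor F V W)"
  shows "f x = g x"
  using assms(4)
proof (induction rule: tensor_induct)
  case (add x y)
  then show ?case using linear_add[OF f] linear_add[OF g] by metis
qed (simp add: assms(3))

end

text \<open>
  If \<open>\<beta> u\<close> depends linearly on a further parameter \<open>u\<close>, so does its lift; this is what makes
  nested lifts linear in all their arguments.
\<close>

lemma tlift_linear_param:
  assumes V: "module F V" and W: "module F W" and U: "module F U" and T: "module F T"
    and \<beta>: "\<And>u. u \<in> carrier T \<Longrightarrow> \<beta> u \<in> bilinear_maps F V W U"
    and lin: "\<And>v w. \<lbrakk>v \<in> carrier V; w \<in> carrier W\<rbrakk> \<Longrightarrow> (\<lambda>u. \<beta> u v w) \<in> linear_maps F T U"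
    and x: "x \<in> carrier (tensor F V W)"
  shows "(\<lambda>u. tlift F U (\<beta> u) x) \<in> linear_maps F T U"
proof -
  interpret U: module F U by (rule U)
  interpret T: module F T by (rule T)
  note lift = tlift_linear[OF V W U \<beta>]
  show ?thesis
  proof (rule linear_mapsI)
    fix u assume u: "u \<in> carrier T"
    show "tlift F U (\<beta> u) x \<in> carrier U" by (rule linear_closed[OF lift[OF u] x])
    show "tlift F U (\<beta> (a \<odot>\<^bsub>T\<^esub> u)) x = a \<odot>\<^bsub>U\<^esub> tlift F U (\<beta> u) x" if a: "a \<in> carrier F" for a
    proof (rule linear_tensor_eq[OF V W lift _ _ x])
      show "(\<lambda>x. a \<odot>\<^bsub>U\<^esub> tlift F U (\<beta> u) x) \<in> linear_maps F (tensor F V W) U"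
        using a linear_closed[OF lift[OF u]]
        by (intro linear_mapsI)
          (auto simp: linear_add[OF lift[OF u]] linear_smult[OF lift[OF u]] U.smult_r_distr
            U.smult_assoc1[symmetric] U.R.m_comm)
    qed (use a u lin in \<open>auto simp: tlift_tens[OF V W U \<beta>] linear_smult[OF lin]\<close>)
    fix u' assume u': "u' \<in> carrier T"
    show "tlift F U (\<beta> (u \<oplus>\<^bsub>T\<^esub> u')) x = tlift F U (\<beta> u) x \<oplus>\<^bsub>U\<^esub> tlift F U (\<beta> u') x"
    proof (rule linear_tensor_eq[OF V W lift _ _ x])
      show "(\<lambda>x. tlift F U (\<beta> u) x \<oplus>\<^bsub>U\<^esub> tlift F U (\<beta> u') x) \<in> linear_maps F (tensor F V W) U"
        using linear_closed[OF lift[OF u]] linear_closed[OF lift[OF u']]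
        by (intro linear_mapsI)
          (auto simp: linear_add[OF lift[OF u]] linear_smult[OF lift[OF u]] linear_add[OF lift[OF u']]
            linear_smult[OF lift[OF u']] U.smult_r_distr U.M.a_ac)
    qed (use u u' lin in \<open>auto simp: tlift_tens[OF V W U \<beta>] linear_add[OF lin]\<close>)
  qed
qed

lemma linear_tens_left: 
  assumes "module F V" "module F W" "f \<in> linear_maps F U V" "w \<in> carrier W"
  shows "(\<lambda>u. tens F V W (f u) w) \<in> linear_maps F U (tensor F V W)"
  by (rule linear_compose[OF assms(3) bilinear_left[OF tens_bilinear[OF assms(1,2)] assms(4)]])

lemma linear_tens_right:
  assumes "module F V" "module F W" "f \<in> linear_maps F U W" "v \<in> carrier V"
  shows "(\<lambda>u. tens F V W v (f u)) \<in> linear_maps F U (tensor F V W)"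
  by (rule linear_compose[OF assms(3) bilinear_right[OF tens_bilinear[OF assms(1,2)] assms(4)]])

section \<open>Functoriality and associativity of the tensor product\<close>

context
  fixes F :: "('f, 'm) ring_scheme" and V :: "('f, 'v, 'n) module_scheme" and W :: "('f, 'w, 'p) module_scheme"
    and X :: "('f, 'x, 'q) module_scheme" and Y :: "('f, 'y, 'r) module_scheme" and f g
  assumes mods: "module F V" "module F W" "module F X" "module F Y"
    and f: "f \<in> linear_maps F X V" and g: "g \<in> linear_maps F Y W"
begin

private lemma bil: "(\<lambda>x y. tens F V W (f x) (g y)) \<in> bilinear_maps F X Y (tensor F V W)"
  using mods f g by (intro bilinear_mapsI linear_tens_left linear_tens_right) (auto simp: linear_closed)

lemma tmap_linear: "tmap F V W f g \<in> linear_maps F (tensor F X Y) (tensor F V W)"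
  unfolding tmap_def by (rule tlift_linear[OF mods(3,4) tensor_module[OF mods(1,2)] bil])

lemma tmap_tens: "\<lbrakk>x \<in> carrier X; y \<in> carrier Y\<rbrakk> \<Longrightarrow> tmap F V W f g (tens F X Y x y) = tens F V W (f x) (g y)"
  unfolding tmap_def by (rule tlift_tens[OF mods(3,4) tensor_module[OF mods(1,2)] bil])

end

context
  fixes F :: "('f, 'm) ring_scheme" and U :: "('f, 'u, 'n) module_scheme" and V :: "('f, 'v, 'p) module_scheme"
    and W :: "('f, 'w, 'q) module_scheme"
  assumes mods: "module F U" "module F V" "module F W"
begin

private lemma VW: "module F (tensor F V W)" and UV: "module F (tensor F U V)"
  and UVW: "module F (tensor F U (tensor F V W))" and UVW': "module F (tensor F (tensor F U V) W)"
  using mods by (auto intro: tensor_module)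

private lemma inner: 
  "w \<in> carrier W \<Longrightarrow> (\<lambda>u v. tens F U (tensor F V W) u (tens F V W v w)) \<in> bilinear_maps F U V (tensor F U (tensor F V W))"
  "u \<in> carrier U \<Longrightarrow> (\<lambda>v w. tens F (tensor F U V) W (tens F U V u v) w) \<in> bilinear_maps F V W (tensor F (tensor F U V) W)"
  using mods VW UV by (auto intro!: bilinear_mapsI linear_tens_left linear_tens_right linear_id simp: tens_closed)

private lemma assoc_bil: 
  "(\<lambda>x w. tlift F (tensor F U (tensor F V W)) (\<lambda>u v. tens F U (tensor F V W) u (tens F V W v w)) x)
     \<in> bilinear_maps F (tensor F U V) W (tensor F U (tensor F V W))"
  "(\<lambda>u. tlift F (tensor F (tensor F U V) W) (\<lambda>v w. tens F (tensor F U V) W (tens F U V u v) w))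
     \<in> bilinear_maps F U (tensor F V W) (tensor F (tensor F U V) W)"
  using mods VW UV UVW UVW' inner
  by (auto intro!: bilinear_mapsI linear_tens_left linear_tens_right linear_id tlift_linear tlift_linear_param simp: tens_closed)

lemma tassoc_linear: "tassoc F U V W \<in> linear_maps F (tensor F (tensor F U V) W) (tensor F U (tensor F V W))"
  unfolding tassoc_def Let_def by (rule tlift_linear[OF UV mods(3) UVW assoc_bil(1)])

lemma tassoc_tens:
  assumes "u \<in> carrier U" "v \<in> carrier V" "w \<in> carrier W"
  shows "tassoc F U V W (tens F (tensor F U V) W (tens F U V u v) w) = tens F U (tensor F V W) u (tens F V W v w)"
  unfolding tassoc_def Let_def 
  using assms mods by (simp add: tlift_tens[OF UV mods(3) UVW assoc_bil(1)] tlift_tens[OF mods(1,2) UVW inner(1)] tens_closed)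

lemma tassoc_inv_linear: "tassoc_inv F U V W \<in> linear_maps F (tensor F U (tensor F V W)) (tensor F (tensor F U V) W)"
  unfolding tassoc_inv_def Let_def by (rule tlift_linear[OF mods(1) VW UVW' assoc_bil(2)])

lemma tassoc_inv_tens:
  assumes "u \<in> carrier U" "v \<in> carrier V" "w \<in> carrier W"
  shows "tassoc_inv F U V W (tens F U (tensor F V W) u (tens F V W v w)) = tens F (tensor F U V) W (tens F U V u v) w"
  unfolding tassoc_inv_def Let_def 
  using assms mods by (simp add: tlift_tens[OF mods(1) VW UVW' assoc_bil(2)] tlift_tens[OF mods(2,3) UVW' inner(2)] tens_closed)

text \<open>A linear map on a triple tensor product is determined by its values on pure tensors.\<close>

lemma linear_tensor3_eq:
  assumes f: "f \<in> linear_maps F (tensor F (tensor F U V) W) T" and g: "g \<in> linear_maps F (tensor F (tensor F U V) W) T"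
    and eq: "\<And>u v w. \<lbrakk>u \<in> carrier U; v \<in> carrier V; w \<in> carrier W\<rbrakk> \<Longrightarrow>
        f (tens F (tensor F U V) W (tens F U V u v) w) = g (tens F (tensor F U V) W (tens F U V u v) w)"
    and x: "x \<in> carrier (tensor F (tensor F U V) W)"
  shows "f x = g x"
proof (rule linear_tensor_eq[OF UV mods(3) f g _ x])
  fix y w assume y: "y \<in> carrier (tensor F U V)" and w: "w \<in> carrier W"
  show "f (tens F (tensor F U V) W y w) = g (tens F (tensor F U V) W y w)"
    by (rule linear_tensor_eq[OF mods(1,2) _ _ _ y])
      (auto intro!: linear_compose[OF _ f] linear_compose[OF _ g] linear_tens_left UV mods linear_id w simp: eq w)
qed

lemma linear_tensor3_eq':
  assumes f: "f \<in> linear_maps F (tensor F U (tensor F V W)) T" and g: "g \<in> linear_maps F (tensor F U (tensor F V W)) T"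
    and eq: "\<And>u v w. \<lbrakk>u \<in> carrier U; v \<in> carrier V; w \<in> carrier W\<rbrakk> \<Longrightarrow>
        f (tens F U (tensor F V W) u (tens F V W v w)) = g (tens F U (tensor F V W) u (tens F V W v w))"
    and x: "x \<in> carrier (tensor F U (tensor F V W))"
  shows "f x = g x"
proof (rule linear_tensor_eq[OF mods(1) VW f g _ x])
  fix u y assume u: "u \<in> carrier U" and y: "y \<in> carrier (tensor F V W)"
  show "f (tens F U (tensor F V W) u y) = g (tens F U (tensor F V W) u y)"
    by (rule linear_tensor_eq[OF mods(2,3) _ _ _ y])
      (auto intro!: linear_compose[OF _ f] linear_compose[OF _ g] linear_tens_right VW mods linear_id u simp: eq u)
qed

lemma tassoc_tassoc_inv: "x \<in> carrier (tensor F U (tensor F V W)) \<Longrightarrow> tassoc F U V W (tassoc_inv F U V W x) = x"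
  by (rule linear_tensor3_eq'[OF linear_compose[OF tassoc_inv_linear tassoc_linear] linear_id])
    (auto simp: tassoc_tens tassoc_inv_tens)

end

lemma tassoc_inv_tassoc:
  assumes "module F U" "module F V" "module F W" "x \<in> carrier (tensor F (tensor F U V) W)"
  shows "tassoc_inv F U V W (tassoc F U V W x) = x"
  by (rule linear_tensor3_eq[OF assms(1-3) linear_compose[OF tassoc_linear tassoc_inv_linear] linear_id _ assms(4)])
    (auto simp: tassoc_tens tassoc_inv_tens assms)

lemma linear_bilinear_left:
  "\<lbrakk>\<beta> \<in> bilinear_maps F V W U; f \<in> linear_maps F T V; w \<in> carrier W\<rbrakk> \<Longrightarrow> (\<lambda>t. \<beta> (f t) w) \<in> linear_maps F T U"
  by (rule linear_compose[OF _ bilinear_left])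

lemma linear_bilinear_right:
  "\<lbrakk>\<beta> \<in> bilinear_maps F V W U; f \<in> linear_maps F T W; v \<in> carrier V\<rbrakk> \<Longrightarrow> (\<lambda>t. \<beta> v (f t)) \<in> linear_maps F T U"
  by (rule linear_compose[OF _ bilinear_right])

lemma (in assoc_algebra) mult_bilinear: "(\<otimes>\<^bsub>A\<^esub>) \<in> bilinear_maps F A A A"
  by (intro bilinear_mapsI linear_mapsI)
    (auto simp: A.l_distr A.r_distr smult_mult_left smult_mult_right)

section \<open>Linear maps with coefficients in an algebra\<close>

locale coefficient_algebra = assoc_algebra F B
  for F :: "('f, 'm) ring_scheme" and B :: "('f, 'b, 'r) module_scheme"
begin

text \<open>
  On elements, \<open>rmult W b\<close> is \<open>w \<otimes> c \<mapsto> w \<otimes> c b\<close> and \<open>prepend V W v\<close> is \<open>w \<otimes> c \<mapsto> (v \<otimes> w) \<otimes> c\<close>.  Composition of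
  the maps in \<open>dyn_End V\<close> becomes ordinary composition after applying \<open>ext\<close> (\<open>ext_comp\<close>), and for this
  reason most identities below are stated for extended maps on \<open>V \<otimes> B\<close>.
\<close>

abbreviation rmult where "rmult W b \<equiv> tmap F W B (\<lambda>w. w) (\<lambda>c. c \<otimes>\<^bsub>B\<^esub> b)"
abbreviation ext where "ext \<equiv> dyn_ext F B"
abbreviation prepend where "prepend V W v \<equiv> tmap F (tensor F V W) B (tens F V W v) (\<lambda>c. c)"
abbreviation dyn_End where "dyn_End V \<equiv> linear_maps F V (tensor F V B)"

lemma B_module: "module F B" by unfold_locales

lemma rmult_linear: "\<lbrakk>module F W; b \<in> carrier B\<rbrakk> \<Longrightarrow> rmult W b \<in> linear_maps F (tensor F W B) (tensor F W B)"
  by (intro tmap_linear B_module linear_id bilinear_left[OF mult_bilinear])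

lemma rmult_tens:
  "\<lbrakk>module F W; w \<in> carrier W; c \<in> carrier B; b \<in> carrier B\<rbrakk> \<Longrightarrow>
     rmult W b (tens F W B w c) = tens F W B w (c \<otimes>\<^bsub>B\<^esub> b)"
  by (rule tmap_tens[OF _ B_module _ B_module linear_id bilinear_left[OF mult_bilinear]])

lemma rmult_bilinear:
  assumes W: "module F W"
  shows "rmult W \<in> bilinear_maps F B (tensor F W B) (tensor F W B)"
proof (rule bilinear_mapsI)
  fix x assume x: "x \<in> carrier (tensor F W B)"
  show "(\<lambda>b. rmult W b x) \<in> linear_maps F B (tensor F W B)"
    unfolding tmap_def
    by (rule tlift_linear_param[OF W B_module tensor_module[OF W B_module] B_module _ _ x])
      (auto intro!: bilinear_mapsI linear_tens_left linear_tens_right W B_module linear_id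
         bilinear_left[OF mult_bilinear] bilinear_right[OF mult_bilinear])
qed (use rmult_linear[OF W] in auto)

lemmas rmult_closed = bilinear_closed[OF rmult_bilinear]

lemma prepend_linear:
  "\<lbrakk>module F V; module F W; v \<in> carrier V\<rbrakk> \<Longrightarrow> prepend V W v \<in> linear_maps F (tensor F W B) (tensor F (tensor F V W) B)"
  by (intro tmap_linear B_module tensor_module linear_id bilinear_right[OF tens_bilinear])

lemma prepend_tens:
  "\<lbrakk>module F V; module F W; v \<in> carrier V; w \<in> carrier W; c \<in> carrier B\<rbrakk> \<Longrightarrow>
     prepend V W v (tens F W B w c) = tens F (tensor F V W) B (tens F V W v w) c"
  by (rule tmap_tens) (auto intro: B_module tensor_module linear_id bilinear_right[OF tens_bilinear])

context
  fixes W :: "('f, 'w, 'p) module_scheme"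
  assumes W: "module F W"
begin

lemma rmult_rmult:
  assumes "x \<in> carrier (tensor F W B)" "b \<in> carrier B" "c \<in> carrier B"
  shows "rmult W b (rmult W c x) = rmult W (c \<otimes>\<^bsub>B\<^esub> b) x"
  by (rule linear_tensor_eq[OF W B_module _ _ _ assms(1)])
    (use assms in \<open>auto intro!: linear_compose[OF rmult_linear rmult_linear] rmult_linear W simp: rmult_tens W A.m_assoc\<close>)

lemma rmult_one: "x \<in> carrier (tensor F W B) \<Longrightarrow> rmult W \<one>\<^bsub>B\<^esub> x = x"
  by (rule linear_tensor_eq[OF W B_module rmult_linear linear_id]) (auto simp: W rmult_tens)

lemma rmult_prepend:
  assumes "module F V" "v \<in> carrier V" "b \<in> carrier B" "x \<in> carrier (tensor F W B)"
  shows "rmult (tensor F V W) b (prepend V W v x) = prepend V W v (rmult W b x)"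
  by (rule linear_tensor_eq[OF W B_module _ _ _ assms(4)])
    (use assms in \<open>auto intro!: linear_compose[OF prepend_linear rmult_linear] linear_compose[OF rmult_linear prepend_linear]
      W tensor_module simp: rmult_tens prepend_tens W tens_closed tensor_module\<close>)

private lemma ext_bil:
  assumes "f \<in> linear_maps F V (tensor F W B)"
  shows "(\<lambda>v b. rmult W b (f v)) \<in> bilinear_maps F V B (tensor F W B)"
  using assms by (intro bilinear_mapsI linear_bilinear_left[OF rmult_bilinear] linear_compose[OF _ rmult_linear]
      bilinear_left[OF rmult_bilinear] W) (auto simp: linear_closed)

lemma ext_linear:
  "\<lbrakk>module F V; f \<in> linear_maps F V (tensor F W B)\<rbrakk> \<Longrightarrow> ext W f \<in> linear_maps F (tensor F V B) (tensor F W B)"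
  unfolding dyn_ext_def by (rule tlift_linear[OF _ B_module tensor_module[OF W B_module] ext_bil])

lemma ext_tens:
  "\<lbrakk>module F V; f \<in> linear_maps F V (tensor F W B); v \<in> carrier V; b \<in> carrier B\<rbrakk> \<Longrightarrow>
    ext W f (tens F V B v b) = rmult W b (f v)"
  unfolding dyn_ext_def by (rule tlift_tens[OF _ B_module tensor_module[OF W B_module] ext_bil])

lemma ext_closed:
  "\<lbrakk>module F V; f \<in> linear_maps F V (tensor F W B); x \<in> carrier (tensor F V B)\<rbrakk> \<Longrightarrow> ext W f x \<in> carrier (tensor F W B)"
  using ext_linear linear_closed by metis

lemma ext_one:
  "\<lbrakk>module F V; f \<in> linear_maps F V (tensor F W B); v \<in> carrier V\<rbrakk> \<Longrightarrow> ext W f (tens F V B v \<one>\<^bsub>B\<^esub>) = f v"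
  by (simp add: ext_tens rmult_one linear_closed)

lemma ext_rmult:
  assumes "module F V" "f \<in> linear_maps F V (tensor F W B)" "b \<in> carrier B" "x \<in> carrier (tensor F V B)"
  shows "ext W f (rmult V b x) = rmult W b (ext W f x)"
  by (rule linear_tensor_eq[OF assms(1) B_module _ _ _ assms(4)])
    (use assms in \<open>auto intro!: linear_compose[OF ext_linear rmult_linear] linear_compose[OF rmult_linear ext_linear]
      W simp: rmult_tens ext_tens rmult_rmult linear_closed W\<close>)

lemma ext_cong:
  assumes "module F V" "f \<in> linear_maps F V (tensor F W B)" "g \<in> linear_maps F V (tensor F W B)"
    and "\<And>v. v \<in> carrier V \<Longrightarrow> f v = g v" "x \<in> carrier (tensor F V B)"
  shows "ext W f x = ext W g x"
  by (rule linear_tensor_eq[OF assms(1) B_module _ _ _ assms(5)])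
    (use assms in \<open>auto intro!: ext_linear simp: ext_tens\<close>)

lemma dyn_id_linear: "dyn_id F B W \<in> dyn_End W"
  unfolding dyn_id_def by (intro linear_tens_left W B_module linear_id) simp

lemma ext_id: "x \<in> carrier (tensor F W B) \<Longrightarrow> ext W (dyn_id F B W) x = x"
  by (rule linear_tensor_eq[OF W B_module ext_linear linear_id])
    (auto simp: ext_tens W dyn_id_linear, auto simp: dyn_id_def rmult_tens W)

lemma dyn_comp_linear:
  assumes "module F V" "f \<in> linear_maps F U (tensor F V B)" "g \<in> linear_maps F V (tensor F W B)"
  shows "dyn_comp F B W g f \<in> linear_maps F U (tensor F W B)"
  unfolding dyn_comp_def comp_def using assms by (intro linear_compose[OF _ ext_linear])

end

lemma ext_comp:
  assumes mods: "module F U" "module F V" "module F W"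
    and f: "f \<in> linear_maps F U (tensor F V B)" and g: "g \<in> linear_maps F V (tensor F W B)"
    and x: "x \<in> carrier (tensor F U B)"
  shows "ext W (dyn_comp F B W g f) x = ext W g (ext V f x)"
proof (rule linear_tensor_eq[OF mods(1) B_module _ _ _ x])
  have gf: "dyn_comp F B W g f \<in> linear_maps F U (tensor F W B)"
    using mods f g by (intro dyn_comp_linear)
  then show "ext W (dyn_comp F B W g f) \<in> linear_maps F (tensor F U B) (tensor F W B)"
    using mods by (intro ext_linear)
  show "(\<lambda>x. ext W g (ext V f x)) \<in> linear_maps F (tensor F U B) (tensor F W B)"
    using mods f g by (intro linear_compose[OF ext_linear ext_linear])
  fix u b assume "u \<in> carrier U" "b \<in> carrier B"
  then show "ext W (dyn_comp F B W g f) (tens F U B u b) = ext W g (ext V f (tens F U B u b))"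
    using mods f g by (simp add: ext_tens gf linear_closed[OF f] ext_rmult) (simp add: dyn_comp_def)
qed

lemma dyn_comp_id_right: "module F M \<Longrightarrow> f \<in> dyn_End M \<Longrightarrow> x \<in> carrier M \<Longrightarrow> dyn_comp F B M f (dyn_id F B M) x = f x"
  by (simp add: dyn_comp_def ext_one[of M M] dyn_id_def)

lemma dyn_comp_id_left: "module F M \<Longrightarrow> f \<in> dyn_End M \<Longrightarrow> x \<in> carrier M \<Longrightarrow> dyn_comp F B M (dyn_id F B M) f x = f x"
  by (simp add: dyn_comp_def ext_id linear_closed)

lemma ext_commute:
  assumes M: "module F M" and e: "f \<in> dyn_End M" "g \<in> dyn_End M" "h \<in> dyn_End M" "k \<in> dyn_End M"
    and eq: "\<And>x. x \<in> carrier M \<Longrightarrow> dyn_comp F B M f g x = dyn_comp F B M h k x" and y: "y \<in> carrier (tensor F M B)"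
  shows "ext M f (ext M g y) = ext M h (ext M k y)"
proof -
  have "ext M (dyn_comp F B M f g) y = ext M (dyn_comp F B M h k) y"
    by (rule ext_cong[OF M M dyn_comp_linear[OF M M e(2,1)] dyn_comp_linear[OF M M e(4,3)] eq y])
  then show ?thesis using ext_comp[OF M M M] e y by simp
qed

lemma ext_inverse:
  assumes M: "module F M" and f: "f \<in> dyn_End M" and inv: "is_dyn_inverse F B M f g" and y: "y \<in> carrier (tensor F M B)"
  shows "ext M f (ext M g y) = y" and "ext M g (ext M f y) = y"
proof -
  have g: "g \<in> dyn_End M" using inv by (simp add: is_dyn_inverse_def)
  have "ext M (dyn_comp F B M f g) y = ext M (dyn_id F B M) y" "ext M (dyn_comp F B M g f) y = ext M (dyn_id F B M) y"
    using inv by (auto intro!: ext_cong[OF M M _ dyn_id_linear[OF M] _ y] dyn_comp_linear[OF M M] f g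
      simp: is_dyn_inverse_def)
  then show "ext M f (ext M g y) = y" "ext M g (ext M f y) = y"
    by (simp_all add: ext_comp[OF M M M] f g y ext_id[OF M])
qed

lemma is_dyn_inverse_dyn_inv: "is_dyn_inverse F B M f g \<Longrightarrow> is_dyn_inverse F B M f (dyn_inv F B M f)"
  unfolding dyn_inv_def by (rule someI[of "is_dyn_inverse F B M f"])

subsection \<open>Change of bracketing\<close>

text \<open>
  Transport of an endomorphism of \<open>V \<otimes> (W \<otimes> U)\<close> to the bracketing \<open>(V \<otimes> W) \<otimes> U\<close>; with the identity of \<open>V\<close>
  on the left, this is how \<open>dyn_23\<close> is formed.
\<close>

definition rebracket where
  "rebracket V W U Q = tmap F (tensor F (tensor F V W) U) B (tassoc_inv F V W U) (\<lambda>b. b) \<circ> Q \<circ> tassoc F V W U"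

context
  fixes V :: "('f, 'v, 'p) module_scheme" and W :: "('f, 'w, 'q) module_scheme" and U :: "('f, 'u, 't) module_scheme"
  assumes V: "module F V" and W: "module F W" and U: "module F U"
begin

private abbreviation "VW_U \<equiv> tensor F (tensor F V W) U"
private abbreviation "V_WU \<equiv> tensor F V (tensor F W U)"
private abbreviation "Lft \<equiv> tmap F VW_U B (tassoc_inv F V W U) (\<lambda>b. b)"

private lemma rm: "module F VW_U" "module F V_WU"
  by (intro tensor_module V W U)+

private lemma Lft_linear: "Lft \<in> linear_maps F (tensor F V_WU B) (tensor F VW_U B)"
  by (intro tmap_linear rm B_module tassoc_inv_linear V W U linear_id)

private lemma Lft_tens:
  "\<lbrakk>t \<in> carrier V_WU; b \<in> carrier B\<rbrakk> \<Longrightarrow> Lft (tens F V_WU B t b) = tens F VW_U B (tassoc_inv F V W U t) b"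
  by (rule tmap_tens[OF rm(1) B_module rm(2) B_module tassoc_inv_linear[OF V W U] linear_id])

private lemma Lft_rmult:
  assumes y: "y \<in> carrier (tensor F V_WU B)" and b: "b \<in> carrier B"
  shows "Lft (rmult V_WU b y) = rmult VW_U b (Lft y)"
proof (rule linear_tensor_eq[OF rm(2) B_module _ _ _ y])
  show "(\<lambda>y. Lft (rmult V_WU b y)) \<in> linear_maps F (tensor F V_WU B) (tensor F VW_U B)"
    using b by (intro linear_compose[OF rmult_linear Lft_linear] rm)
  show "(\<lambda>y. rmult VW_U b (Lft y)) \<in> linear_maps F (tensor F V_WU B) (tensor F VW_U B)"
    using b by (intro linear_compose[OF Lft_linear rmult_linear] rm)
qed (use b in \<open>simp add: rmult_tens rm Lft_tens linear_closed[OF tassoc_inv_linear[OF V W U]]\<close>)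

lemma rebracket_linear: "Q \<in> dyn_End V_WU \<Longrightarrow> rebracket V W U Q \<in> dyn_End VW_U"
  unfolding rebracket_def comp_def
  by (rule linear_compose[OF tassoc_linear[OF V W U] linear_compose[OF _ Lft_linear]])

lemma rebracket_cong:
  "(\<And>x. x \<in> carrier V_WU \<Longrightarrow> P x = Q x) \<Longrightarrow> x \<in> carrier VW_U \<Longrightarrow> rebracket V W U P x = rebracket V W U Q x"
  using linear_closed[OF tassoc_linear[OF V W U]] by (simp add: rebracket_def)

lemma rebracket_scalar:
  assumes "x \<in> carrier VW_U" "s \<in> linear_maps F V_WU V_WU" "\<And>y. y \<in> carrier V_WU \<Longrightarrow> Q y = tens F V_WU B (s y) \<one>\<^bsub>B\<^esub>"
  shows "rebracket V W U Q x = tens F VW_U B (tassoc_inv F V W U (s (tassoc F V W U x))) \<one>\<^bsub>B\<^esub>"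
  using assms linear_closed[OF tassoc_linear[OF V W U], of x]
  by (simp add: rebracket_def Lft_tens linear_closed[OF assms(2)])

lemma rebracket_id:
  assumes "x \<in> carrier VW_U"
  shows "rebracket V W U (dyn_id F B V_WU) x = dyn_id F B VW_U x"
  using rebracket_scalar[OF assms linear_id, of "dyn_id F B V_WU"] assms
  by (simp add: dyn_id_def tassoc_inv_tassoc V W U)

text \<open>
  The extension of a transported map intertwines the reassociation of \<open>V \<otimes> (W \<otimes> U) \<otimes> B\<close>, so the two
  associators between the factors of a composite cancel.
\<close>

lemma dyn_comp_rebracket:
  assumes P: "P \<in> dyn_End V_WU" and Q: "Q \<in> dyn_End V_WU" and x: "x \<in> carrier VW_U"
  shows "dyn_comp F B VW_U (rebracket V W U P) (rebracket V W U Q) x = rebracket V W U (dyn_comp F B V_WU P Q) x"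
proof -
  have ext: "ext VW_U (rebracket V W U P) (Lft y) = Lft (ext V_WU P y)" if y: "y \<in> carrier (tensor F V_WU B)" for y
  proof (rule linear_tensor_eq[OF rm(2) B_module _ _ _ y])
    show "(\<lambda>y. ext VW_U (rebracket V W U P) (Lft y)) \<in> linear_maps F (tensor F V_WU B) (tensor F VW_U B)"
      using P by (intro linear_compose[OF Lft_linear ext_linear] rm rebracket_linear)
    show "(\<lambda>y. Lft (ext V_WU P y)) \<in> linear_maps F (tensor F V_WU B) (tensor F VW_U B)"
      using P by (intro linear_compose[OF ext_linear Lft_linear] rm)
    fix t b assume t: "t \<in> carrier V_WU" and b: "b \<in> carrier B"
    have "rebracket V W U P (tassoc_inv F V W U t) = Lft (P t)"
      using t by (simp add: rebracket_def tassoc_tassoc_inv V W U)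
    then show "ext VW_U (rebracket V W U P) (Lft (tens F V_WU B t b)) = Lft (ext V_WU P (tens F V_WU B t b))"
      using t b P by (simp add: Lft_tens ext_tens rm rebracket_linear Lft_rmult linear_closed[OF P]
          linear_closed[OF tassoc_inv_linear[OF V W U]])
  qed
  have "Q (tassoc F V W U x) \<in> carrier (tensor F V_WU B)"
    using x by (intro linear_closed[OF Q] linear_closed[OF tassoc_linear[OF V W U]])
  then show ?thesis
    using ext by (simp add: dyn_comp_def rebracket_def)
qed

end

end

section \<open>Moving coefficients past comodule elements\<close>

text \<open>
  Attaching a coaction changes neither the underlying module nor anything formed from it.  These rules
  remove coactions wherever only the module matters.
\<close>

lemma with_coaction_simps [simp]:
  "carrier (with_coaction M \<rho>) = carrier M" "add (with_coaction M \<rho>) = add M"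
  "zero (with_coaction M \<rho>) = zero M" "smult (with_coaction M \<rho>) = smult M" "coact (with_coaction M \<rho>) = \<rho>"
  by (simp_all add: with_coaction_def)

text \<open>
  The tensor product sees its factors only through carrier, addition and scalar multiplication.
\<close>

lemma tensor_null_cong:
  assumes "carrier V = carrier V'" "add V = add V'" "smult V = smult V'"
    and "carrier W = carrier W'" "add W = add W'" "smult W = smult W'"
  shows "tensor_null F V W = tensor_null F V' W'"
  using assms by (simp add: tensor_null_def tensor_relators_def)

lemma tensor_with_coaction [simp]:
  "tensor F (with_coaction M \<rho>) W = tensor F M W" "tensor F V (with_coaction M \<rho>) = tensor F V M"
  "tens F (with_coaction M \<rho>) W = tens F M W" "tens F V (with_coaction M \<rho>) = tens F V M"
  by (simp_all add: tensor_def tens_def fun_eq_iff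
      tensor_null_cong[where V = "with_coaction M \<rho>" and V' = M and W = W and W' = W]
      tensor_null_cong[where V = V and V' = V and W = "with_coaction M \<rho>" and W' = M])

lemma linear_maps_with_coaction [simp]:
  "linear_maps F (with_coaction M \<rho>) W = linear_maps F M W" "linear_maps F V (with_coaction M \<rho>) = linear_maps F V M"
  by (simp_all add: linear_maps_def)

lemma module_with_coaction: "module F M \<Longrightarrow> module F (with_coaction M \<rho>)"
proof -
  assume "module F M"
  then interpret module F M .
  show ?thesis by (rule module_surjection[OF \<open>module F M\<close>, where \<pi> = "\<lambda>x. x"]) auto
qed

lemma tlift_with_coaction [simp]: "tlift F (with_coaction M \<rho>) = tlift F M"
  by (simp add: tlift_def fun_eq_iff finsum_def finprod_def Let_def)

lemma tmap_with_coaction [simp]: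
  "tmap F (with_coaction M \<rho>) W = tmap F M W" "tmap F V (with_coaction M \<rho>) = tmap F V M"
  by (simp_all add: tmap_def fun_eq_iff)

lemma dyn_with_coaction [simp]:
  "dyn_ext F B (with_coaction M \<rho>) = dyn_ext F B M" "dyn_id F B (with_coaction M \<rho>) = dyn_id F B M"
  by (simp_all add: dyn_ext_def dyn_id_def fun_eq_iff)

locale dynamical_setting =
  fixes F :: "('f, 'm) ring_scheme" and H :: "('f, 'h, 'n) hopf_scheme"
    and B :: "('f, 'b, 'r) module_scheme" and \<sigma> :: "('h \<times> 'b \<Rightarrow> 'f) set \<Rightarrow> 'b"
  assumes hopf: "comm_cocomm_hopf_algebra F H" and action: "module_algebra F H B \<sigma>"
    and coefficients_comm: "\<lbrakk>b \<in> carrier B; c \<in> carrier B\<rbrakk> \<Longrightarrow> b \<otimes>\<^bsub>B\<^esub> c = c \<otimes>\<^bsub>B\<^esub> b"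
begin

sublocale Hopf: comm_cocomm_hopf_algebra F H by (rule hopf)
sublocale Act: module_algebra F H B \<sigma> by (rule action)
sublocale coefficient_algebra F B
  by unfold_locales

lemma H_module: "module F H" by unfold_locales

abbreviation hit where "hit h b \<equiv> \<sigma> (tens F H B h b)"
abbreviation merge where "merge \<equiv> dyn_merge F H B \<sigma>"
abbreviation dtensor where "dtensor \<equiv> dyn_tensor F H B \<sigma>"

text \<open>
  \<open>tau W b\<close> is \<open>w \<mapsto> w\<^sub>0 \<otimes> \<sigma>(w\<^sub>1 \<otimes> b)\<close>.  Fixing \<open>b\<close> turns \<open>\<tau>\<close> into a family of endomorphisms with
  coefficients, to which \<open>ext\<close> and composition apply.
\<close>

definition tau where "tau W b w = dyn_tau F H B \<sigma> W (tens F B W b w)"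

text \<open>
  Linearity of the coaction makes \<open>tau W\<close> bilinear.  Coassociativity and the counit axiom act only
  through their consequences for \<open>tau W\<close>, which \<open>half_braided\<close> collects below.
\<close>

definition coacted where "coacted W \<longleftrightarrow> module F W \<and> coact W \<in> linear_maps F W (tensor F W H)"

lemma coacted_module: "coacted W \<Longrightarrow> module F W" by (simp add: coacted_def)

lemma hit_bilinear: "(\<lambda>h b. hit h b) \<in> bilinear_maps F H B B"
  by (intro bilinear_mapsI linear_compose[OF _ Act.action_linear] linear_tens_left linear_tens_right
      H_module B_module linear_id)

lemmas hit_closed = bilinear_closed[OF hit_bilinear]

text \<open>
  The map \<open>w \<otimes> h \<mapsto> w \<otimes> \<sigma>(h \<otimes> b)\<close> separates the action on \<open>B\<close> from the coaction:
  \<open>tau W b = spread W b \<circ> coact W\<close> (\<open>tau_eq\<close>).  As \<open>spread\<close> is defined on all of \<open>W \<otimes> H\<close>, identities for it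
  can be checked on pure tensors, which is not possible on the values of a coaction.
\<close>

definition spread where "spread W b = tlift F (tensor F W B) (\<lambda>w h. tens F W B w (hit h b))"

context
  fixes W :: "('f, 'w, 'p) module_scheme"
  assumes W: "module F W"
begin

private lemma WB: "module F (tensor F W B)"
  by (intro tensor_module B_module W)

private lemma inner:
  "b \<in> carrier B \<Longrightarrow> (\<lambda>w h. tens F W B w (hit h b)) \<in> bilinear_maps F W H (tensor F W B)"
  by (intro bilinear_mapsI linear_tens_left linear_tens_right W B_module linear_id
     bilinear_left[OF hit_bilinear]) (auto simp: hit_closed)

lemma spread_linear: "b \<in> carrier B \<Longrightarrow> spread W b \<in> linear_maps F (tensor F W H) (tensor F W B)"
  unfolding spread_def by (rule tlift_linear[OF W H_module WB inner])

lemma spread_tens: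
  "\<lbrakk>b \<in> carrier B; w \<in> carrier W; h \<in> carrier H\<rbrakk> \<Longrightarrow> spread W b (tens F W H w h) = tens F W B w (hit h b)"
  unfolding spread_def by (rule tlift_tens[OF W H_module WB inner])

lemma spread_linear':
  assumes z: "z \<in> carrier (tensor F W H)"
  shows "(\<lambda>b. spread W b z) \<in> linear_maps F B (tensor F W B)"
  unfolding spread_def
  by (rule tlift_linear_param[OF W H_module WB B_module inner _ z])
    (auto intro!: linear_tens_right W B_module bilinear_right[OF hit_bilinear])

end

context
  fixes W :: "('f, 'w, 'h, 'p) comodule_scheme"
  assumes W: "coacted W"
begin

private lemma mods: "module F W" "module F (tensor F W B)" "module F (tensor F W H)"
  using W by (auto simp: coacted_def intro!: tensor_module B_module H_module)

private lemma coact: "coact W \<in> linear_maps F W (tensor F W H)"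
  using W by (simp add: coacted_def)

private lemma outer: "(\<lambda>b w. spread W b (coact W w)) \<in> bilinear_maps F B W (tensor F W B)"
  by (intro bilinear_mapsI linear_compose[OF coact spread_linear] spread_linear' linear_closed[OF coact] mods)

lemma tau_eq: "\<lbrakk>b \<in> carrier B; w \<in> carrier W\<rbrakk> \<Longrightarrow> tau W b w = spread W b (coact W w)"
  unfolding tau_def dyn_tau_def spread_def[symmetric] by (rule tlift_tens[OF B_module mods(1,2) outer])

lemma tau_bilinear: "tau W \<in> bilinear_maps F B W (tensor F W B)"
proof -
  have dt: "dyn_tau F H B \<sigma> W \<in> linear_maps F (tensor F B W) (tensor F W B)"
    unfolding dyn_tau_def spread_def[symmetric] by (rule tlift_linear[OF B_module mods(1,2) outer])
  show ?thesis
    unfolding tau_def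
    by (intro bilinear_mapsI linear_compose[OF _ dt] linear_tens_left linear_tens_right mods B_module linear_id)
qed

lemma tau_linear: "b \<in> carrier B \<Longrightarrow> tau W b \<in> dyn_End W"
  by (rule bilinear_right[OF tau_bilinear])

lemma tau_linear': "w \<in> carrier W \<Longrightarrow> (\<lambda>b. tau W b w) \<in> linear_maps F B (tensor F W B)"
  by (rule bilinear_left[OF tau_bilinear])

lemma tau_closed: "\<lbrakk>b \<in> carrier B; w \<in> carrier W\<rbrakk> \<Longrightarrow> tau W b w \<in> carrier (tensor F W B)"
  by (rule bilinear_closed[OF tau_bilinear])

end

subsection \<open>The coaction on a tensor product\<close>

text \<open>
  The bilinear operation \<open>(v \<otimes> g, w \<otimes> h) \<mapsto> (v \<otimes> w) \<otimes> g h\<close>, by which the coactions of two comodules are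
  combined into that of their tensor product.
\<close>

definition coact_pair where
  "coact_pair V W x y =
    (let T = tensor F (tensor F V W) H in
     tlift F T (\<lambda>v g. tlift F T (\<lambda>w h. tens F (tensor F V W) H (tens F V W v w) (g \<otimes>\<^bsub>H\<^esub> h)) y) x)"

context
  fixes V :: "('f, 'v, 'h, 'p) comodule_scheme" and W :: "('f, 'w, 'h, 'q) comodule_scheme"
  assumes V: "coacted V" and W: "coacted W"
begin

private abbreviation "T \<equiv> tensor F (tensor F V W) H"

private lemma tmods: "module F V" "module F W" "module F (tensor F V W)" "module F (tensor F V H)"
    "module F (tensor F W H)" "module F T"
  using V W by (auto simp: coacted_def intro!: tensor_module H_module)

private lemma coacts: "coact V \<in> linear_maps F V (tensor F V H)" "coact W \<in> linear_maps F W (tensor F W H)"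
  using V W by (auto simp: coacted_def)

private lemma l1:
  assumes "v \<in> carrier V" "g \<in> carrier H"
  shows "(\<lambda>w h. tens F (tensor F V W) H (tens F V W v w) (g \<otimes>\<^bsub>H\<^esub> h)) \<in> bilinear_maps F W H T"
  using assms by (intro bilinear_mapsI linear_tens_left linear_tens_right tmods H_module linear_id
      bilinear_right[OF Hopf.mult_bilinear] tens_closed Hopf.A.m_closed)

private lemma l2:
  assumes y: "y \<in> carrier (tensor F W H)"
  shows "(\<lambda>v g. tlift F T (\<lambda>w h. tens F (tensor F V W) H (tens F V W v w) (g \<otimes>\<^bsub>H\<^esub> h)) y) \<in> bilinear_maps F V H T"
proof (rule bilinear_mapsI)
  fix g assume g: "g \<in> carrier H"
  show "(\<lambda>v. tlift F T (\<lambda>w h. tens F (tensor F V W) H (tens F V W v w) (g \<otimes>\<^bsub>H\<^esub> h)) y) \<in> linear_maps F V T"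
    using g by (intro tlift_linear_param[OF tmods(2) H_module tmods(6,1) _ _ y] l1 linear_tens_left tmods H_module
        linear_id Hopf.A.m_closed)
next
  fix v assume v: "v \<in> carrier V"
  show "(\<lambda>g. tlift F T (\<lambda>w h. tens F (tensor F V W) H (tens F V W v w) (g \<otimes>\<^bsub>H\<^esub> h)) y) \<in> linear_maps F H T"
    using v by (intro tlift_linear_param[OF tmods(2) H_module tmods(6) H_module _ _ y] l1 linear_tens_right tmods H_module
        bilinear_left[OF Hopf.mult_bilinear] tens_closed)
qed

lemma coact_pair_bilinear: "coact_pair V W \<in> bilinear_maps F (tensor F V H) (tensor F W H) T"
  unfolding coact_pair_def Let_def
proof (rule bilinear_mapsI)
  fix y assume "y \<in> carrier (tensor F W H)"
  then show "tlift F T (\<lambda>v g. tlift F T (\<lambda>w h. tens F (tensor F V W) H (tens F V W v w) (g \<otimes>\<^bsub>H\<^esub> h)) y)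
      \<in> linear_maps F (tensor F V H) T"
    by (intro tlift_linear tmods H_module l2)
next
  fix x assume x: "x \<in> carrier (tensor F V H)"
  show "(\<lambda>y. tlift F T (\<lambda>v g. tlift F T (\<lambda>w h. tens F (tensor F V W) H (tens F V W v w) (g \<otimes>\<^bsub>H\<^esub> h)) y) x)
      \<in> linear_maps F (tensor F W H) T"
    by (intro tlift_linear_param[OF tmods(1) H_module tmods(6,5) _ _ x] l2 tlift_linear tmods H_module l1)
qed

lemma coact_pair_tens_left:
  "\<lbrakk>v \<in> carrier V; g \<in> carrier H; y \<in> carrier (tensor F W H)\<rbrakk> \<Longrightarrow>
     coact_pair V W (tens F V H v g) y = tlift F T (\<lambda>w h. tens F (tensor F V W) H (tens F V W v w) (g \<otimes>\<^bsub>H\<^esub> h)) y"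
  unfolding coact_pair_def Let_def by (rule tlift_tens[OF tmods(1) H_module tmods(6) l2])

lemma coact_pair_tens:
  "\<lbrakk>v \<in> carrier V; g \<in> carrier H; w \<in> carrier W; h \<in> carrier H\<rbrakk> \<Longrightarrow>
     coact_pair V W (tens F V H v g) (tens F W H w h) = tens F (tensor F V W) H (tens F V W v w) (g \<otimes>\<^bsub>H\<^esub> h)"
  by (simp add: coact_pair_tens_left tens_closed tmods H_module tlift_tens[OF tmods(2) H_module tmods(6) l1])

private lemma coact_bil: "(\<lambda>v w. coact_pair V W (coact V v) (coact W w)) \<in> bilinear_maps F V W T"
  using coacts by (intro bilinear_mapsI linear_bilinear_left[OF coact_pair_bilinear]
      linear_bilinear_right[OF coact_pair_bilinear]) (auto simp: linear_closed)

private lemma coact_def: "coact (tensor_comodule F H V W) = tlift F T (\<lambda>v w. coact_pair V W (coact V v) (coact W w))"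
  by (simp add: tensor_comodule_def coact_pair_def Let_def)

lemma coact_tensor: 
  "\<lbrakk>v \<in> carrier V; w \<in> carrier W\<rbrakk> \<Longrightarrow>
     coact (tensor_comodule F H V W) (tens F V W v w) = coact_pair V W (coact V v) (coact W w)"
  unfolding coact_def by (rule tlift_tens[OF tmods(1,2,6) coact_bil])

lemma coacted_tensor: "coacted (tensor_comodule F H V W)"
  using tlift_linear[OF tmods(1,2,6) coact_bil] tmods
  by (simp add: coacted_def coact_def[symmetric] tensor_comodule_def Let_def module_with_coaction)

end

lemma coacted_trivial: "coacted (trivial_comodule F H B)"
  by (auto simp: coacted_def trivial_comodule_def intro!: module_with_coaction B_module linear_tens_left H_module linear_id)

end

context dynamical_setting
begin

subsection \<open>Half-braided comodules\<close>

text \<open>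
  The multiplicativity of \<open>\<tau>\<close> in its coefficient.  Unlike the comodule axioms, it passes easily to tensor
  products (\<open>half_braided_tensor\<close>).
\<close>

definition half_braided where
  "half_braided W \<longleftrightarrow> coacted W \<and>
     (\<forall>w\<in>carrier W. tau W \<one>\<^bsub>B\<^esub> w = tens F W B w \<one>\<^bsub>B\<^esub>) \<and>
     (\<forall>b\<in>carrier B. \<forall>c\<in>carrier B. \<forall>w\<in>carrier W. tau W (b \<otimes>\<^bsub>B\<^esub> c) w = ext W (tau W b) (tau W c w))"

lemma half_braided_coacted: "half_braided W \<Longrightarrow> coacted W" by (simp add: half_braided_def)

lemma counit_closed: "h \<in> carrier H \<Longrightarrow> counit H h \<in> carrier F"
  using Hopf.counit_hom by (rule ring_hom_closed)

text \<open>
  The unit law is the counit axiom together with \<open>\<sigma>(h \<otimes> 1) = \<epsilon>(h) 1\<close>.  For the product,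
  \<open>w\<^sub>0 \<otimes> \<sigma>(w\<^sub>1 \<otimes> bc)\<close> is expanded by comultiplying \<open>w\<^sub>1\<close>, whereas composing the two maps coacts
  twice; coassociativity identifies the results.
\<close>

lemma half_braided_comodule:
  fixes W :: "('f, 'w, 'h, 'p) comodule_scheme"
  assumes "right_comodule F H W"
  shows "half_braided W"
proof -
  interpret W: right_comodule F H W by fact
  have Wm: "module F W" by unfold_locales
  have Wc: "coacted W" using W.coact_linear Wm by (simp add: coacted_def)
  have HH: "module F (tensor F H H)" by (rule tensor_module[OF H_module H_module])
  have WB: "module F (tensor F W B)" by (rule tensor_module[OF Wm B_module])
  have WH: "module F (tensor F W H)" by (rule tensor_module[OF Wm H_module])
  have unit: "tau W \<one>\<^bsub>B\<^esub> w = tens F W B w \<one>\<^bsub>B\<^esub>" if w: "w \<in> carrier W" for w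
  proof -
    have eps: "(\<lambda>w h. counit H h \<odot>\<^bsub>W\<^esub> w) \<in> bilinear_maps F W H W"
    proof (intro bilinear_mapsI linear_mapsI)
      fix w g h assume "w \<in> carrier W" "g \<in> carrier H" "h \<in> carrier H"
      then show "counit H (g \<oplus>\<^bsub>H\<^esub> h) \<odot>\<^bsub>W\<^esub> w = counit H g \<odot>\<^bsub>W\<^esub> w \<oplus>\<^bsub>W\<^esub> counit H h \<odot>\<^bsub>W\<^esub> w"
        using ring_hom_add[OF Hopf.counit_hom] by (simp add: counit_closed W.smult_l_distr)
    qed (auto simp: counit_closed W.smult_r_distr W.smult_assoc1[symmetric] Hopf.R.m_comm Hopf.counit_linear)
    note lift = tlift_linear[OF Wm H_module Wm eps] tlift_tens[OF Wm H_module Wm eps]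
    have "spread W \<one>\<^bsub>B\<^esub> z = tens F W B (tlift F W (\<lambda>w h. counit H h \<odot>\<^bsub>W\<^esub> w) z) \<one>\<^bsub>B\<^esub>"
      if "z \<in> carrier (tensor F W H)" for z
    proof (rule linear_tensor_eq[OF Wm H_module _ _ _ that])
      show "(\<lambda>z. tens F W B (tlift F W (\<lambda>w h. counit H h \<odot>\<^bsub>W\<^esub> w) z) \<one>\<^bsub>B\<^esub>) \<in> linear_maps F (tensor F W H) (tensor F W B)"
        by (intro linear_tens_left Wm B_module lift) simp
      fix w h assume "w \<in> carrier W" "h \<in> carrier H"
      then show "spread W \<one>\<^bsub>B\<^esub> (tens F W H w h) =
          tens F W B (tlift F W (\<lambda>w h. counit H h \<odot>\<^bsub>W\<^esub> w) (tens F W H w h)) \<one>\<^bsub>B\<^esub>"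
        by (simp add: spread_tens Wm lift Act.action_on_one counit_closed
            linear_smult[OF bilinear_left[OF tens_bilinear[OF Wm B_module]]]
            linear_smult[OF bilinear_right[OF tens_bilinear[OF Wm B_module]]])
    qed (simp add: spread_linear Wm)
    then show ?thesis
      using w linear_closed[OF W.coact_linear w] by (simp add: tau_eq Wc W.coact_counit)
  qed
  have mult: "tau W (b \<otimes>\<^bsub>B\<^esub> c) w = ext W (tau W b) (tau W c w)"
    if b: "b \<in> carrier B" and c: "c \<in> carrier B" and w: "w \<in> carrier W" for b c w
  proof -
    \<comment> \<open>\<open>\<Psi>\<close> sends \<open>w \<otimes> h \<otimes> k\<close> to \<open>w \<otimes> \<sigma>(h \<otimes> b) \<sigma>(k \<otimes> c)\<close>.  The two sides are its values at the two sides of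
      the coassociativity law for \<open>w\<close>.\<close>
    define m where "m = tlift F B (\<lambda>h k. hit h b \<otimes>\<^bsub>B\<^esub> hit k c)"
    have m_bil: "(\<lambda>h k. hit h b \<otimes>\<^bsub>B\<^esub> hit k c) \<in> bilinear_maps F H H B"
      using b c by (intro bilinear_mapsI linear_bilinear_left[OF Act.mult_bilinear] linear_bilinear_right[OF Act.mult_bilinear]
          bilinear_left[OF hit_bilinear]) (auto simp: hit_closed)
    note m_linear = tlift_linear[OF H_module H_module B_module m_bil, folded m_def]
    note m_tens = tlift_tens[OF H_module H_module B_module m_bil, folded m_def]
    define \<Psi> where "\<Psi> = tmap F W B (\<lambda>w. w) m"
    have \<Psi>_linear: "\<Psi> \<in> linear_maps F (tensor F W (tensor F H H)) (tensor F W B)"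
      unfolding \<Psi>_def by (intro tmap_linear Wm B_module HH linear_id m_linear)
    have \<Psi>_tens: "\<Psi> (tens F W (tensor F H H) w y) = tens F W B w (m y)"
      if "w \<in> carrier W" "y \<in> carrier (tensor F H H)" for w y
      unfolding \<Psi>_def by (rule tmap_tens[OF Wm B_module Wm HH linear_id m_linear that])
    have coact_id: "tmap F (tensor F W H) H (coact W) (\<lambda>h. h) \<in> linear_maps F (tensor F W H) (tensor F (tensor F W H) H)"
      by (intro tmap_linear WH H_module Wm W.coact_linear linear_id)
    have id_comult: "tmap F W (tensor F H H) (\<lambda>w. w) (comult H) \<in> linear_maps F (tensor F W H) (tensor F W (tensor F H H))"
      by (intro tmap_linear HH H_module Wm Hopf.comult_linear linear_id)
    have left: "spread W (b \<otimes>\<^bsub>B\<^esub> c) z = \<Psi> (tmap F W (tensor F H H) (\<lambda>w. w) (comult H) z)"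
      if "z \<in> carrier (tensor F W H)" for z
    proof (rule linear_tensor_eq[OF Wm H_module _ linear_compose[OF id_comult \<Psi>_linear] _ that])
      fix w h assume wh: "w \<in> carrier W" "h \<in> carrier H"
      then show "spread W (b \<otimes>\<^bsub>B\<^esub> c) (tens F W H w h) =
          \<Psi> (tmap F W (tensor F H H) (\<lambda>w. w) (comult H) (tens F W H w h))"
        using b c by (simp add: spread_tens Wm tmap_tens[OF Wm HH Wm H_module linear_id Hopf.comult_linear]
            \<Psi>_tens linear_closed[OF Hopf.comult_linear] Act.action_on_mult m_def)
    qed (use b c in \<open>simp add: spread_linear Wm\<close>)
    have right_inner: "\<Psi> (tassoc F W H H (tens F (tensor F W H) H x h)) = rmult W (hit h c) (spread W b x)"
      if x: "x \<in> carrier (tensor F W H)" and h: "h \<in> carrier H" for x h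
    proof (rule linear_tensor_eq[OF Wm H_module _ _ _ x])
      show "(\<lambda>x. \<Psi> (tassoc F W H H (tens F (tensor F W H) H x h))) \<in> linear_maps F (tensor F W H) (tensor F W B)"
        by (rule linear_compose[OF _ \<Psi>_linear], rule linear_compose[OF _ tassoc_linear[OF Wm H_module H_module]])
          (intro linear_tens_left WH H_module linear_id h)
      show "(\<lambda>x. rmult W (hit h c) (spread W b x)) \<in> linear_maps F (tensor F W H) (tensor F W B)"
        using b c h by (intro linear_compose[OF spread_linear rmult_linear] Wm) (auto simp: hit_closed)
    qed (use b c h in \<open>simp add: spread_tens Wm H_module tassoc_tens \<Psi>_tens tens_closed m_tens rmult_tens hit_closed\<close>)
    have right: "\<Psi> (tassoc F W H H (tmap F (tensor F W H) H (coact W) (\<lambda>h. h) z)) = ext W (tau W b) (spread W c z)"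
      if "z \<in> carrier (tensor F W H)" for z
    proof (rule linear_tensor_eq[OF Wm H_module _ _ _ that])
      show "(\<lambda>z. \<Psi> (tassoc F W H H (tmap F (tensor F W H) H (coact W) (\<lambda>h. h) z))) \<in> linear_maps F (tensor F W H) (tensor F W B)"
        by (rule linear_compose[OF _ \<Psi>_linear], rule linear_compose[OF _ tassoc_linear[OF Wm H_module H_module]])
          (rule coact_id)
      show "(\<lambda>z. ext W (tau W b) (spread W c z)) \<in> linear_maps F (tensor F W H) (tensor F W B)"
        using b c by (intro linear_compose[OF spread_linear ext_linear] Wm tau_linear Wc)
      fix w h assume "w \<in> carrier W" "h \<in> carrier H"
      then show "\<Psi> (tassoc F W H H (tmap F (tensor F W H) H (coact W) (\<lambda>h. h) (tens F W H w h))) =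
          ext W (tau W b) (spread W c (tens F W H w h))"
        using b c by (simp add: tmap_tens[OF WH H_module Wm H_module W.coact_linear linear_id]
            right_inner linear_closed[OF W.coact_linear] spread_tens Wm ext_tens[OF Wm Wm] tau_linear Wc hit_closed tau_eq)
    qed
    have z: "coact W w \<in> carrier (tensor F W H)" by (rule linear_closed[OF W.coact_linear w])
    have "tau W (b \<otimes>\<^bsub>B\<^esub> c) w = \<Psi> (tmap F W (tensor F H H) (\<lambda>w. w) (comult H) (coact W w))"
      using b c w by (simp add: tau_eq Wc left z)
    also have "\<dots> = ext W (tau W b) (tau W c w)"
      using b c w by (simp add: W.coact_coassoc[symmetric] right z tau_eq Wc)
    finally show ?thesis .
  qed
  show ?thesis using Wc unit mult by (simp add: half_braided_def)
qed

subsection \<open>Tensor products of maps with coefficients\<close>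

text \<open>
  The map \<open>(1 \<otimes> m)(1 \<otimes> \<tau> \<otimes> 1)\<close> as a bilinear operation.  All its properties are derived from the formula
  \<open>(v \<otimes> b) \<cdot> y = v \<otimes> \<tau>\<^sub>b(y)\<close> of \<open>twisted_prod_tens_left\<close>, with \<open>\<tau>\<^sub>b\<close> extended to \<open>W \<otimes> B\<close>.
\<close>

definition twisted_prod where "twisted_prod V W x y = merge V W (tens F (tensor F V B) (tensor F W B) x y)"

context
  fixes V :: "('f, 'v, 'h, 'p) comodule_scheme" and W :: "('f, 'w, 'h, 'q) comodule_scheme"
  assumes V: "module F V" and Wc: "coacted W"
begin

private abbreviation "VWB \<equiv> tensor F (tensor F V W) B"

private lemmas W = coacted_module[OF Wc]

private lemma VW: "module F (tensor F V W)" and VBm: "module F (tensor F V B)" and WBm: "module F (tensor F W B)"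
  and VWBm: "module F VWB"
  by (intro tensor_module V W B_module)+

private lemma merge_bil0:
  assumes "v \<in> carrier V" "c \<in> carrier B"
  shows "(\<lambda>w' d. tens F (tensor F V W) B (tens F V W v w') (d \<otimes>\<^bsub>B\<^esub> c)) \<in> bilinear_maps F W B VWB"
  using assms by (intro bilinear_mapsI linear_tens_left linear_tens_right VW V W B_module linear_id
      bilinear_left[OF Act.mult_bilinear] tens_closed Act.A.m_closed)

private lemma lift0:
  assumes "v \<in> carrier V" "c \<in> carrier B" "x \<in> carrier (tensor F W B)"
  shows "tlift F VWB (\<lambda>w' d. tens F (tensor F V W) B (tens F V W v w') (d \<otimes>\<^bsub>B\<^esub> c)) x = rmult (tensor F V W) c (prepend V W v x)"
proof (rule linear_tensor_eq[OF W B_module tlift_linear[OF W B_module VWBm merge_bil0[OF assms(1,2)]] _ _ assms(3)])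
  show "(\<lambda>x. rmult (tensor F V W) c (prepend V W v x)) \<in> linear_maps F (tensor F W B) VWB"
    using assms by (intro linear_compose[OF prepend_linear rmult_linear] V W VW)
qed (use assms in \<open>simp add: tlift_tens[OF W B_module VWBm merge_bil0] prepend_tens V W rmult_tens VW tens_closed\<close>)

private lemma merge_bil1:
  assumes v: "v \<in> carrier V" and b: "b \<in> carrier B"
  shows "(\<lambda>w c. tlift F VWB (\<lambda>w' d. tens F (tensor F V W) B (tens F V W v w') (d \<otimes>\<^bsub>B\<^esub> c)) (tau W b w))
    \<in> bilinear_maps F W B VWB"
proof (rule bilinear_mapsI)
  fix c assume "c \<in> carrier B"
  then show "(\<lambda>w. tlift F VWB (\<lambda>w' d. tens F (tensor F V W) B (tens F V W v w') (d \<otimes>\<^bsub>B\<^esub> c)) (tau W b w)) \<in> linear_maps F W VWB"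
    using v b by (intro linear_compose[OF tau_linear tlift_linear] Wc W B_module VWBm merge_bil0)
next
  fix w assume w: "w \<in> carrier W"
  show "(\<lambda>c. tlift F VWB (\<lambda>w' d. tens F (tensor F V W) B (tens F V W v w') (d \<otimes>\<^bsub>B\<^esub> c)) (tau W b w)) \<in> linear_maps F B VWB"
    using v b w by (intro tlift_linear_param[OF W B_module VWBm B_module] merge_bil0 tau_closed Wc linear_tens_right VW B_module
       bilinear_right[OF Act.mult_bilinear] tens_closed V W)
qed

private lemma merge_bil2:
  assumes y: "y \<in> carrier (tensor F W B)"
  shows "(\<lambda>v b. tlift F VWB (\<lambda>w c. tlift F VWB (\<lambda>w' d. tens F (tensor F V W) B (tens F V W v w') (d \<otimes>\<^bsub>B\<^esub> c)) (tau W b w)) y)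
    \<in> bilinear_maps F V B VWB"
proof (rule bilinear_mapsI)
  fix b assume b: "b \<in> carrier B"
  show "(\<lambda>v. tlift F VWB (\<lambda>w c. tlift F VWB (\<lambda>w' d. tens F (tensor F V W) B (tens F V W v w') (d \<otimes>\<^bsub>B\<^esub> c)) (tau W b w)) y)
      \<in> linear_maps F V VWB"
    using b by (intro tlift_linear_param[OF W B_module VWBm V] merge_bil1 merge_bil0 y tau_closed Wc linear_tens_left VW V W B_module
        linear_id Act.A.m_closed)
next
  fix v assume v: "v \<in> carrier V"
  show "(\<lambda>b. tlift F VWB (\<lambda>w c. tlift F VWB (\<lambda>w' d. tens F (tensor F V W) B (tens F V W v w') (d \<otimes>\<^bsub>B\<^esub> c)) (tau W b w)) y)
      \<in> linear_maps F B VWB"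
    using v by (intro tlift_linear_param[OF W B_module VWBm B_module _ _ y] merge_bil1
        linear_compose[OF tau_linear' tlift_linear] Wc W B_module VWBm merge_bil0)
qed

private lemma merge_bil3:
  "(\<lambda>x y. tlift F VWB (\<lambda>v b. tlift F VWB (\<lambda>w c. tlift F VWB (\<lambda>w' d. tens F (tensor F V W) B (tens F V W v w') (d \<otimes>\<^bsub>B\<^esub> c))
      (tau W b w)) y) x) \<in> bilinear_maps F (tensor F V B) (tensor F W B) VWB"
proof (rule bilinear_mapsI)
  fix x assume x: "x \<in> carrier (tensor F V B)"
  show "(\<lambda>y. tlift F VWB (\<lambda>v b. tlift F VWB (\<lambda>w c. tlift F VWB (\<lambda>w' d. tens F (tensor F V W) B (tens F V W v w') (d \<otimes>\<^bsub>B\<^esub> c))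
      (tau W b w)) y) x) \<in> linear_maps F (tensor F W B) VWB"
    by (intro tlift_linear_param[OF V B_module VWBm WBm _ _ x] merge_bil2 tlift_linear W B_module VWBm merge_bil1)
qed (intro tlift_linear V B_module VWBm merge_bil2)

private lemma merge_linear: "merge V W \<in> linear_maps F (tensor F (tensor F V B) (tensor F W B)) VWB"
  unfolding dyn_merge_def Let_def tau_def[symmetric] by (rule tlift_linear[OF VBm WBm VWBm merge_bil3])

lemma twisted_prod_bilinear: "twisted_prod V W \<in> bilinear_maps F (tensor F V B) (tensor F W B) VWB"
  unfolding twisted_prod_def
  by (intro bilinear_mapsI linear_compose[OF _ merge_linear] linear_tens_left linear_tens_right VBm WBm linear_id)

lemma twisted_prod_tens_left:
  assumes v: "v \<in> carrier V" and b: "b \<in> carrier B" and y: "y \<in> carrier (tensor F W B)"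
  shows "twisted_prod V W (tens F V B v b) y = prepend V W v (ext W (tau W b) y)"
proof -
  have "twisted_prod V W (tens F V B v b) y =
      tlift F VWB (\<lambda>w c. tlift F VWB (\<lambda>w' d. tens F (tensor F V W) B (tens F V W v w') (d \<otimes>\<^bsub>B\<^esub> c)) (tau W b w)) y"
    unfolding twisted_prod_def dyn_merge_def Let_def tau_def[symmetric]
    using assms by (simp add: tlift_tens[OF VBm WBm VWBm merge_bil3] tlift_tens[OF V B_module VWBm merge_bil2] tens_closed V B_module)
  also have "\<dots> = prepend V W v (ext W (tau W b) y)"
  proof (rule linear_tensor_eq[OF W B_module tlift_linear[OF W B_module VWBm merge_bil1[OF v b]] _ _ y])
    show "(\<lambda>y. prepend V W v (ext W (tau W b) y)) \<in> linear_maps F (tensor F W B) VWB"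
      using v b by (intro linear_compose[OF ext_linear prepend_linear] V W tau_linear Wc)
    fix w c assume "w \<in> carrier W" "c \<in> carrier B"
    then show "tlift F VWB (\<lambda>w c. tlift F VWB (\<lambda>w' d. tens F (tensor F V W) B (tens F V W v w') (d \<otimes>\<^bsub>B\<^esub> c)) (tau W b w))
        (tens F W B w c) = prepend V W v (ext W (tau W b) (tens F W B w c))"
      using v b by (simp add: tlift_tens[OF W B_module VWBm merge_bil1] lift0 tau_closed Wc rmult_prepend V W ext_tens tau_linear)
  qed
  finally show ?thesis .
qed

lemma dtensor_tens:
  assumes "module F X" "module F Y" "f \<in> linear_maps F X (tensor F V B)" "g \<in> linear_maps F Y (tensor F W B)"
    "x \<in> carrier X" "y \<in> carrier Y"
  shows "dtensor V W f g (tens F X Y x y) = twisted_prod V W (f x) (g y)"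
  using assms by (simp add: dyn_tensor_def twisted_prod_def tmap_tens[OF VBm WBm])

lemma dtensor_linear:
  assumes "module F X" "module F Y" "f \<in> linear_maps F X (tensor F V B)" "g \<in> linear_maps F Y (tensor F W B)"
  shows "dtensor V W f g \<in> linear_maps F (tensor F X Y) VWB"
  unfolding dyn_tensor_def comp_def using assms by (intro linear_compose[OF tmap_linear merge_linear] VBm WBm)

lemma rmult_twisted_prod:
  assumes "x \<in> carrier (tensor F V B)" "y \<in> carrier (tensor F W B)" "c \<in> carrier B"
  shows "rmult (tensor F V W) c (twisted_prod V W x y) = twisted_prod V W x (rmult W c y)"
proof (rule linear_tensor_eq[OF V B_module _ _ _ assms(1)])
  show "(\<lambda>x. rmult (tensor F V W) c (twisted_prod V W x y)) \<in> linear_maps F (tensor F V B) VWB"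
    using assms by (intro linear_compose[OF bilinear_left[OF twisted_prod_bilinear] rmult_linear] VW)
  show "(\<lambda>x. twisted_prod V W x (rmult W c y)) \<in> linear_maps F (tensor F V B) VWB"
    using assms by (intro bilinear_left[OF twisted_prod_bilinear] rmult_closed W)
qed (use assms in \<open>simp add: twisted_prod_tens_left rmult_prepend rmult_closed V W ext_closed[OF W W] tau_linear Wc ext_rmult\<close>)

end

end

lemma tensor_comodule_simps [simp]:
  "carrier (tensor_comodule F H V W) = carrier (tensor F V W)"
  "tensor F (tensor_comodule F H V W) X = tensor F (tensor F V W) X"
  "tensor F Y (tensor_comodule F H V W) = tensor F Y (tensor F V W)"
  "tens F (tensor_comodule F H V W) X = tens F (tensor F V W) X"
  "tens F Y (tensor_comodule F H V W) = tens F Y (tensor F V W)"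
  "linear_maps F (tensor_comodule F H V W) X = linear_maps F (tensor F V W) X"
  "linear_maps F Y (tensor_comodule F H V W) = linear_maps F Y (tensor F V W)"
  "tmap F (tensor_comodule F H V W) X = tmap F (tensor F V W) X"
  "tmap F Y (tensor_comodule F H V W) = tmap F Y (tensor F V W)"
  "dyn_ext F B (tensor_comodule F H V W) = dyn_ext F B (tensor F V W)"
  "dyn_id F B (tensor_comodule F H V W) = dyn_id F B (tensor F V W)"
  by (simp_all add: tensor_comodule_def Let_def)

lemma module_tensor_comodule: "module F V \<Longrightarrow> module F W \<Longrightarrow> module F (tensor_comodule F H V W)"
  by (simp add: tensor_comodule_def Let_def module_with_coaction tensor_module)

context dynamical_setting
begin

text \<open>
  The condition under which a coefficient arising to the left of \<open>W\<close> may be moved past \<open>W\<close> either before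
  or after \<open>g\<close> is applied.
\<close>

definition tau_commuting where
  "tau_commuting W g \<longleftrightarrow> (\<forall>b\<in>carrier B. \<forall>y\<in>carrier (tensor F W B).
     ext W g (ext W (tau W b) y) = ext W (tau W b) (ext W g y))"

context
  fixes W :: "('f, 'w, 'h, 'p) comodule_scheme"
  assumes Wc: "coacted W"
begin

private lemmas Wmod = coacted_module[OF Wc]

private lemma WBmod: "module F (tensor F W B)"
  by (intro tensor_module Wmod B_module)

lemma tau_commuting_id: "tau_commuting W (dyn_id F B W)"
  by (simp add: tau_commuting_def ext_id Wmod ext_closed[OF Wmod Wmod] tau_linear Wc)

text \<open>
  The comodule map condition reads \<open>g(w)\<^sub>0 \<otimes> g(w)\<^sub>1 = g(w\<^sub>0) \<otimes> w\<^sub>1\<close> in \<open>W \<otimes> B \<otimes> H\<close>, the coaction on \<open>B\<close>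
  being trivial.  Applying \<open>x \<otimes> h \<mapsto> x \<sigma>(h \<otimes> b)\<close> to both sides gives \<open>\<tau>\<^sub>b g\<close> on the left, where the
  commutativity of \<open>B\<close> is needed to bring \<open>\<sigma>(h \<otimes> b)\<close> to the front, and \<open>g \<tau>\<^sub>b\<close> on the right.
\<close>

lemma tau_commuting_dyn_hom:
  assumes g: "g \<in> dyn_hom F H B W W"
  shows "tau_commuting W g"
  unfolding tau_commuting_def
proof (intro ballI)
  fix b y assume b: "b \<in> carrier B" and y: "y \<in> carrier (tensor F W B)"
  let ?WB = "tensor F W B"
  let ?C = "trivial_comodule F H B"
  have triv: "tensor F W ?C = ?WB" "tens F W ?C = tens F W B" "carrier ?C = carrier B"
    by (simp_all add: trivial_comodule_def)
  have glin: "g \<in> dyn_End W"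
    using g by (simp add: dyn_hom_def comodule_maps_def triv)
  define \<kappa> where "\<kappa> = coact (tensor_comodule F H W ?C)"
  have g_comod: "\<kappa> (g w) = tmap F ?WB H g (\<lambda>h. h) (coact W w)" if "w \<in> carrier W" for w
    using g that by (simp add: dyn_hom_def comodule_maps_def \<kappa>_def triv trivial_comodule_def)
  have \<kappa>_linear: "\<kappa> \<in> linear_maps F ?WB (tensor F ?WB H)"
    using coacted_tensor[OF Wc coacted_trivial] by (simp add: coacted_def \<kappa>_def triv)
  \<comment> \<open>Letting the comodule component act on \<open>b\<close> and multiplying it into the coefficient turns the
    coaction of \<open>Wmod \<otimes> B\<close> into the extension of \<open>tau Wmod b\<close>.\<close>
  define \<Phi> where "\<Phi> = tlift F ?WB (\<lambda>x h. rmult W (hit h b) x)"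
  have \<Phi>_bil: "(\<lambda>x h. rmult W (hit h b) x) \<in> bilinear_maps F ?WB H ?WB"
    using b by (intro bilinear_mapsI rmult_linear Wmod linear_bilinear_left[OF rmult_bilinear] bilinear_left[OF hit_bilinear])
      (auto simp: hit_closed)
  note \<Phi>_linear = tlift_linear[OF WBmod H_module WBmod \<Phi>_bil, folded \<Phi>_def]
  note \<Phi>_tens = tlift_tens[OF WBmod H_module WBmod \<Phi>_bil, folded \<Phi>_def]
  have pair: "\<Phi> (coact_pair W ?C z (tens F B H c \<one>\<^bsub>H\<^esub>)) = rmult W c (spread W b z)"
    if z: "z \<in> carrier (tensor F W H)" and c: "c \<in> carrier B" for z c
  proof (rule linear_tensor_eq[OF Wmod H_module _ _ _ z])
    have c1: "tens F B H c \<one>\<^bsub>H\<^esub> \<in> carrier (tensor F ?C H)"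
      using c by (simp add: trivial_comodule_def tens_closed B_module H_module)
    have "(\<lambda>z. coact_pair W ?C z (tens F B H c \<one>\<^bsub>H\<^esub>)) \<in> linear_maps F (tensor F W H) (tensor F ?WB H)"
      using bilinear_left[OF coact_pair_bilinear[OF Wc coacted_trivial] c1] by (simp add: triv)
    then show "(\<lambda>z. \<Phi> (coact_pair W ?C z (tens F B H c \<one>\<^bsub>H\<^esub>))) \<in> linear_maps F (tensor F W H) ?WB"
      by (rule linear_compose[OF _ \<Phi>_linear])
    show "(\<lambda>z. rmult W c (spread W b z)) \<in> linear_maps F (tensor F W H) ?WB"
      using b c by (intro linear_compose[OF spread_linear rmult_linear] Wmod)
    fix w h assume "w \<in> carrier W" "h \<in> carrier H"
    moreover from this have "coact_pair W ?C (tens F W H w h) (tens F ?C H c \<one>\<^bsub>H\<^esub>) = tens F ?WB H (tens F W B w c) h"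
      using coact_pair_tens[OF Wc coacted_trivial, of w h c "\<one>\<^bsub>H\<^esub>"] c by (simp add: triv)
    ultimately show "\<Phi> (coact_pair W ?C (tens F W H w h) (tens F B H c \<one>\<^bsub>H\<^esub>)) = rmult W c (spread W b (tens F W H w h))"
      using b c by (simp add: trivial_comodule_def \<Phi>_tens tens_closed Wmod B_module rmult_tens hit_closed spread_tens coefficients_comm)
  qed
  have \<Phi>_coact: "\<Phi> (\<kappa> x) = ext W (tau W b) x" if x: "x \<in> carrier ?WB" for x
  proof (rule linear_tensor_eq[OF Wmod B_module linear_compose[OF \<kappa>_linear \<Phi>_linear] _ _ x])
    fix w c assume wc: "w \<in> carrier W" "c \<in> carrier B"
    have "\<kappa> (tens F W B w c) = coact_pair W ?C (coact W w) (tens F B H c \<one>\<^bsub>H\<^esub>)"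
      using wc coact_tensor[OF Wc coacted_trivial, of w c] by (simp add: \<kappa>_def triv) (simp add: trivial_comodule_def)
    moreover have "coact W w \<in> carrier (tensor F W H)"
      using Wc wc by (auto simp: coacted_def linear_closed)
    ultimately show "\<Phi> (\<kappa> (tens F W B w c)) = ext W (tau W b) (tens F W B w c)"
      using wc b by (simp add: pair ext_tens Wmod tau_linear Wc tau_eq)
  qed (use b in \<open>intro ext_linear Wmod tau_linear Wc\<close>)
  have \<Phi>_map: "\<Phi> (tmap F ?WB H g (\<lambda>h. h) z) = ext W g (spread W b z)"
    if z: "z \<in> carrier (tensor F W H)" for z
  proof (rule linear_tensor_eq[OF Wmod H_module linear_compose[OF tmap_linear \<Phi>_linear] _ _ z])
    show "(\<lambda>z. ext W g (spread W b z)) \<in> linear_maps F (tensor F W H) ?WB"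
      using b by (intro linear_compose[OF spread_linear ext_linear] Wmod glin)
    fix w h assume "w \<in> carrier W" "h \<in> carrier H"
    then show "\<Phi> (tmap F ?WB H g (\<lambda>h. h) (tens F W H w h)) = ext W g (spread W b (tens F W H w h))"
      using b by (simp add: tmap_tens[OF WBmod H_module Wmod H_module glin linear_id] \<Phi>_tens linear_closed[OF glin]
          spread_tens Wmod ext_tens[OF Wmod Wmod] glin hit_closed)
  qed (intro WBmod H_module Wmod glin linear_id)+
  show "ext W g (ext W (tau W b) y) = ext W (tau W b) (ext W g y)"
  proof (rule linear_tensor_eq[OF Wmod B_module _ _ _ y])
    show "(\<lambda>y. ext W g (ext W (tau W b) y)) \<in> linear_maps F ?WB ?WB"
      using b by (intro linear_compose[OF ext_linear ext_linear] Wmod tau_linear Wc glin)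
    show "(\<lambda>y. ext W (tau W b) (ext W g y)) \<in> linear_maps F ?WB ?WB"
      using b by (intro linear_compose[OF ext_linear ext_linear] Wmod tau_linear Wc glin)
    fix w c assume wc: "w \<in> carrier W" "c \<in> carrier B"
    have z: "coact W w \<in> carrier (tensor F W H)"
      using Wc wc by (auto simp: coacted_def linear_closed)
    have "ext W g (tau W b w) = ext W (tau W b) (g w)"
      using wc b \<Phi>_coact[of "g w"] \<Phi>_map[OF z] by (simp add: tau_eq Wc g_comod linear_closed[OF glin])
    then show "ext W g (ext W (tau W b) (tens F W B w c)) = ext W (tau W b) (ext W g (tens F W B w c))"
      using wc b by (simp add: ext_tens Wmod tau_linear Wc glin ext_rmult[OF Wmod Wmod] tau_closed linear_closed[OF glin])
  qed
qed

end

context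
  fixes W :: "('f, 'w, 'h, 'p) comodule_scheme"
  assumes Wh: "half_braided W"
begin

private lemmas Wc' = half_braided_coacted[OF Wh]
private lemmas W' = coacted_module[OF Wc']

lemma ext_tau_one: "y \<in> carrier (tensor F W B) \<Longrightarrow> ext W (tau W \<one>\<^bsub>B\<^esub>) y = y"
  by (rule linear_tensor_eq[OF W' B_module ext_linear linear_id])
    (use Wh in \<open>simp_all add: W' Wc' tau_linear ext_tens half_braided_def rmult_tens\<close>)

lemma ext_tau_mult:
  assumes b: "b \<in> carrier B" and c: "c \<in> carrier B" and y: "y \<in> carrier (tensor F W B)"
  shows "ext W (tau W (b \<otimes>\<^bsub>B\<^esub> c)) y = ext W (tau W b) (ext W (tau W c) y)"
proof (rule linear_tensor_eq[OF W' B_module _ _ _ y])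
  show "ext W (tau W (b \<otimes>\<^bsub>B\<^esub> c)) \<in> linear_maps F (tensor F W B) (tensor F W B)"
    using b c by (intro ext_linear W' tau_linear Wc') simp
  show "(\<lambda>y. ext W (tau W b) (ext W (tau W c) y)) \<in> linear_maps F (tensor F W B) (tensor F W B)"
    using b c by (intro linear_compose[OF ext_linear ext_linear] W' tau_linear Wc')
qed (use Wh b c in \<open>simp add: ext_tens W' Wc' tau_linear half_braided_def ext_rmult[OF W' W'] tau_closed\<close>)

end

subsection \<open>The interchange law\<close>

context
  fixes V :: "('f, 'v, 'h, 'p) comodule_scheme" and W :: "('f, 'w, 'h, 'q) comodule_scheme"
  assumes V: "module F V" and Wh: "half_braided W"
begin

private lemmas Wc'' = half_braided_coacted[OF Wh]
private lemmas W'' = coacted_module[OF Wc'']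
private lemmas VW'' = tensor_module[OF V W'']
private lemmas mb = twisted_prod_bilinear[OF V Wc'']
private lemmas mt = twisted_prod_tens_left[OF V Wc'']

lemma twisted_prod_one_left: "\<lbrakk>v \<in> carrier V; y \<in> carrier (tensor F W B)\<rbrakk> \<Longrightarrow> twisted_prod V W (tens F V B v \<one>\<^bsub>B\<^esub>) y = prepend V W v y"
  by (simp add: mt ext_tau_one Wh)

text \<open>
  A coefficient may be moved from the left factor to the right one at the price of \<open>\<tau>\<^sub>b\<close>; this is the
  multiplicativity \<open>\<tau>\<^sub>a\<^sub>b = \<tau>\<^sub>a \<tau>\<^sub>b\<close>.
\<close>

lemma twisted_prod_rmult:
  assumes x: "x \<in> carrier (tensor F V B)" and b: "b \<in> carrier B" and y: "y \<in> carrier (tensor F W B)"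
  shows "twisted_prod V W (rmult V b x) y = twisted_prod V W x (ext W (tau W b) y)"
proof (rule linear_tensor_eq[OF V B_module _ _ _ x])
  show "(\<lambda>x. twisted_prod V W (rmult V b x) y) \<in> linear_maps F (tensor F V B) (tensor F (tensor F V W) B)"
    using b y by (intro linear_bilinear_left[OF mb] rmult_linear V)
  show "(\<lambda>x. twisted_prod V W x (ext W (tau W b) y)) \<in> linear_maps F (tensor F V B) (tensor F (tensor F V W) B)"
    using b y by (intro bilinear_left[OF mb] ext_closed[OF W'' W''] tau_linear Wc'')
qed (use b y in \<open>simp add: rmult_tens V mt ext_tau_mult Wh ext_closed[OF W'' W''] tau_linear Wc''\<close>)

context
  fixes f g
  assumes f: "f \<in> dyn_End V" and g: "g \<in> dyn_End W"
begin

private lemmas fg = dtensor_linear[OF V Wc'' V W'' f g]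

lemma ext_dtensor_prepend:
  assumes v: "v \<in> carrier V" and y: "y \<in> carrier (tensor F W B)"
  shows "ext (tensor F V W) (dtensor V W f g) (prepend V W v y) = twisted_prod V W (f v) (ext W g y)"
proof (rule linear_tensor_eq[OF W'' B_module _ _ _ y])
  show "(\<lambda>y. ext (tensor F V W) (dtensor V W f g) (prepend V W v y)) \<in> linear_maps F (tensor F W B) (tensor F (tensor F V W) B)"
    using v by (intro linear_compose[OF prepend_linear ext_linear] V W'' VW'' fg)
  show "(\<lambda>y. twisted_prod V W (f v) (ext W g y)) \<in> linear_maps F (tensor F W B) (tensor F (tensor F V W) B)"
    using v by (intro linear_bilinear_right[OF mb] ext_linear W'' g linear_closed[OF f])
qed (use v in \<open>simp add: prepend_tens V W'' ext_tens VW'' fg tens_closed dtensor_tens[OF V Wc'' V W'' f g]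
    rmult_twisted_prod[OF V Wc''] linear_closed[OF f] linear_closed[OF g] g\<close>)

text \<open>
  By \<open>twisted_prod_tens_left\<close>, the left side is \<open>f(v) \<cdot> g(\<tau>\<^sub>b(y))\<close> and the right side \<open>(f(v) b) \<cdot> g(y)\<close>,
  that is, \<open>f(v) \<cdot> \<tau>\<^sub>b(g(y))\<close>.  The hypothesis is kept for a single \<open>b\<close>, so that both versions of the
  interchange law follow: for commuting \<open>g\<close> it holds at every \<open>b\<close>, and for arbitrary \<open>g\<close> at \<open>b = 1\<close>.
\<close>

lemma ext_dtensor_twisted_prod_tens:
  assumes v: "v \<in> carrier V" and b: "b \<in> carrier B" and y: "y \<in> carrier (tensor F W B)"
    and comm: "ext W g (ext W (tau W b) y) = ext W (tau W b) (ext W g y)"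
  shows "ext (tensor F V W) (dtensor V W f g) (twisted_prod V W (tens F V B v b) y) = twisted_prod V W (ext V f (tens F V B v b)) (ext W g y)"
  using v b y 
  by (simp add: mt ext_dtensor_prepend ext_closed[OF W'' W''] tau_linear Wc'' comm ext_tens V f g twisted_prod_rmult linear_closed[OF f])

lemma ext_dtensor_twisted_prod:
  assumes g_comm: "tau_commuting W g"
    and x: "x \<in> carrier (tensor F V B)" and y: "y \<in> carrier (tensor F W B)"
  shows "ext (tensor F V W) (dtensor V W f g) (twisted_prod V W x y) = twisted_prod V W (ext V f x) (ext W g y)"
proof (rule linear_tensor_eq[OF V B_module _ _ _ x])
  show "(\<lambda>x. ext (tensor F V W) (dtensor V W f g) (twisted_prod V W x y)) \<in> linear_maps F (tensor F V B) (tensor F (tensor F V W) B)"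
    using y by (intro linear_compose[OF bilinear_left[OF mb] ext_linear] VW'' fg)
  show "(\<lambda>x. twisted_prod V W (ext V f x) (ext W g y)) \<in> linear_maps F (tensor F V B) (tensor F (tensor F V W) B)"
    using y by (intro linear_bilinear_left[OF mb] ext_linear V f ext_closed[OF W'' W''] g)
qed (use y g_comm in \<open>simp add: ext_dtensor_twisted_prod_tens tau_commuting_def\<close>)

lemma dyn_comp_dtensor:
  assumes "tau_commuting W g" and f': "f' \<in> dyn_End V" and g': "g' \<in> dyn_End W" and x: "x \<in> carrier (tensor F V W)"
  shows "dyn_comp F B (tensor F V W) (dtensor V W f g) (dtensor V W f' g') x =
    dtensor V W (dyn_comp F B V f f') (dyn_comp F B W g g') x"
proof (rule linear_tensor_eq[OF V W'' _ _ _ x])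
  have ff: "dyn_comp F B V f f' \<in> dyn_End V" and gg: "dyn_comp F B W g g' \<in> dyn_End W"
    by (rule dyn_comp_linear[OF V V f' f], rule dyn_comp_linear[OF W'' W'' g' g])
  show "dyn_comp F B (tensor F V W) (dtensor V W f g) (dtensor V W f' g') \<in> dyn_End (tensor F V W)"
    by (rule dyn_comp_linear[OF VW'' VW'' dtensor_linear[OF V Wc'' V W'' f' g'] fg])
  show "dtensor V W (dyn_comp F B V f f') (dyn_comp F B W g g') \<in> dyn_End (tensor F V W)"
    by (intro dtensor_linear V Wc'' W'' ff gg)
  fix v w assume "v \<in> carrier V" "w \<in> carrier W"
  then show "dyn_comp F B (tensor F V W) (dtensor V W f g) (dtensor V W f' g') (tens F V W v w) =
    dtensor V W (dyn_comp F B V f f') (dyn_comp F B W g g') (tens F V W v w)"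
    using assms(1)
    by (simp add: dtensor_tens[OF V Wc'' V W''] ff gg)
      (simp add: dyn_comp_def dtensor_tens[OF V Wc'' V W''] f' g' ext_dtensor_twisted_prod linear_closed[OF f'] linear_closed[OF g'])
qed

text \<open>
  The values of \<open>f'\<close> have coefficient 1, and \<open>g\<close> commutes with \<open>\<tau>\<^sub>1 = 1\<close>.
\<close>

lemma dyn_comp_dtensor_scalar:
  assumes s: "s \<in> linear_maps F V V" and g': "g' \<in> dyn_End W" and x: "x \<in> carrier (tensor F V W)"
    and f': "f' \<in> dyn_End V" "\<And>v. v \<in> carrier V \<Longrightarrow> f' v = tens F V B (s v) \<one>\<^bsub>B\<^esub>"
  shows "dyn_comp F B (tensor F V W) (dtensor V W f g) (dtensor V W f' g') x =
    dtensor V W (dyn_comp F B V f f') (dyn_comp F B W g g') x"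
proof (rule linear_tensor_eq[OF V W'' _ _ _ x])
  have ff: "dyn_comp F B V f f' \<in> dyn_End V" and gg: "dyn_comp F B W g g' \<in> dyn_End W"
    by (rule dyn_comp_linear[OF V V f'(1) f], rule dyn_comp_linear[OF W'' W'' g' g])
  show "dyn_comp F B (tensor F V W) (dtensor V W f g) (dtensor V W f' g') \<in> dyn_End (tensor F V W)"
    by (rule dyn_comp_linear[OF VW'' VW'' dtensor_linear[OF V Wc'' V W'' f'(1) g'] fg])
  show "dtensor V W (dyn_comp F B V f f') (dyn_comp F B W g g') \<in> dyn_End (tensor F V W)"
    by (intro dtensor_linear V Wc'' W'' ff gg)
  fix v w assume "v \<in> carrier V" "w \<in> carrier W"
  then show "dyn_comp F B (tensor F V W) (dtensor V W f g) (dtensor V W f' g') (tens F V W v w) =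
    dtensor V W (dyn_comp F B V f f') (dyn_comp F B W g g') (tens F V W v w)"
    by (simp add: dtensor_tens[OF V Wc'' V W''] ff gg)
      (simp add: dyn_comp_def dtensor_tens[OF V Wc'' V W''] f' g' ext_dtensor_twisted_prod_tens ext_tau_one[OF Wh]
        ext_closed[OF W'' W''] g linear_closed[OF s] linear_closed[OF g'])
qed

end

lemma dtensor_id:
  assumes x: "x \<in> carrier (tensor F V W)"
  shows "dtensor V W (dyn_id F B V) (dyn_id F B W) x = dyn_id F B (tensor F V W) x"
  by (rule linear_tensor_eq[OF V W'' _ _ _ x])
    (auto intro!: dtensor_linear V Wc'' W'' VW'' dyn_id_linear simp: dtensor_tens[OF V Wc'' V W''] dyn_id_linear V W'',
     auto simp: dyn_id_def twisted_prod_one_left tens_closed W'' B_module prepend_tens V)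

lemma dtensor_cong:
  assumes "f \<in> dyn_End V" "f' \<in> dyn_End V" "g \<in> dyn_End W" "g' \<in> dyn_End W"
    and "\<And>v. v \<in> carrier V \<Longrightarrow> f v = f' v" "\<And>w. w \<in> carrier W \<Longrightarrow> g w = g' w"
    and x: "x \<in> carrier (tensor F V W)"
  shows "dtensor V W f g x = dtensor V W f' g' x"
  by (rule linear_tensor_eq[OF V W'' _ _ _ x])
    (use assms in \<open>auto intro!: dtensor_linear V Wc'' W'' simp: dtensor_tens[OF V Wc'' V W'']\<close>)

end

end

context dynamical_setting
begin

subsection \<open>Tensor products of half-braided comodules\<close>

context
  fixes V :: "('f, 'v, 'h, 'p) comodule_scheme" and W :: "('f, 'w, 'h, 'q) comodule_scheme"
  assumes V: "coacted V" and W: "coacted W"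
begin

private abbreviation "VW \<equiv> tensor_comodule F H V W"

private lemma mm: "module F V" "module F W" "module F (tensor F V W)" "module F (tensor F V H)"
    "module F (tensor F W H)" "module F (tensor F (tensor F V W) H)"
  using V W by (auto simp: coacted_def intro!: tensor_module H_module)

text \<open>
  On \<open>v \<otimes> w\<close> the left side is \<open>v\<^sub>0 \<otimes> w\<^sub>0 \<otimes> \<sigma>(v\<^sub>1 w\<^sub>1 \<otimes> b)\<close>.  On the right, \<open>v\<^sub>1\<close> acts first and \<open>w\<^sub>1\<close>
  second, which gives \<open>\<sigma>(w\<^sub>1 v\<^sub>1 \<otimes> b)\<close>; the two agree because \<open>H\<close> is commutative.
\<close>

lemma tau_tensor:
  assumes b: "b \<in> carrier B" and x: "x \<in> carrier (tensor F V W)"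
  shows "tau VW b x = dtensor V W (tau V b) (dyn_id F B W) x"
proof -
  have inner: "spread (tensor F V W) b (coact_pair V W (tens F V H v g) y) = prepend V W v (spread W (hit g b) y)"
    if v: "v \<in> carrier V" and g: "g \<in> carrier H" and y: "y \<in> carrier (tensor F W H)" for v g y
  proof (rule linear_tensor_eq[OF mm(2) H_module _ _ _ y])
    show "(\<lambda>y. spread (tensor F V W) b (coact_pair V W (tens F V H v g) y)) \<in>
        linear_maps F (tensor F W H) (tensor F (tensor F V W) B)"
      using v g b by (intro linear_compose[OF bilinear_right[OF coact_pair_bilinear[OF V W]] spread_linear] mm
          tens_closed H_module)
    show "(\<lambda>y. prepend V W v (spread W (hit g b) y)) \<in> linear_maps F (tensor F W H) (tensor F (tensor F V W) B)"
      using v g b by (intro linear_compose[OF spread_linear prepend_linear] mm hit_closed)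
    fix w h assume "w \<in> carrier W" "h \<in> carrier H"
    then show "spread (tensor F V W) b (coact_pair V W (tens F V H v g) (tens F W H w h)) =
        prepend V W v (spread W (hit g b) (tens F W H w h))"
      using v g b by (simp add: coact_pair_tens V W spread_tens mm tens_closed prepend_tens hit_closed
          Hopf.comm[of g h] Act.action_mult)
  qed
  have pair: "spread (tensor F V W) b (coact_pair V W z (coact W w)) = twisted_prod V W (spread V b z) (tens F W B w \<one>\<^bsub>B\<^esub>)"
    if z: "z \<in> carrier (tensor F V H)" and w: "w \<in> carrier W" for z w
  proof (rule linear_tensor_eq[OF mm(1) H_module _ _ _ z])
    have cw: "coact W w \<in> carrier (tensor F W H)" using W w by (auto simp: coacted_def linear_closed)
    have w1: "tens F W B w \<one>\<^bsub>B\<^esub> \<in> carrier (tensor F W B)" using w by (intro tens_closed mm B_module) auto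
    show "(\<lambda>z. spread (tensor F V W) b (coact_pair V W z (coact W w))) \<in>
        linear_maps F (tensor F V H) (tensor F (tensor F V W) B)"
      using b by (intro linear_compose[OF bilinear_left[OF coact_pair_bilinear[OF V W] cw] spread_linear] mm)
    show "(\<lambda>z. twisted_prod V W (spread V b z) (tens F W B w \<one>\<^bsub>B\<^esub>)) \<in> linear_maps F (tensor F V H) (tensor F (tensor F V W) B)"
      using b by (intro linear_compose[OF spread_linear bilinear_left[OF twisted_prod_bilinear[OF mm(1) W] w1]] mm)
    fix v g assume "v \<in> carrier V" "g \<in> carrier H"
    then show "spread (tensor F V W) b (coact_pair V W (tens F V H v g) (coact W w)) =
        twisted_prod V W (spread V b (tens F V H v g)) (tens F W B w \<one>\<^bsub>B\<^esub>)"
      using b w w1 cw by (simp add: inner spread_tens mm twisted_prod_tens_left W hit_closed ext_one tau_linear tau_eq)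
  qed
  have cVW: "coacted VW" by (rule coacted_tensor[OF V W])
  show ?thesis
  proof (rule linear_tensor_eq[OF mm(1,2) _ _ _ x])
    show "tau VW b \<in> dyn_End (tensor F V W)" using tau_linear[OF cVW b] by simp
    show "dtensor V W (tau V b) (dyn_id F B W) \<in> dyn_End (tensor F V W)"
      using b by (intro dtensor_linear W mm tau_linear V dyn_id_linear)
    fix v w assume vw: "v \<in> carrier V" "w \<in> carrier W"
    then have "coact V v \<in> carrier (tensor F V H)" using V by (auto simp: coacted_def linear_closed)
    moreover have "spread VW = spread (tensor F V W)" by (simp add: spread_def fun_eq_iff)
    ultimately show "tau VW b (tens F V W v w) = dtensor V W (tau V b) (dyn_id F B W) (tens F V W v w)"
      using vw b by (simp add: tau_eq[OF cVW] tens_closed mm coact_tensor V W pair dtensor_tens[OF mm(1) W mm(1,2)]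
          tau_linear dyn_id_linear) (simp add: dyn_id_def tau_eq V)
  qed
qed

lemma ext_tau_tensor:
  assumes b: "b \<in> carrier B" and x: "x \<in> carrier (tensor F (tensor F V W) B)"
  shows "ext (tensor F V W) (tau VW b) x = ext (tensor F V W) (dtensor V W (tau V b) (dyn_id F B W)) x"
  by (rule ext_cong[OF mm(3,3) _ _ _ x])
    (use tau_linear[OF coacted_tensor[OF V W] b] b in
      \<open>auto simp: tau_tensor intro!: dtensor_linear W mm tau_linear V dyn_id_linear\<close>)

end

text \<open>
  With \<open>\<tau>\<^sub>b = \<tau>\<^sub>b \<otimes> 1\<close> on \<open>V \<otimes> W\<close>, multiplicativity for \<open>V\<close> is carried over by the interchange law.
\<close>

lemma half_braided_tensor:
  fixes V :: "('f, 'v, 'h, 'p) comodule_scheme" and W :: "('f, 'w, 'h, 'q) comodule_scheme"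
  assumes Vh: "half_braided V" and Wh: "half_braided W"
  shows "half_braided (tensor_comodule F H V W)"
proof -
  note V = half_braided_coacted[OF Vh] and W = half_braided_coacted[OF Wh]
  note m = coacted_module[OF V] coacted_module[OF W]
  let ?VW = "tensor_comodule F H V W" and ?M = "tensor F V W"
  have M: "module F ?M" by (rule tensor_module[OF m])
  have "tau ?VW \<one>\<^bsub>B\<^esub> x = tens F ?M B x \<one>\<^bsub>B\<^esub>" if x: "x \<in> carrier ?M" for x
  proof -
    have "tau ?VW \<one>\<^bsub>B\<^esub> x = dtensor V W (tau V \<one>\<^bsub>B\<^esub>) (dyn_id F B W) x"
      by (simp add: tau_tensor V W x)
    also have "\<dots> = dtensor V W (dyn_id F B V) (dyn_id F B W) x"
      using Vh by (intro dtensor_cong m Wh tau_linear V dyn_id_linear x) (auto simp: half_braided_def dyn_id_def)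
    finally show ?thesis by (simp add: dtensor_id m Wh x) (simp add: dyn_id_def)
  qed
  moreover have "tau ?VW (b \<otimes>\<^bsub>B\<^esub> c) x = ext ?M (tau ?VW b) (tau ?VW c x)"
    if b: "b \<in> carrier B" and c: "c \<in> carrier B" and x: "x \<in> carrier ?M" for b c x
  proof -
    have cl: "tau ?VW c x \<in> carrier (tensor F ?M B)"
      using tau_closed[OF coacted_tensor[OF V W] c] x by simp
    have "ext ?M (tau ?VW b) (tau ?VW c x) =
        dyn_comp F B ?M (dtensor V W (tau V b) (dyn_id F B W)) (dtensor V W (tau V c) (dyn_id F B W)) x"
      using cl by (simp add: ext_tau_tensor V W b) (simp add: dyn_comp_def tau_tensor V W c x)
    also have "\<dots> = dtensor V W (dyn_comp F B V (tau V b) (tau V c)) (dyn_comp F B W (dyn_id F B W) (dyn_id F B W)) x"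
      using b c by (intro dyn_comp_dtensor m Wh tau_linear V dyn_id_linear tau_commuting_id W x)
    also have "\<dots> = dtensor V W (tau V (b \<otimes>\<^bsub>B\<^esub> c)) (dyn_id F B W) x"
      using b c Vh
      by (intro dtensor_cong m Wh dyn_comp_linear[OF m(1,1)] dyn_comp_linear[OF m(2,2)] tau_linear V dyn_id_linear x)
        (auto simp: dyn_comp_def half_braided_def ext_id m linear_closed[OF dyn_id_linear])
    also have "\<dots> = tau ?VW (b \<otimes>\<^bsub>B\<^esub> c) x"
      using b c by (simp add: tau_tensor V W x)
    finally show ?thesis ..
  qed
  ultimately show ?thesis
    unfolding half_braided_def using coacted_tensor[OF V W] by simp
qed

subsection \<open>Associativity\<close>

context
  fixes V :: "('f, 'v, 'h, 'p) comodule_scheme" and W :: "('f, 'w, 'h, 'q) comodule_scheme"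
    and U :: "('f, 'u, 'h, 't) comodule_scheme"
  assumes Vm: "module F V" and Wh: "half_braided W" and Uh: "half_braided U"
begin

private abbreviation "VoW \<equiv> tensor_comodule F H V W"
private abbreviation "WoU \<equiv> tensor_comodule F H W U"
private abbreviation "L \<equiv> tmap F (tensor F (tensor F V W) U) B (tassoc_inv F V W U) (\<lambda>b. b)"

private lemmas Wc = half_braided_coacted[OF Wh] and Uc = half_braided_coacted[OF Uh]
private lemmas Wm = coacted_module[OF half_braided_coacted[OF Wh]] and Um = coacted_module[OF half_braided_coacted[OF Uh]]
private lemmas WUc = half_braided_coacted[OF half_braided_tensor[OF Wh Uh]]

private lemma ms: "module F (tensor F V W)" "module F (tensor F W U)" "module F VoW" "module F WoU"
    "module F (tensor F (tensor F V W) U)" "module F (tensor F V (tensor F W U))"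
  by (intro tensor_module module_tensor_comodule Vm Wm Um)+

private lemma L_lin: "L \<in> linear_maps F (tensor F (tensor F V (tensor F W U)) B) (tensor F (tensor F (tensor F V W) U) B)"
  by (intro tmap_linear ms B_module tassoc_inv_linear Vm Wm Um linear_id)

private lemma L_tens:
  "\<lbrakk>t \<in> carrier (tensor F V (tensor F W U)); b \<in> carrier B\<rbrakk> \<Longrightarrow>
    L (tens F (tensor F V (tensor F W U)) B t b) = tens F (tensor F (tensor F V W) U) B (tassoc_inv F V W U t) b"
  by (rule tmap_tens[OF ms(5) B_module ms(6) B_module tassoc_inv_linear[OF Vm Wm Um] linear_id])

private lemma twisted_prod_V_WU: "twisted_prod V WoU \<in> bilinear_maps F (tensor F V B) (tensor F (tensor F W U) B) (tensor F (tensor F V (tensor F W U)) B)"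
  using twisted_prod_bilinear[OF Vm WUc] by simp

private lemma twisted_prod_VW_U: "twisted_prod VoW U \<in> bilinear_maps F (tensor F (tensor F V W) B) (tensor F U B) (tensor F (tensor F (tensor F V W) U) B)"
  using twisted_prod_bilinear[OF ms(3) Uc] by simp

private lemma twisted_prod_V_WU_tens:
  "\<lbrakk>v \<in> carrier V; b \<in> carrier B; y \<in> carrier (tensor F (tensor F W U) B)\<rbrakk> \<Longrightarrow>
    twisted_prod V WoU (tens F V B v b) y = prepend V (tensor F W U) v (ext (tensor F W U) (tau WoU b) y)"
  using twisted_prod_tens_left[OF Vm WUc, of v b y] by simp

private lemma twisted_prod_VW_U_tens:
  "\<lbrakk>x \<in> carrier (tensor F V W); b \<in> carrier B; z \<in> carrier (tensor F U B)\<rbrakk> \<Longrightarrow>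
    twisted_prod VoW U (tens F (tensor F V W) B x b) z = prepend (tensor F V W) U x (ext U (tau U b) z)"
  using twisted_prod_tens_left[OF ms(3) Uc, of x b z] by simp

text \<open>
  Associativity is peeled off one factor at a time: first when both left factors are pure vectors, then
  when only the leftmost one is, and finally in general.
\<close>

private lemma L_prepend_prepend:
  assumes v: "v \<in> carrier V" and w: "w \<in> carrier W" and z: "z \<in> carrier (tensor F U B)"
  shows "L (prepend V (tensor F W U) v (prepend W U w z)) = prepend (tensor F V W) U (tens F V W v w) z"
proof (rule linear_tensor_eq[OF Um B_module _ _ _ z])
  show "(\<lambda>z. L (prepend V (tensor F W U) v (prepend W U w z))) \<in> linear_maps F (tensor F U B) (tensor F (tensor F (tensor F V W) U) B)"
    using v w by (intro linear_compose[OF linear_compose[OF prepend_linear prepend_linear] L_lin] Vm Wm Um ms)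
  show "prepend (tensor F V W) U (tens F V W v w) \<in> linear_maps F (tensor F U B) (tensor F (tensor F (tensor F V W) U) B)"
    using v w by (intro prepend_linear Um ms tens_closed Vm Wm)
qed (use v w in \<open>simp add: prepend_tens Vm Wm Um ms tens_closed L_tens tassoc_inv_tens\<close>)

private lemma L_prepend_twisted_prod:
  assumes v: "v \<in> carrier V" and y: "y \<in> carrier (tensor F W B)" and z: "z \<in> carrier (tensor F U B)"
  shows "L (prepend V (tensor F W U) v (twisted_prod W U y z)) = twisted_prod VoW U (prepend V W v y) z"
proof (rule linear_tensor_eq[OF Wm B_module _ _ _ y])
  show "(\<lambda>y. L (prepend V (tensor F W U) v (twisted_prod W U y z))) \<in> linear_maps F (tensor F W B) (tensor F (tensor F (tensor F V W) U) B)"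
    using v z by (intro linear_compose[OF linear_compose[OF bilinear_left[OF twisted_prod_bilinear] prepend_linear] L_lin] Vm Wm Uc ms)
  show "(\<lambda>y. twisted_prod VoW U (prepend V W v y) z) \<in> linear_maps F (tensor F W B) (tensor F (tensor F (tensor F V W) U) B)"
    using v z by (intro linear_compose[OF prepend_linear bilinear_left[OF twisted_prod_VW_U]] Vm Wm)
qed (use v z in \<open>simp add: twisted_prod_tens_left[OF Wm Uc] L_prepend_prepend ext_closed[OF Um Um] tau_linear Uc prepend_tens Vm Wm tens_closed twisted_prod_VW_U_tens\<close>)

text \<open>
  For \<open>x = v \<otimes> b\<close> both sides are \<open>v \<otimes> (\<tau>\<^sub>b(y) \<cdot> z)\<close> up to bracketing: on the left because \<open>\<tau>\<^sub>b\<close> on \<open>W \<otimes> U\<close> is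
  \<open>\<tau>\<^sub>b \<otimes> 1\<close>, so that \<open>\<tau>\<^sub>b(y \<cdot> z) = \<tau>\<^sub>b(y) \<cdot> z\<close>.
\<close>

lemma twisted_prod_assoc:
  assumes x: "x \<in> carrier (tensor F V B)" and y: "y \<in> carrier (tensor F W B)" and z: "z \<in> carrier (tensor F U B)"
  shows "L (twisted_prod V WoU x (twisted_prod W U y z)) = twisted_prod VoW U (twisted_prod V W x y) z"
proof (rule linear_tensor_eq[OF Vm B_module _ _ _ x])
  have yz: "twisted_prod W U y z \<in> carrier (tensor F (tensor F W U) B)"
    by (rule bilinear_closed[OF twisted_prod_bilinear[OF Wm Uc] y z])
  show "(\<lambda>x. L (twisted_prod V WoU x (twisted_prod W U y z))) \<in> linear_maps F (tensor F V B) (tensor F (tensor F (tensor F V W) U) B)"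
    by (rule linear_compose[OF bilinear_left[OF twisted_prod_V_WU yz] L_lin])
  show "(\<lambda>x. twisted_prod VoW U (twisted_prod V W x y) z) \<in> linear_maps F (tensor F V B) (tensor F (tensor F (tensor F V W) U) B)"
    by (rule linear_compose[OF bilinear_left[OF twisted_prod_bilinear[OF Vm Wc] y] bilinear_left[OF twisted_prod_VW_U z]])
  fix v b assume v: "v \<in> carrier V" and b: "b \<in> carrier B"
  have y': "ext W (tau W b) y \<in> carrier (tensor F W B)"
    using b y by (intro ext_closed[OF Wm Wm] tau_linear Wc)
  have "ext (tensor F W U) (tau WoU b) (twisted_prod W U y z) = twisted_prod W U (ext W (tau W b) y) z"
    using b y z
    by (simp add: ext_tau_tensor Wc Uc yz ext_dtensor_twisted_prod[OF Wm Uh] tau_linear dyn_id_linear Um tau_commuting_id ext_id)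
  then show "L (twisted_prod V WoU (tens F V B v b) (twisted_prod W U y z)) = twisted_prod VoW U (twisted_prod V W (tens F V B v b) y) z"
    using v b y z y' by (simp add: twisted_prod_V_WU_tens yz L_prepend_twisted_prod twisted_prod_tens_left[OF Vm Wc])
qed

end

lemma dtensor_assoc:
  fixes V :: "('f, 'v, 'h, 'p) comodule_scheme" and W :: "('f, 'w, 'h, 'q) comodule_scheme"
    and U :: "('f, 'u, 'h, 't) comodule_scheme"
  assumes V: "module F V" and Wh: "half_braided W" and Uh: "half_braided U"
    and f: "f \<in> dyn_End V" and g: "g \<in> dyn_End W" and h: "h \<in> dyn_End U"
    and x: "x \<in> carrier (tensor F (tensor F V W) U)"
  shows "rebracket V W U (dtensor V (tensor_comodule F H W U) f (dtensor W U g h)) x =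
    dtensor (tensor_comodule F H V W) U (dtensor V W f g) h x"
proof -
  note Wc = half_braided_coacted[OF Wh] and Uc = half_braided_coacted[OF Uh]
  note W = coacted_module[OF Wc] and U = coacted_module[OF Uc]
  have WUc: "coacted (tensor_comodule F H W U)" by (rule coacted_tensor[OF Wc Uc])
  have m: "module F (tensor F W U)" "module F (tensor F V W)" "module F (tensor_comodule F H V W)"
    by (intro tensor_module module_tensor_comodule V W U)+
  have gh: "dtensor W U g h \<in> dyn_End (tensor F W U)" and fg: "dtensor V W f g \<in> dyn_End (tensor F V W)"
    by (intro dtensor_linear V W U Wc Uc f g h)+
  have l: "dtensor V (tensor_comodule F H W U) f (dtensor W U g h) \<in> dyn_End (tensor F V (tensor F W U))"
    using dtensor_linear[OF V WUc V m(1) f, of "dtensor W U g h"] gh by simp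
  have r: "dtensor (tensor_comodule F H V W) U (dtensor V W f g) h \<in> dyn_End (tensor F (tensor F V W) U)"
    using dtensor_linear[OF m(3) Uc m(2) U, of "dtensor V W f g" h] fg h by simp
  show ?thesis
  proof (rule linear_tensor3_eq[OF V W U rebracket_linear[OF V W U l] r _ x])
    fix v w u assume vwu: "v \<in> carrier V" "w \<in> carrier W" "u \<in> carrier U"
    then have "dtensor V (tensor_comodule F H W U) f (dtensor W U g h) (tens F V (tensor F W U) v (tens F W U w u)) =
        twisted_prod V (tensor_comodule F H W U) (f v) (twisted_prod W U (g w) (h u))"
      using dtensor_tens[OF V WUc V m(1) f, of "dtensor W U g h" v "tens F W U w u"] gh
      by (simp add: dtensor_tens[OF W Uc W U g h] tens_closed W U)
    moreover have "dtensor (tensor_comodule F H V W) U (dtensor V W f g) h (tens F (tensor F V W) U (tens F V W v w) u) =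
        twisted_prod (tensor_comodule F H V W) U (twisted_prod V W (f v) (g w)) (h u)"
      using vwu dtensor_tens[OF m(3) Uc m(2) U, of "dtensor V W f g" h "tens F V W v w" u] fg h
      by (simp add: dtensor_tens[OF V Wc V W f g] tens_closed V W)
    ultimately show "rebracket V W U (dtensor V (tensor_comodule F H W U) f (dtensor W U g h))
          (tens F (tensor F V W) U (tens F V W v w) u) =
        dtensor (tensor_comodule F H V W) U (dtensor V W f g) h (tens F (tensor F V W) U (tens F V W v w) u)"
      using vwu by (simp add: rebracket_def tassoc_tens V W U twisted_prod_assoc[OF V Wh Uh] linear_closed[OF f]
          linear_closed[OF g] linear_closed[OF h])
  qed
qed

end

section \<open>Recovering an operator from its scalar extension\<close>

text \<open>
  By Zorn's lemma there is a submodule \<open>N\<close> maximal among those not containing \<open>e\<close>.  Adjoining to \<open>N\<close> any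
  further element \<open>x\<close> captures \<open>e\<close>, and dividing by the coefficient of \<open>x\<close> puts \<open>x\<close> into \<open>N + F e\<close>.
\<close>

lemma exists_functional:
  assumes "field F" "module F M" and e: "e \<in> carrier M" "e \<noteq> \<zero>\<^bsub>M\<^esub>"
  obtains \<phi> where "\<And>x. x \<in> carrier M \<Longrightarrow> \<phi> x \<in> carrier F"
    "\<And>x y. \<lbrakk>x \<in> carrier M; y \<in> carrier M\<rbrakk> \<Longrightarrow> \<phi> (x \<oplus>\<^bsub>M\<^esub> y) = \<phi> x \<oplus>\<^bsub>F\<^esub> \<phi> y"
    "\<And>a x. \<lbrakk>a \<in> carrier F; x \<in> carrier M\<rbrakk> \<Longrightarrow> \<phi> (a \<odot>\<^bsub>M\<^esub> x) = a \<otimes>\<^bsub>F\<^esub> \<phi> x"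
    "\<phi> e = \<one>\<^bsub>F\<^esub>"
proof -
  interpret F: field F by fact
  interpret module F M by fact
  define \<N> where "\<N> = {N. submodule N F M \<and> e \<notin> N}"
  have zero: "\<zero>\<^bsub>M\<^esub> \<in> N" if "submodule N F M" for N
    using submoduleE(2,3,5,1)[OF that] by (metis M.r_neg ex_in_conv subsetD)
  have "\<exists>N\<in>\<N>. \<forall>N'\<in>\<N>. N \<subseteq> N' \<longrightarrow> N' = N"
  proof (rule subset_Zorn_nonempty)
    have "submodule {\<zero>\<^bsub>M\<^esub>} F M" by (rule submoduleI) auto
    then show "\<N> \<noteq> {}" using e by (auto simp: \<N>_def)
  next
    fix C assume C: "C \<noteq> {}" "subset.chain \<N> C"
    then have sub: "submodule N F M" "e \<notin> N" if "N \<in> C" for N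
      using that by (auto simp: subset_chain_def \<N>_def)
    have common: "\<exists>N\<in>C. a \<in> N \<and> b \<in> N" if "a \<in> \<Union>C" "b \<in> \<Union>C" for a b
      using that C(2) unfolding subset_chain_def by blast
    have "submodule (\<Union>C) F M"
    proof (rule submoduleI)
      show "\<Union>C \<subseteq> carrier M" using submoduleE(1)[OF sub(1)] by blast
      show "\<zero>\<^bsub>M\<^esub> \<in> \<Union>C" using C(1) zero[OF sub(1)] by blast
      show "\<ominus>\<^bsub>M\<^esub> a \<in> \<Union>C" if "a \<in> \<Union>C" for a using that submoduleE(3)[OF sub(1)] by blast
      show "a \<oplus>\<^bsub>M\<^esub> b \<in> \<Union>C" if "a \<in> \<Union>C" "b \<in> \<Union>C" for a b
        using common[OF that] submoduleE(5)[OF sub(1)] by blast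
      show "a \<odot>\<^bsub>M\<^esub> x \<in> \<Union>C" if "a \<in> carrier F" "x \<in> \<Union>C" for a x
        using that submoduleE(4)[OF sub(1)] by blast
    qed
    then show "\<Union>C \<in> \<N>" using sub by (auto simp: \<N>_def)
  qed
  then obtain N where N: "submodule N F M" "e \<notin> N" and max: "\<And>N'. \<lbrakk>submodule N' F M; e \<notin> N'; N \<subseteq> N'\<rbrakk> \<Longrightarrow> N' = N"
    unfolding \<N>_def by blast
  note Nc = submoduleE(1)[OF N(1)] and Nn = submoduleE(3)[OF N(1)] and Ns = submoduleE(4)[OF N(1)]
    and Na = submoduleE(5)[OF N(1)]
  \<comment> \<open>By maximality \<open>M = N \<oplus> F e\<close>; the functional is the second coordinate.\<close>
  have ex: "\<exists>c\<in>carrier F. \<exists>n\<in>N. x = n \<oplus>\<^bsub>M\<^esub> c \<odot>\<^bsub>M\<^esub> e" if x: "x \<in> carrier M" for x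
  proof (cases "x \<in> N")
    case True
    then show ?thesis using x e by (intro bexI[of _ "\<zero>\<^bsub>F\<^esub>"] bexI[of _ x]) auto
  next
    case False
    let ?N' = "{n \<oplus>\<^bsub>M\<^esub> a \<odot>\<^bsub>M\<^esub> x | n a. n \<in> N \<and> a \<in> carrier F}"
    have sm: "submodule ?N' F M"
    proof (rule submoduleI)
      show "?N' \<subseteq> carrier M" using x Nc by auto
      have "\<zero>\<^bsub>M\<^esub> = \<zero>\<^bsub>M\<^esub> \<oplus>\<^bsub>M\<^esub> \<zero>\<^bsub>F\<^esub> \<odot>\<^bsub>M\<^esub> x" using x by simp
      then show "\<zero>\<^bsub>M\<^esub> \<in> ?N'" using zero[OF N(1)] by blast
    next
      fix y assume "y \<in> ?N'"
      then obtain n a where y: "y = n \<oplus>\<^bsub>M\<^esub> a \<odot>\<^bsub>M\<^esub> x" "n \<in> N" "a \<in> carrier F" by blast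
      then have "\<ominus>\<^bsub>M\<^esub> y = \<ominus>\<^bsub>M\<^esub> n \<oplus>\<^bsub>M\<^esub> (\<ominus>\<^bsub>F\<^esub> a) \<odot>\<^bsub>M\<^esub> x"
        using x Nc by (auto simp: M.minus_add smult_l_minus)
      then show "\<ominus>\<^bsub>M\<^esub> y \<in> ?N'" using y Nn by blast
      fix z assume "z \<in> ?N'"
      then obtain n' a' where z: "z = n' \<oplus>\<^bsub>M\<^esub> a' \<odot>\<^bsub>M\<^esub> x" "n' \<in> N" "a' \<in> carrier F" by blast
      have "n \<in> carrier M" "n' \<in> carrier M" using y z Nc by auto
      then have "y \<oplus>\<^bsub>M\<^esub> z = (n \<oplus>\<^bsub>M\<^esub> n') \<oplus>\<^bsub>M\<^esub> (a \<oplus>\<^bsub>F\<^esub> a') \<odot>\<^bsub>M\<^esub> x"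
        using x y z by (simp add: smult_l_distr M.a_ac)
      then show "y \<oplus>\<^bsub>M\<^esub> z \<in> ?N'" using y z Na by blast
    next
      fix c y assume c: "c \<in> carrier F" and "y \<in> ?N'"
      then obtain n a where y: "y = n \<oplus>\<^bsub>M\<^esub> a \<odot>\<^bsub>M\<^esub> x" "n \<in> N" "a \<in> carrier F" by blast
      then have "c \<odot>\<^bsub>M\<^esub> y = c \<odot>\<^bsub>M\<^esub> n \<oplus>\<^bsub>M\<^esub> (c \<otimes>\<^bsub>F\<^esub> a) \<odot>\<^bsub>M\<^esub> x"
        using x c Nc by (auto simp: smult_r_distr smult_assoc1)
      then show "c \<odot>\<^bsub>M\<^esub> y \<in> ?N'" using y c Ns by blast
    qed
    have sub: "N \<subseteq> ?N'"
    proof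
      fix n assume n: "n \<in> N"
      then have "n = n \<oplus>\<^bsub>M\<^esub> \<zero>\<^bsub>F\<^esub> \<odot>\<^bsub>M\<^esub> x" using Nc x by auto
      then show "n \<in> ?N'" using n by blast
    qed
    have "x = \<zero>\<^bsub>M\<^esub> \<oplus>\<^bsub>M\<^esub> \<one>\<^bsub>F\<^esub> \<odot>\<^bsub>M\<^esub> x" using x by simp
    then have xN': "x \<in> ?N'" using zero[OF N(1)] by blast
    have "e \<in> ?N'"
    proof (rule ccontr)
      assume "e \<notin> ?N'"
      then have "?N' = N" by (rule max[OF sm _ sub])
      from xN' this have "x \<in> N" by (rule back_subst)
      then show False using False by contradiction
    qed
    then obtain n a where na: "e = n \<oplus>\<^bsub>M\<^esub> a \<odot>\<^bsub>M\<^esub> x" "n \<in> N" "a \<in> carrier F" by blast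
    have nM: "n \<in> carrier M" using na Nc by blast
    have "a \<noteq> \<zero>\<^bsub>F\<^esub>" using na N(2) x nM by auto
    then have a: "inv\<^bsub>F\<^esub> a \<in> carrier F" "inv\<^bsub>F\<^esub> a \<otimes>\<^bsub>F\<^esub> a = \<one>\<^bsub>F\<^esub>"
      using na F.field_Units by auto
    have "inv\<^bsub>F\<^esub> a \<odot>\<^bsub>M\<^esub> e = inv\<^bsub>F\<^esub> a \<odot>\<^bsub>M\<^esub> n \<oplus>\<^bsub>M\<^esub> x"
      using na a x nM by (simp add: smult_r_distr smult_assoc1[symmetric])
    then have "x = (\<ominus>\<^bsub>M\<^esub> (inv\<^bsub>F\<^esub> a \<odot>\<^bsub>M\<^esub> n)) \<oplus>\<^bsub>M\<^esub> inv\<^bsub>F\<^esub> a \<odot>\<^bsub>M\<^esub> e"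
      using a x nM by (simp add: M.r_neg1)
    then show ?thesis using a na Nn Ns by blast
  qed
  have uniq: "c = c'" if "c \<in> carrier F" "c' \<in> carrier F" "n \<in> N" "n' \<in> N"
    "n \<oplus>\<^bsub>M\<^esub> c \<odot>\<^bsub>M\<^esub> e = n' \<oplus>\<^bsub>M\<^esub> c' \<odot>\<^bsub>M\<^esub> e" for c c' n n'
  proof (rule ccontr)
    assume "c \<noteq> c'"
    have nM: "n \<in> carrier M" "n' \<in> carrier M" using that Nc by auto
    let ?d = "c \<oplus>\<^bsub>F\<^esub> \<ominus>\<^bsub>F\<^esub> c'"
    have "?d \<noteq> \<zero>\<^bsub>F\<^esub>" using \<open>c \<noteq> c'\<close> that by (metis F.minus_equality F.minus_minus F.a_inv_closed F.a_comm)
    then have d: "inv\<^bsub>F\<^esub> ?d \<in> carrier F" "inv\<^bsub>F\<^esub> ?d \<otimes>\<^bsub>F\<^esub> ?d = \<one>\<^bsub>F\<^esub>" "?d \<in> carrier F"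
      using that F.field_Units by auto
    have "c \<odot>\<^bsub>M\<^esub> e = \<ominus>\<^bsub>M\<^esub> n \<oplus>\<^bsub>M\<^esub> (n \<oplus>\<^bsub>M\<^esub> c \<odot>\<^bsub>M\<^esub> e)"
      using that(1,2) nM e by (simp add: M.r_neg1)
    also have "\<dots> = (\<ominus>\<^bsub>M\<^esub> n \<oplus>\<^bsub>M\<^esub> n') \<oplus>\<^bsub>M\<^esub> c' \<odot>\<^bsub>M\<^esub> e"
      using that nM e by (simp add: M.a_assoc)
    finally have "?d \<odot>\<^bsub>M\<^esub> e = \<ominus>\<^bsub>M\<^esub> n \<oplus>\<^bsub>M\<^esub> n'"
      using that nM e by (simp add: smult_l_distr smult_l_minus M.a_assoc M.r_neg)
    then have "?d \<odot>\<^bsub>M\<^esub> e \<in> N" using that Na Nn by simp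
    then have "inv\<^bsub>F\<^esub> ?d \<odot>\<^bsub>M\<^esub> (?d \<odot>\<^bsub>M\<^esub> e) \<in> N" using d Ns by blast
    then show False using d e N(2) by (simp add: smult_assoc1[symmetric])
  qed
  define \<phi> where "\<phi> x = (THE c. c \<in> carrier F \<and> (\<exists>n\<in>N. x = n \<oplus>\<^bsub>M\<^esub> c \<odot>\<^bsub>M\<^esub> e))" for x
  have \<phi>: "\<phi> x = c" if "c \<in> carrier F" "n \<in> N" "x = n \<oplus>\<^bsub>M\<^esub> c \<odot>\<^bsub>M\<^esub> e" for x c n
    unfolding \<phi>_def using that uniq by (intro the_equality) blast+
  show ?thesis
  proof (rule that[of \<phi>])
    fix x assume x: "x \<in> carrier M"
    then obtain c n where cn: "c \<in> carrier F" "n \<in> N" "x = n \<oplus>\<^bsub>M\<^esub> c \<odot>\<^bsub>M\<^esub> e" using ex by blast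
    have nM: "n \<in> carrier M" using cn Nc by blast
    show "\<phi> x \<in> carrier F" using \<phi>[OF cn] cn by simp
    show "\<phi> (a \<odot>\<^bsub>M\<^esub> x) = a \<otimes>\<^bsub>F\<^esub> \<phi> x" if a: "a \<in> carrier F" for a
      using cn a e nM \<phi>[OF cn] Ns
      by (intro \<phi>[of _ "a \<odot>\<^bsub>M\<^esub> n"]) (auto simp: smult_r_distr smult_assoc1)
    fix y assume "y \<in> carrier M"
    then obtain d m where dm: "d \<in> carrier F" "m \<in> N" "y = m \<oplus>\<^bsub>M\<^esub> d \<odot>\<^bsub>M\<^esub> e" using ex by blast
    have mM: "m \<in> carrier M" using dm Nc by blast
    show "\<phi> (x \<oplus>\<^bsub>M\<^esub> y) = \<phi> x \<oplus>\<^bsub>F\<^esub> \<phi> y"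
      using cn dm e nM mM \<phi>[OF cn] \<phi>[OF dm] Na
      by (intro \<phi>[of _ "n \<oplus>\<^bsub>M\<^esub> m"]) (auto simp: smult_l_distr M.a_ac)
  next
    show "\<phi> e = \<one>\<^bsub>F\<^esub>" using e zero[OF N(1)] by (intro \<phi>[of _ "\<zero>\<^bsub>M\<^esub>"]) auto
  qed
qed

text \<open>
  A functional \<open>\<phi>\<close> with \<open>\<phi>(e) = 1\<close> yields the left inverse \<open>v \<otimes> b \<mapsto> \<phi>(b) v\<close>.
\<close>

lemma tens_right_injective:
  assumes F: "field F" and V: "module F V" and M: "module F M" and e: "e \<in> carrier M" "e \<noteq> \<zero>\<^bsub>M\<^esub>"
    and x: "x \<in> carrier V" and y: "y \<in> carrier V" and eq: "tens F V M x e = tens F V M y e"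
  shows "x = y"
proof (rule exists_functional[OF F M e])
  interpret V: module F V by fact
  fix \<phi> assume \<phi>: "\<And>x. x \<in> carrier M \<Longrightarrow> \<phi> x \<in> carrier F"
    "\<And>x y. \<lbrakk>x \<in> carrier M; y \<in> carrier M\<rbrakk> \<Longrightarrow> \<phi> (x \<oplus>\<^bsub>M\<^esub> y) = \<phi> x \<oplus>\<^bsub>F\<^esub> \<phi> y"
    "\<And>a x. \<lbrakk>a \<in> carrier F; x \<in> carrier M\<rbrakk> \<Longrightarrow> \<phi> (a \<odot>\<^bsub>M\<^esub> x) = a \<otimes>\<^bsub>F\<^esub> \<phi> x" "\<phi> e = \<one>\<^bsub>F\<^esub>"
  have bil: "(\<lambda>v b. \<phi> b \<odot>\<^bsub>V\<^esub> v) \<in> bilinear_maps F V M V"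
    by (intro bilinear_mapsI linear_mapsI)
      (auto simp: \<phi> V.smult_r_distr V.smult_l_distr V.smult_assoc1[symmetric] V.m_comm)
  have "tlift F V (\<lambda>v b. \<phi> b \<odot>\<^bsub>V\<^esub> v) (tens F V M v e) = v" if "v \<in> carrier V" for v
    using that e by (simp add: tlift_tens[OF V M V bil] \<phi>)
  then show "x = y" using x y eq by metis
qed

context coefficient_algebra
begin

text \<open>
  Since \<open>v \<otimes> a 1 = a v \<otimes> 1\<close>, every value of \<open>f\<close> is of the form \<open>w \<otimes> 1\<close>; injectivity of \<open>w \<mapsto> w \<otimes> 1\<close> makes \<open>w\<close>
  unique, and hence linear in the argument.
\<close>

lemma scalar_op_linear:
  assumes "field F" and nz: "\<one>\<^bsub>B\<^esub> \<noteq> \<zero>\<^bsub>B\<^esub>" and M: "module F M" and f: "f \<in> dyn_End M"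
    and scal: "f ` carrier M \<subseteq> scalar_part F B M"
  shows "x \<in> carrier M \<Longrightarrow> f x = tens F M B (scalar_op F B M f x) \<one>\<^bsub>B\<^esub>" and "scalar_op F B M f \<in> linear_maps F M M"
proof -
  interpret M: module F M by (rule M)
  note inj = tens_right_injective[OF \<open>field F\<close> M B_module _ nz]
  note tl = bilinear_left[OF tens_bilinear[OF M B_module], of "\<one>\<^bsub>B\<^esub>"]
  have *: "scalar_op F B M f x \<in> carrier M \<and> f x = tens F M B (scalar_op F B M f x) \<one>\<^bsub>B\<^esub>" if x: "x \<in> carrier M" for x
  proof -
    obtain v a where va: "v \<in> carrier M" "a \<in> carrier F" "f x = tens F M B v (a \<odot>\<^bsub>B\<^esub> \<one>\<^bsub>B\<^esub>)"
      using scal x by (auto simp: scalar_part_def)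
    have "f x = tens F M B (a \<odot>\<^bsub>M\<^esub> v) \<one>\<^bsub>B\<^esub>"
      using va by (simp add: linear_smult[OF tl] linear_smult[OF bilinear_right[OF tens_bilinear[OF M B_module]]])
    then have "\<exists>!w. w \<in> carrier M \<and> f x = tens F M B w \<one>\<^bsub>B\<^esub>"
      using va by (intro ex1I[of _ "a \<odot>\<^bsub>M\<^esub> v"]) (auto intro: inj)
    then show ?thesis unfolding scalar_op_def by (rule theI')
  qed
  then show "x \<in> carrier M \<Longrightarrow> f x = tens F M B (scalar_op F B M f x) \<one>\<^bsub>B\<^esub>" by blast
  show "scalar_op F B M f \<in> linear_maps F M M"
  proof (rule linear_mapsI)
    fix x assume x: "x \<in> carrier M"
    then show "scalar_op F B M f x \<in> carrier M" using * by blast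
    show "scalar_op F B M f (a \<odot>\<^bsub>M\<^esub> x) = a \<odot>\<^bsub>M\<^esub> scalar_op F B M f x" if a: "a \<in> carrier F" for a
    proof (rule inj)
      show "tens F M B (scalar_op F B M f (a \<odot>\<^bsub>M\<^esub> x)) \<one>\<^bsub>B\<^esub> = tens F M B (a \<odot>\<^bsub>M\<^esub> scalar_op F B M f x) \<one>\<^bsub>B\<^esub>"
        using x a *[of x] *[of "a \<odot>\<^bsub>M\<^esub> x"] by (simp add: linear_smult[OF tl] linear_smult[OF f])
    qed (use x a * in auto)
    fix y assume y: "y \<in> carrier M"
    show "scalar_op F B M f (x \<oplus>\<^bsub>M\<^esub> y) = scalar_op F B M f x \<oplus>\<^bsub>M\<^esub> scalar_op F B M f y"
    proof (rule inj)
      show "tens F M B (scalar_op F B M f (x \<oplus>\<^bsub>M\<^esub> y)) \<one>\<^bsub>B\<^esub> =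
          tens F M B (scalar_op F B M f x \<oplus>\<^bsub>M\<^esub> scalar_op F B M f y) \<one>\<^bsub>B\<^esub>"
        using x y *[of x] *[of y] *[of "x \<oplus>\<^bsub>M\<^esub> y"] by (simp add: linear_add[OF tl] linear_add[OF f])
    qed (use x y * in auto)
  qed
qed

end

section \<open>Gauge transformations\<close>

locale dynamical_comodule = dynamical_setting F H B \<sigma>
  for F :: "('f, 'm) ring_scheme" and H :: "('f, 'h, 'n) hopf_scheme"
    and B :: "('f, 'b, 'r) module_scheme" and \<sigma> :: "('h \<times> 'b \<Rightarrow> 'f) set \<Rightarrow> 'b" +
  fixes V :: "('f, 'v, 'h, 'p) comodule_scheme"
  assumes V_half_braided: "half_braided V"
begin

text \<open>
  \<open>Vc\<close> is \<open>V \<otimes> V\<close> with its coaction, as the twisted tensor product requires; \<open>VV\<close> is the underlying module.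
  In the notation of the introduction, \<open>A\<^sub>1\<close>, \<open>A\<^sub>2\<close> and \<open>A\<^sub>3\<close> on the triple product are \<open>on12 (first A)\<close>,
  \<open>on12 (second A)\<close> and \<open>on23 (second A)\<close>.
\<close>

abbreviation "VV \<equiv> tensor F V V"
abbreviation "Vc \<equiv> tensor_comodule F H V V"
abbreviation "VVV \<equiv> tensor F VV V"
abbreviation "first f \<equiv> dtensor V V f (dyn_id F B V)"
abbreviation "second f \<equiv> dtensor V V (dyn_id F B V) f"

abbreviation "on12 f \<equiv> dtensor Vc V f (dyn_id F B V)"
abbreviation "on23 f \<equiv> rebracket V V V (dtensor V Vc (dyn_id F B V) f)"

lemma V_coacted: "coacted V" and V_module: "module F V" and VV_module: "module F VV" and VVV_module: "module F VVV"
  and Vc_module: "module F Vc" and Vc_half_braided: "half_braided Vc" and Vc_coacted: "coacted Vc"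
  and V_VV_module: "module F (tensor F V VV)"
  using V_half_braided
  by (auto intro!: tensor_module half_braided_coacted half_braided_tensor coacted_module[OF half_braided_coacted])

lemmas id_End = dyn_id_linear[OF V_module]

lemma first_End: "f \<in> dyn_End V \<Longrightarrow> first f \<in> dyn_End VV"
  and second_End: "f \<in> dyn_End V \<Longrightarrow> second f \<in> dyn_End VV"
  by (intro dtensor_linear V_coacted V_module id_End; simp)+

lemma dtensor_VV_V_End: "f \<in> dyn_End VV \<Longrightarrow> g \<in> dyn_End V \<Longrightarrow> dtensor Vc V f g \<in> dyn_End VVV"
  using dtensor_linear[OF Vc_module V_coacted VV_module V_module, of f g] by simp

lemma dtensor_V_VV_End: "f \<in> dyn_End V \<Longrightarrow> g \<in> dyn_End VV \<Longrightarrow> dtensor V Vc f g \<in> dyn_End (tensor F V VV)"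
  using dtensor_linear[OF V_module Vc_coacted V_module VV_module, of f g] by simp

lemma on12_End: "f \<in> dyn_End VV \<Longrightarrow> on12 f \<in> dyn_End VVV"
  by (intro dtensor_VV_V_End id_End)

lemma on23_End: "f \<in> dyn_End VV \<Longrightarrow> on23 f \<in> dyn_End VVV"
  by (intro rebracket_linear V_module dtensor_V_VV_End id_End)

lemma id_id: "x \<in> carrier V \<Longrightarrow> dyn_comp F B V (dyn_id F B V) (dyn_id F B V) x = dyn_id F B V x"
  by (simp add: dyn_comp_def ext_id V_module linear_closed[OF id_End])

lemma first_comp:
  assumes f: "f \<in> dyn_End V" and g: "g \<in> dyn_End V" and x: "x \<in> carrier VV"
  shows "dyn_comp F B VV (first f) (first g) x = first (dyn_comp F B V f g) x"
proof -
  have "dyn_comp F B VV (first f) (first g) x =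
      dtensor V V (dyn_comp F B V f g) (dyn_comp F B V (dyn_id F B V) (dyn_id F B V)) x"
    by (intro dyn_comp_dtensor V_module V_half_braided f g id_End tau_commuting_id V_coacted x)
  also have "\<dots> = first (dyn_comp F B V f g) x"
    by (intro dtensor_cong V_module V_half_braided dyn_comp_linear[OF V_module V_module] f g id_End id_id x) auto
  finally show ?thesis .
qed

lemma second_comp:
  assumes f: "f \<in> dyn_End V" and g: "g \<in> dyn_End V" and x: "x \<in> carrier VV"
  shows "dyn_comp F B VV (second f) (second g) x = second (dyn_comp F B V f g) x"
proof -
  have "dyn_comp F B VV (second f) (second g) x =
      dtensor V V (dyn_comp F B V (dyn_id F B V) (dyn_id F B V)) (dyn_comp F B V f g) x"
    by (rule dyn_comp_dtensor_scalar[OF V_module V_half_braided id_End f linear_id g x id_End])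
      (simp add: dyn_id_def)
  also have "\<dots> = second (dyn_comp F B V f g) x"
    by (intro dtensor_cong V_module V_half_braided dyn_comp_linear[OF V_module V_module] f g id_End id_id x) auto
  finally show ?thesis .
qed

lemma is_dyn_inverse_dtensor:
  assumes A: "A \<in> dyn_End V" and J: "is_dyn_inverse F B V A J"
  shows "is_dyn_inverse F B VV (first A) (first J)" and "is_dyn_inverse F B VV (second A) (second J)"
proof -
  have Jl: "J \<in> dyn_End V" using J by (simp add: is_dyn_inverse_def)
  have *: "dtensor V V f g x = dyn_id F B VV x"
    if "f \<in> dyn_End V" "g \<in> dyn_End V" "\<And>v. v \<in> carrier V \<Longrightarrow> f v = dyn_id F B V v"
      "\<And>v. v \<in> carrier V \<Longrightarrow> g v = dyn_id F B V v" "x \<in> carrier VV" for f g x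
    using that dtensor_cong[OF V_module V_half_braided that(1) id_End that(2) id_End that(3,4,5)]
    by (simp add: dtensor_id V_module V_half_braided)
  note l = dyn_comp_linear[OF V_module V_module Jl A] dyn_comp_linear[OF V_module V_module A Jl]
  have inv: "dyn_comp F B V J A v = dyn_id F B V v" "dyn_comp F B V A J v = dyn_id F B V v" if "v \<in> carrier V" for v
    using J that by (simp_all add: is_dyn_inverse_def)
  show "is_dyn_inverse F B VV (first A) (first J)" "is_dyn_inverse F B VV (second A) (second J)"
    unfolding is_dyn_inverse_def
    by (simp_all add: first_End second_End first_comp second_comp A Jl l inv id_End *)
qed

lemma on12_comp:
  assumes f: "f \<in> dyn_End VV" and g: "g \<in> dyn_End VV" and x: "x \<in> carrier VVV"
  shows "dyn_comp F B VVV (on12 f) (on12 g) x = on12 (dyn_comp F B VV f g) x"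
proof -
  have "dyn_comp F B VVV (on12 f) (on12 g) x =
      dtensor Vc V (dyn_comp F B VV f g) (dyn_comp F B V (dyn_id F B V) (dyn_id F B V)) x"
    using dyn_comp_dtensor[OF Vc_module V_half_braided, of f "dyn_id F B V" g "dyn_id F B V" x] f g x
    by (simp add: dyn_comp_def tau_commuting_id V_coacted id_End)
  also have "\<dots> = on12 (dyn_comp F B VV f g) x"
    using dtensor_cong[OF Vc_module V_half_braided, of "dyn_comp F B VV f g" "dyn_comp F B VV f g"
        "dyn_comp F B V (dyn_id F B V) (dyn_id F B V)" "dyn_id F B V" x] x
      dyn_comp_linear[OF VV_module VV_module g f] dyn_comp_linear[OF V_module V_module id_End id_End] id_End id_id
    by simp
  finally show ?thesis .
qed

lemma on23_comp:
  assumes f: "f \<in> dyn_End VV" and g: "g \<in> dyn_End VV" and x: "x \<in> carrier VVV"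
  shows "dyn_comp F B VVV (on23 f) (on23 g) x = on23 (dyn_comp F B VV f g) x"
proof -
  have "dyn_comp F B (tensor F V VV) (dtensor V Vc (dyn_id F B V) f) (dtensor V Vc (dyn_id F B V) g) y =
      dtensor V Vc (dyn_id F B V) (dyn_comp F B VV f g) y" if y: "y \<in> carrier (tensor F V VV)" for y
  proof -
    have "dyn_comp F B (tensor F V VV) (dtensor V Vc (dyn_id F B V) f) (dtensor V Vc (dyn_id F B V) g) y =
        dtensor V Vc (dyn_comp F B V (dyn_id F B V) (dyn_id F B V)) (dyn_comp F B VV f g) y"
      using dyn_comp_dtensor_scalar[OF V_module Vc_half_braided id_End, of f "\<lambda>v. v" g y "dyn_id F B V"] f g y
      by (simp add: dyn_comp_def linear_id id_End) (simp add: dyn_id_def)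
    also have "\<dots> = dtensor V Vc (dyn_id F B V) (dyn_comp F B VV f g) y"
      using dtensor_cong[OF V_module Vc_half_braided, of "dyn_comp F B V (dyn_id F B V) (dyn_id F B V)" "dyn_id F B V"
          "dyn_comp F B VV f g" "dyn_comp F B VV f g" y] y
        dyn_comp_linear[OF VV_module VV_module g f] dyn_comp_linear[OF V_module V_module id_End id_End] id_End id_id
      by simp
    finally show ?thesis .
  qed
  then have "rebracket V V V (dyn_comp F B (tensor F V VV) (dtensor V Vc (dyn_id F B V) f) (dtensor V Vc (dyn_id F B V) g)) x
      = on23 (dyn_comp F B VV f g) x"
    by (intro rebracket_cong V_module x)
  then show ?thesis
    by (simp add: dyn_comp_rebracket V_module dtensor_V_VV_End id_End f g x)
qed

lemma on12_cong:
  assumes "f \<in> dyn_End VV" "g \<in> dyn_End VV" "\<And>x. x \<in> carrier VV \<Longrightarrow> f x = g x" "x \<in> carrier VVV"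
  shows "on12 f x = on12 g x"
  using dtensor_cong[OF Vc_module V_half_braided, of f g "dyn_id F B V" "dyn_id F B V" x] assms id_End by simp

lemma on23_cong:
  assumes "f \<in> dyn_End VV" "g \<in> dyn_End VV" "\<And>x. x \<in> carrier VV \<Longrightarrow> f x = g x" "x \<in> carrier VVV"
  shows "on23 f x = on23 g x"
proof (rule rebracket_cong[OF V_module V_module V_module _ assms(4)])
  fix y assume "y \<in> carrier (tensor F V VV)"
  then show "dtensor V Vc (dyn_id F B V) f y = dtensor V Vc (dyn_id F B V) g y"
    using dtensor_cong[OF V_module Vc_half_braided, of "dyn_id F B V" "dyn_id F B V" f g y] assms id_End by simp
qed

lemma on12_id: "x \<in> carrier VVV \<Longrightarrow> on12 (dyn_id F B VV) x = dyn_id F B VVV x"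
  using dtensor_id[OF Vc_module V_half_braided, of x] by simp

lemma on23_id: "x \<in> carrier VVV \<Longrightarrow> on23 (dyn_id F B VV) x = dyn_id F B VVV x"
proof -
  assume x: "x \<in> carrier VVV"
  have "on23 (dyn_id F B VV) x = rebracket V V V (dyn_id F B (tensor F V VV)) x"
    using dtensor_id[OF V_module Vc_half_braided] x by (intro rebracket_cong V_module) auto
  then show ?thesis by (simp add: rebracket_id V_module x)
qed

text \<open>
  The two ways of placing a map on the middle factor agree.  Through this, \<open>A\<^sub>2\<close> takes part both in
  \<open>A\<^sub>1 A\<^sub>2\<close>, which lives on the first two factors, and in \<open>A\<^sub>2 A\<^sub>3\<close>, which lives on the last two.
\<close>

lemma on12_second_eq_on23_first:
  "f \<in> dyn_End V \<Longrightarrow> x \<in> carrier VVV \<Longrightarrow> on12 (second f) x = on23 (first f) x"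
  using dtensor_assoc[OF V_module V_half_braided V_half_braided id_End _ id_End] by simp

text \<open>
  By associativity \<open>A\<^sub>1\<close> is \<open>A \<otimes> 1\<close> on \<open>V \<otimes> (V \<otimes> V)\<close>, and both composites equal \<open>A \<otimes> R\<close>.  In \<open>R\<^sub>2\<^sub>3 A\<^sub>1\<close> the
  coefficient produced by \<open>A\<close> has already been moved past \<open>V \<otimes> V\<close> when \<open>R\<close> is applied; this is where \<open>R\<close> must
  commute with \<open>\<tau>\<close>.
\<close>

lemma on12_first_on23_commute:
  assumes A: "A \<in> dyn_End V" and R: "R \<in> dyn_hom F H B Vc Vc" and x: "x \<in> carrier VVV"
  shows "dyn_comp F B VVV (on12 (first A)) (on23 R) x = dyn_comp F B VVV (on23 R) (on12 (first A)) x"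
proof -
  let ?V_VV = "tensor F V VV"
  let ?A = "dtensor V Vc A (dyn_id F B VV)"
  let ?R = "dtensor V Vc (dyn_id F B V) R"
  have Rl: "R \<in> dyn_End VV"
    using R by (simp add: dyn_hom_def comodule_maps_def trivial_comodule_def)
  have idVV: "dyn_id F B VV \<in> dyn_End VV" by (rule dyn_id_linear[OF VV_module])
  have A_eq: "on12 (first A) y = rebracket V V V ?A y" if y: "y \<in> carrier VVV" for y
  proof -
    have "on12 (first A) y = rebracket V V V (dtensor V Vc A (dtensor V V (dyn_id F B V) (dyn_id F B V))) y"
      using dtensor_assoc[OF V_module V_half_braided V_half_braided A id_End id_End y] by simp
    also have "\<dots> = rebracket V V V ?A y"
    proof (rule rebracket_cong[OF V_module V_module V_module _ y])
      fix z assume "z \<in> carrier ?V_VV"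
      then show "dtensor V Vc A (dtensor V V (dyn_id F B V) (dyn_id F B V)) z = ?A z"
        using dtensor_cong[OF V_module Vc_half_braided A A, of "dtensor V V (dyn_id F B V) (dyn_id F B V)" "dyn_id F B VV" z]
        by (simp add: idVV first_End id_End dtensor_id V_module V_half_braided)
    qed
    finally show ?thesis .
  qed
  have Ae: "?A \<in> dyn_End ?V_VV" and Re: "?R \<in> dyn_End ?V_VV"
    using A Rl idVV id_End by (auto intro: dtensor_V_VV_End)
  have comm: "dyn_comp F B ?V_VV ?A ?R z = dyn_comp F B ?V_VV ?R ?A z" if z: "z \<in> carrier ?V_VV" for z
  proof -
    have "dyn_comp F B ?V_VV ?A ?R z = dtensor V Vc (dyn_comp F B V A (dyn_id F B V)) (dyn_comp F B VV (dyn_id F B VV) R) z"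
      using dyn_comp_dtensor_scalar[OF V_module Vc_half_braided A, of "dyn_id F B VV" "\<lambda>v. v" R z "dyn_id F B V"] Rl z idVV
      by (simp add: dyn_comp_def linear_id id_End) (simp add: dyn_id_def)
    also have "\<dots> = dtensor V Vc (dyn_comp F B V (dyn_id F B V) A) (dyn_comp F B VV R (dyn_id F B VV)) z"
      using dtensor_cong[OF V_module Vc_half_braided, of "dyn_comp F B V A (dyn_id F B V)" "dyn_comp F B V (dyn_id F B V) A"
          "dyn_comp F B VV (dyn_id F B VV) R" "dyn_comp F B VV R (dyn_id F B VV)" z] z A Rl
        dyn_comp_linear[OF V_module V_module A id_End] dyn_comp_linear[OF V_module V_module id_End A]
        dyn_comp_linear[OF VV_module VV_module Rl idVV] dyn_comp_linear[OF VV_module VV_module idVV Rl]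
      by (simp add: dyn_comp_id_left dyn_comp_id_right V_module VV_module)
    also have "\<dots> = dyn_comp F B ?V_VV ?R ?A z"
      using dyn_comp_dtensor[OF V_module Vc_half_braided id_End, of R A "dyn_id F B VV" z]
        tau_commuting_dyn_hom[OF Vc_coacted R] A Rl z idVV
      by (simp add: dyn_comp_def)
    finally show ?thesis .
  qed
  have 1: "rebracket V V V ?A \<in> dyn_End VVV" "on12 (first A) \<in> dyn_End VVV" "on23 R \<in> dyn_End VVV"
    using A Rl Ae by (auto intro!: rebracket_linear V_module on12_End on23_End first_End)
  have "dyn_comp F B VVV (on12 (first A)) (on23 R) x = dyn_comp F B VVV (rebracket V V V ?A) (on23 R) x"
    unfolding dyn_comp_def comp_apply
    by (rule ext_cong[OF VVV_module VVV_module 1(2,1) A_eq linear_closed[OF 1(3) x]])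
  also have "\<dots> = rebracket V V V (dyn_comp F B ?V_VV ?A ?R) x"
    by (rule dyn_comp_rebracket[OF V_module V_module V_module Ae Re x])
  also have "\<dots> = rebracket V V V (dyn_comp F B ?V_VV ?R ?A) x"
    using comm x by (intro rebracket_cong V_module)
  also have "\<dots> = dyn_comp F B VVV (on23 R) (rebracket V V V ?A) x"
    by (rule dyn_comp_rebracket[OF V_module V_module V_module Re Ae x, symmetric])
  also have "\<dots> = dyn_comp F B VVV (on23 R) (on12 (first A)) x"
    using x A_eq by (simp add: dyn_comp_def)
  finally show ?thesis .
qed

text \<open>
  By associativity \<open>A\<^sub>3\<close> is \<open>1 \<otimes> A\<close> on \<open>(V \<otimes> V) \<otimes> V\<close>, and both composites equal \<open>G \<otimes> A\<close>.  The
  coefficients of \<open>G\<close> being scalars, nothing has to be moved past \<open>A\<close>.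
\<close>

lemma on23_second_on12_commute:
  assumes A: "A \<in> dyn_End V" and G: "G \<in> dyn_End VV" and s: "s \<in> linear_maps F VV VV"
    and Gs: "\<And>x. x \<in> carrier VV \<Longrightarrow> G x = tens F VV B (s x) \<one>\<^bsub>B\<^esub>" and x: "x \<in> carrier VVV"
  shows "dyn_comp F B VVV (on23 (second A)) (on12 G) x = dyn_comp F B VVV (on12 G) (on23 (second A)) x"
proof -
  let ?A = "dtensor Vc V (dyn_id F B VV) A"
  have idVV: "dyn_id F B VV \<in> dyn_End VV" by (rule dyn_id_linear[OF VV_module])
  have A_eq: "on23 (second A) y = ?A y" if y: "y \<in> carrier VVV" for y
  proof -
    have "on23 (second A) y = dtensor Vc V (dtensor V V (dyn_id F B V) (dyn_id F B V)) A y"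
      by (rule dtensor_assoc[OF V_module V_half_braided V_half_braided id_End id_End A y])
    also have "\<dots> = ?A y"
      using dtensor_cong[OF Vc_module V_half_braided, of "dtensor V V (dyn_id F B V) (dyn_id F B V)" "dyn_id F B VV" A A y] y
      by (simp add: idVV first_End id_End dtensor_id V_module V_half_braided A)
    finally show ?thesis .
  qed
  have e: "?A \<in> dyn_End VVV" "on23 (second A) \<in> dyn_End VVV" "on12 G \<in> dyn_End VVV"
    using A G idVV by (auto intro!: dtensor_VV_V_End on12_End on23_End second_End)
  have "dyn_comp F B VVV (on23 (second A)) (on12 G) x = dyn_comp F B VVV ?A (on12 G) x"
    unfolding dyn_comp_def comp_apply
    by (rule ext_cong[OF VVV_module VVV_module e(2,1) A_eq linear_closed[OF e(3) x]])
  also have "\<dots> = dtensor Vc V (dyn_comp F B VV (dyn_id F B VV) G) (dyn_comp F B V A (dyn_id F B V)) x"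
    using dyn_comp_dtensor_scalar[OF Vc_module V_half_braided, of "dyn_id F B VV" A s "dyn_id F B V" x G] A G x idVV s Gs
    by (simp add: dyn_comp_def id_End)
  also have "\<dots> = dtensor Vc V (dyn_comp F B VV G (dyn_id F B VV)) (dyn_comp F B V (dyn_id F B V) A) x"
    using dtensor_cong[OF Vc_module V_half_braided, of "dyn_comp F B VV (dyn_id F B VV) G" "dyn_comp F B VV G (dyn_id F B VV)"
        "dyn_comp F B V A (dyn_id F B V)" "dyn_comp F B V (dyn_id F B V) A" x] x A G
      dyn_comp_linear[OF V_module V_module A id_End] dyn_comp_linear[OF V_module V_module id_End A]
      dyn_comp_linear[OF VV_module VV_module G idVV] dyn_comp_linear[OF VV_module VV_module idVV G]
    by (simp add: dyn_comp_id_left dyn_comp_id_right V_module VV_module)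
  also have "\<dots> = dyn_comp F B VVV (on12 G) ?A x"
    using dyn_comp_dtensor[OF Vc_module V_half_braided, of G "dyn_id F B V" "dyn_id F B VV" A x] A G x idVV
    by (simp add: dyn_comp_def id_End tau_commuting_id V_coacted)
  also have "\<dots> = dyn_comp F B VVV (on12 G) (on23 (second A)) x"
    using x A_eq by (simp add: dyn_comp_def)
  finally show ?thesis .
qed

lemma ext_on12_comp:
  assumes f: "f \<in> dyn_End VV" and g: "g \<in> dyn_End VV" and y: "y \<in> carrier (tensor F VVV B)"
  shows "ext VVV (on12 f) (ext VVV (on12 g) y) = ext VVV (on12 (dyn_comp F B VV f g)) y"
proof -
  note l = on12_End[OF f] on12_End[OF g] on12_End[OF dyn_comp_linear[OF VV_module VV_module g f]]
  have "ext VVV (dyn_comp F B VVV (on12 f) (on12 g)) y = ext VVV (on12 (dyn_comp F B VV f g)) y"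
    by (rule ext_cong[OF VVV_module VVV_module dyn_comp_linear[OF VVV_module VVV_module l(2,1)] l(3) on12_comp[OF f g] y])
  then show ?thesis by (simp add: ext_comp[OF VVV_module VVV_module VVV_module l(2,1) y])
qed

lemma ext_on23_comp:
  assumes f: "f \<in> dyn_End VV" and g: "g \<in> dyn_End VV" and y: "y \<in> carrier (tensor F VVV B)"
  shows "ext VVV (on23 f) (ext VVV (on23 g) y) = ext VVV (on23 (dyn_comp F B VV f g)) y"
proof -
  note l = on23_End[OF f] on23_End[OF g] on23_End[OF dyn_comp_linear[OF VV_module VV_module g f]]
  have "ext VVV (dyn_comp F B VVV (on23 f) (on23 g)) y = ext VVV (on23 (dyn_comp F B VV f g)) y"
    by (rule ext_cong[OF VVV_module VVV_module dyn_comp_linear[OF VVV_module VVV_module l(2,1)] l(3) on23_comp[OF f g] y])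
  then show ?thesis by (simp add: ext_comp[OF VVV_module VVV_module VVV_module l(2,1) y])
qed

lemma ext_on12_inverse:
  assumes f: "f \<in> dyn_End VV" and inv: "is_dyn_inverse F B VV f g" and y: "y \<in> carrier (tensor F VVV B)"
  shows "ext VVV (on12 g) (ext VVV (on12 f) y) = y"
proof -
  have g: "g \<in> dyn_End VV" using inv by (simp add: is_dyn_inverse_def)
  have "ext VVV (on12 (dyn_comp F B VV g f)) y = ext VVV (dyn_id F B VVV) y"
  proof (rule ext_cong[OF VVV_module VVV_module _ _ _ y])
    fix x assume x: "x \<in> carrier VVV"
    have "on12 (dyn_comp F B VV g f) x = on12 (dyn_id F B VV) x"
      using inv by (intro on12_cong dyn_comp_linear[OF VV_module VV_module f g] dyn_id_linear VV_module x)
        (simp add: is_dyn_inverse_def)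
    then show "on12 (dyn_comp F B VV g f) x = dyn_id F B VVV x" by (simp add: on12_id x)
  qed (intro on12_End dyn_comp_linear[OF VV_module VV_module f g] dyn_id_linear VVV_module)+
  then show ?thesis by (simp add: ext_on12_comp f g y ext_id VVV_module)
qed

lemma ext_on23_inverse:
  assumes f: "f \<in> dyn_End VV" and inv: "is_dyn_inverse F B VV f g" and y: "y \<in> carrier (tensor F VVV B)"
  shows "ext VVV (on23 g) (ext VVV (on23 f) y) = y"
proof -
  have g: "g \<in> dyn_End VV" using inv by (simp add: is_dyn_inverse_def)
  have "ext VVV (on23 (dyn_comp F B VV g f)) y = ext VVV (dyn_id F B VVV) y"
  proof (rule ext_cong[OF VVV_module VVV_module _ _ _ y])
    fix x assume x: "x \<in> carrier VVV"
    have "on23 (dyn_comp F B VV g f) x = on23 (dyn_id F B VV) x"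
      using inv by (intro on23_cong dyn_comp_linear[OF VV_module VV_module f g] dyn_id_linear VV_module x)
        (simp add: is_dyn_inverse_def)
    then show "on23 (dyn_comp F B VV g f) x = dyn_id F B VVV x" by (simp add: on23_id x)
  qed (intro on23_End dyn_comp_linear[OF VV_module VV_module f g] dyn_id_linear VVV_module)+
  then show ?thesis by (simp add: ext_on23_comp f g y ext_id VVV_module)
qed

text \<open>
  The conjugation argument.  The hypothesis \<open>conj\<close> is \<open>A\<^sub>1 A\<^sub>2 G = R A\<^sub>1 A\<^sub>2\<close>, that is, \<open>G = R\<^sup>A\<close> written without
  inverses.
\<close>

lemma braid_conjugate:
  assumes A: "A \<in> dyn_End V" and J: "is_dyn_inverse F B V A J"
    and R: "R \<in> dyn_hom F H B Vc Vc" and YB: "dyn_YBE F H B \<sigma> V R"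
    and G: "G \<in> dyn_End VV" and s: "s \<in> linear_maps F VV VV"
    and Gs: "\<And>x. x \<in> carrier VV \<Longrightarrow> G x = tens F VV B (s x) \<one>\<^bsub>B\<^esub>"
    and conj: "\<And>x. x \<in> carrier VV \<Longrightarrow>
      dyn_comp F B VV (first A) (dyn_comp F B VV (second A) G) x = dyn_comp F B VV R (dyn_comp F B VV (first A) (second A)) x"
    and y: "y \<in> carrier (tensor F VVV B)"
  shows "ext VVV (on12 G) (ext VVV (on23 G) (ext VVV (on12 G) y)) = ext VVV (on23 G) (ext VVV (on12 G) (ext VVV (on23 G) y))"
proof -
  let ?C = "carrier (tensor F VVV B)"
  have Rl: "R \<in> dyn_End VV"
    using R by (simp add: dyn_hom_def comodule_maps_def trivial_comodule_def)
  note A1 = first_End[OF A] and A2 = second_End[OF A]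
  note inv1 = is_dyn_inverse_dtensor(1)[OF A J] and inv2 = is_dyn_inverse_dtensor(2)[OF A J]
  define a1 where "a1 = ext VVV (on12 (first A))"
  define a2 where "a2 = ext VVV (on12 (second A))"
  define a3 where "a3 = ext VVV (on23 (second A))"
  define r12 where "r12 = ext VVV (on12 R)"
  define r23 where "r23 = ext VVV (on23 R)"
  define s12 where "s12 = ext VVV (on12 G)"
  define s23 where "s23 = ext VVV (on23 G)"
  note defs = a1_def a2_def a3_def r12_def r23_def s12_def s23_def
  have cl: "a1 z \<in> ?C" "a2 z \<in> ?C" "a3 z \<in> ?C" "r12 z \<in> ?C" "r23 z \<in> ?C" "s12 z \<in> ?C" "s23 z \<in> ?C"
    if "z \<in> ?C" for z
    unfolding defs by (intro ext_closed[OF VVV_module VVV_module] on12_End on23_End A1 A2 Rl G that)+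
  have comps: "dyn_comp F B VV (first A) (second A) \<in> dyn_End VV" "dyn_comp F B VV (second A) G \<in> dyn_End VV"
    by (rule dyn_comp_linear[OF VV_module VV_module A2 A1], rule dyn_comp_linear[OF VV_module VV_module G A2])
  note comps2 = dyn_comp_linear[OF VV_module VV_module comps(2) A1] dyn_comp_linear[OF VV_module VV_module comps(1) Rl]
  have e12: "a1 (a2 (s12 z)) = r12 (a1 (a2 z))" if z: "z \<in> ?C" for z
  proof -
    have "a1 (a2 (s12 z)) = ext VVV (on12 (dyn_comp F B VV (first A) (dyn_comp F B VV (second A) G))) z"
      unfolding defs by (simp add: ext_on12_comp A1 A2 G comps z)
    also have "\<dots> = ext VVV (on12 (dyn_comp F B VV R (dyn_comp F B VV (first A) (second A)))) z"
      by (intro ext_cong[OF VVV_module VVV_module _ _ _ z] on12_End comps2 on12_cong conj)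
    also have "\<dots> = r12 (a1 (a2 z))"
      unfolding defs by (simp add: ext_on12_comp A1 A2 Rl comps z)
    finally show ?thesis .
  qed
  have a2_23: "a2 z = ext VVV (on23 (first A)) z" if z: "z \<in> ?C" for z
    unfolding a2_def by (rule ext_cong[OF VVV_module VVV_module on12_End[OF A2] on23_End[OF A1]
          on12_second_eq_on23_first[OF A] z])
  have e23: "a2 (a3 (s23 z)) = r23 (a2 (a3 z))" if z: "z \<in> ?C" for z
  proof -
    have "a2 (a3 (s23 z)) = ext VVV (on23 (dyn_comp F B VV (first A) (dyn_comp F B VV (second A) G))) z"
      using cl z by (simp add: a2_23) (simp add: defs ext_on23_comp A1 A2 G comps z)
    also have "\<dots> = ext VVV (on23 (dyn_comp F B VV R (dyn_comp F B VV (first A) (second A)))) z"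
      by (intro ext_cong[OF VVV_module VVV_module _ _ _ z] on23_End comps2 on23_cong conj)
    also have "\<dots> = r23 (a2 (a3 z))"
      using cl z by (simp add: a2_23) (simp add: defs ext_on23_comp A1 A2 Rl comps z)
    finally show ?thesis .
  qed
  have c3: "a3 (s12 z) = s12 (a3 z)" if "z \<in> ?C" for z
    unfolding defs using on23_second_on12_commute[OF A G s Gs]
    by (intro ext_commute[OF VVV_module] on12_End on23_End A2 G that)
  have c1: "a1 (r23 z) = r23 (a1 z)" if "z \<in> ?C" for z
    unfolding defs using on12_first_on23_commute[OF A R]
    by (intro ext_commute[OF VVV_module] on12_End on23_End A1 Rl that)
  have ybe: "r12 (r23 (r12 z)) = r23 (r12 (r23 z))" if z: "z \<in> ?C" for z
  proof -
    let ?D = "dyn_comp F B VVV"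
    note l = on12_End[OF Rl] on23_End[OF Rl]
    note comp = dyn_comp_linear[OF VVV_module VVV_module]
    note ll = comp[OF l] comp[OF l(2,1)]
    have "ext VVV (?D (on12 R) (?D (on23 R) (on12 R))) z = ext VVV (?D (on23 R) (?D (on12 R) (on23 R))) z"
    proof (rule ext_cong[OF VVV_module VVV_module comp[OF ll(1) l(1)] comp[OF ll(2) l(2)] _ z])
      show "?D (on12 R) (?D (on23 R) (on12 R)) x = ?D (on23 R) (?D (on12 R) (on23 R)) x" if "x \<in> carrier VVV" for x
        using YB that by (simp add: dyn_YBE_def dyn_12_def dyn_23_def rebracket_def Let_def)
    qed
    then show ?thesis
      by (simp add: ext_comp[OF VVV_module VVV_module VVV_module] l ll z r12_def r23_def)
  qed
  \<comment> \<open>\<open>X = A\<^sub>1 A\<^sub>2 A\<^sub>3\<close> intertwines both pairs of operators.\<close>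
  define X where "X z = a1 (a2 (a3 z))" for z
  have X12: "X (s12 z) = r12 (X z)" and X23: "X (s23 z) = r23 (X z)" and Xcl: "X z \<in> ?C" if "z \<in> ?C" for z
    using that by (simp_all add: X_def c3 e12 e23 c1 cl)
  have X_inj: "z = z'" if z: "z \<in> ?C" "z' \<in> ?C" and eq: "X z = X z'" for z z'
  proof -
    have left_inverse: "ext VVV (on23 (second J)) (ext VVV (on12 (second J)) (ext VVV (on12 (first J)) (X z))) = z"
      if "z \<in> ?C" for z
      unfolding X_def ext_on12_inverse[OF A1 inv1 cl(2)[OF cl(3)[OF that]], folded a1_def]
        ext_on12_inverse[OF A2 inv2 cl(3)[OF that], folded a2_def]
      by (rule ext_on23_inverse[OF A2 inv2 that, folded a3_def])
    show ?thesis
      by (rule trans[OF left_inverse[OF z(1), symmetric]]) (simp only: eq left_inverse[OF z(2)])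
  qed
  have "X (s12 (s23 (s12 y))) = X (s23 (s12 (s23 y)))"
    unfolding X12[OF cl(7)[OF cl(6)[OF y]]] X23[OF cl(6)[OF y]] X12[OF y]
      X23[OF cl(6)[OF cl(7)[OF y]]] X12[OF cl(7)[OF y]] X23[OF y]
    by (rule ybe[OF Xcl[OF y]])
  then have "s12 (s23 (s12 y)) = s23 (s12 (s23 y))"
    by (rule X_inj[OF cl(6)[OF cl(7)[OF cl(6)[OF y]]] cl(7)[OF cl(6)[OF cl(7)[OF y]]]])
  then show ?thesis by (simp add: defs)
qed

text \<open>
  On elements \<open>x \<otimes> 1\<close> the operators \<open>G\<^sub>1\<^sub>2\<close> and \<open>G\<^sub>2\<^sub>3\<close> reduce to \<open>s \<otimes> 1\<close> and \<open>1 \<otimes> s\<close>, because the coefficient 1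
  passes every vector unchanged.
\<close>

lemma scalar_YBE:
  assumes "field F" and nz: "\<one>\<^bsub>B\<^esub> \<noteq> \<zero>\<^bsub>B\<^esub>" and G: "G \<in> dyn_End VV" and s: "s \<in> linear_maps F VV VV"
    and Gs: "\<And>x. x \<in> carrier VV \<Longrightarrow> G x = tens F VV B (s x) \<one>\<^bsub>B\<^esub>"
    and braid: "\<And>y. y \<in> carrier (tensor F VVV B) \<Longrightarrow>
      ext VVV (on12 G) (ext VVV (on23 G) (ext VVV (on12 G) y)) = ext VVV (on23 G) (ext VVV (on12 G) (ext VVV (on23 G) y))"
  shows "YBE F V s"
proof -
  define S12 where "S12 = tmap F VV V s (\<lambda>v. v)"
  define S23 where "S23 = tassoc_inv F V V V \<circ> tmap F V VV (\<lambda>v. v) s \<circ> tassoc F V V V"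
  have S12_linear: "S12 \<in> linear_maps F VVV VVV"
    unfolding S12_def by (intro tmap_linear VV_module V_module s linear_id)
  have right_linear: "tmap F V VV (\<lambda>v. v) s \<in> linear_maps F (tensor F V VV) (tensor F V VV)"
    by (intro tmap_linear VV_module V_module s linear_id)
  have S23_linear: "S23 \<in> linear_maps F VVV VVV"
    unfolding S23_def comp_def
    by (intro linear_compose[OF linear_compose[OF tassoc_linear right_linear] tassoc_inv_linear] V_module)
  have on12: "on12 G x = tens F VVV B (S12 x) \<one>\<^bsub>B\<^esub>" if x: "x \<in> carrier VVV" for x
  proof (rule linear_tensor_eq[OF VV_module V_module on12_End[OF G] _ _ x])
    show "(\<lambda>x. tens F VVV B (S12 x) \<one>\<^bsub>B\<^esub>) \<in> dyn_End VVV"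
      by (intro linear_tens_left VVV_module B_module S12_linear) simp
    fix t v assume tv: "t \<in> carrier VV" "v \<in> carrier V"
    have st: "s t \<in> carrier VV" by (rule linear_closed[OF s tv(1)])
    have "on12 G (tens F VV V t v) = twisted_prod Vc V (tens F VV B (s t) \<one>\<^bsub>B\<^esub>) (tens F V B v \<one>\<^bsub>B\<^esub>)"
      using dtensor_tens[OF Vc_module V_coacted VV_module V_module, of G "dyn_id F B V" t v] tv G id_End
      by (simp add: Gs) (simp add: dyn_id_def)
    also have "\<dots> = prepend VV V (s t) (tens F V B v \<one>\<^bsub>B\<^esub>)"
      using twisted_prod_one_left[OF Vc_module V_half_braided, of "s t" "tens F V B v \<one>\<^bsub>B\<^esub>"] st tv
      by (simp add: tens_closed V_module B_module)
    finally show "on12 G (tens F VV V t v) = tens F VVV B (S12 (tens F VV V t v)) \<one>\<^bsub>B\<^esub>"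
      using st tv by (simp add: prepend_tens VV_module V_module S12_def
          tmap_tens[OF VV_module V_module VV_module V_module s linear_id])
  qed
  have right: "dtensor V Vc (dyn_id F B V) G z = tens F (tensor F V VV) B (tmap F V VV (\<lambda>v. v) s z) \<one>\<^bsub>B\<^esub>"
    if z: "z \<in> carrier (tensor F V VV)" for z
  proof (rule linear_tensor_eq[OF V_module VV_module dtensor_V_VV_End[OF id_End G] _ _ z])
    show "(\<lambda>x. tens F (tensor F V VV) B (tmap F V VV (\<lambda>v. v) s x) \<one>\<^bsub>B\<^esub>) \<in> dyn_End (tensor F V VV)"
      by (intro linear_tens_left V_VV_module B_module right_linear) simp
    fix v t assume tv: "v \<in> carrier V" "t \<in> carrier VV"
    have st: "s t \<in> carrier VV" by (rule linear_closed[OF s tv(2)])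
    have "dtensor V Vc (dyn_id F B V) G (tens F V VV v t) = twisted_prod V Vc (tens F V B v \<one>\<^bsub>B\<^esub>) (tens F VV B (s t) \<one>\<^bsub>B\<^esub>)"
      using dtensor_tens[OF V_module Vc_coacted V_module VV_module id_End, of G v t] tv G
      by (simp add: Gs) (simp add: dyn_id_def)
    also have "\<dots> = prepend V VV v (tens F VV B (s t) \<one>\<^bsub>B\<^esub>)"
      using twisted_prod_one_left[OF V_module Vc_half_braided, of v "tens F VV B (s t) \<one>\<^bsub>B\<^esub>"] st tv
      by (simp add: tens_closed VV_module B_module)
    finally show "dtensor V Vc (dyn_id F B V) G (tens F V VV v t) =
        tens F (tensor F V VV) B (tmap F V VV (\<lambda>v. v) s (tens F V VV v t)) \<one>\<^bsub>B\<^esub>"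
      using st tv by (simp add: prepend_tens VV_module V_module
          tmap_tens[OF V_module VV_module V_module VV_module linear_id s])
  qed
  have on23: "on23 G x = tens F VVV B (S23 x) \<one>\<^bsub>B\<^esub>" if x: "x \<in> carrier VVV" for x
    using rebracket_scalar[OF V_module V_module V_module x right_linear right] by (simp add: S23_def)
  have "S12 (S23 (S12 x)) = S23 (S12 (S23 x))" if x: "x \<in> carrier VVV" for x
  proof -
    have cl: "S12 z \<in> carrier VVV" "S23 z \<in> carrier VVV" if "z \<in> carrier VVV" for z
      using that by (auto intro: linear_closed[OF S12_linear] linear_closed[OF S23_linear])
    have e12: "ext VVV (on12 G) (tens F VVV B z \<one>\<^bsub>B\<^esub>) = tens F VVV B (S12 z) \<one>\<^bsub>B\<^esub>"
      and e23: "ext VVV (on23 G) (tens F VVV B z \<one>\<^bsub>B\<^esub>) = tens F VVV B (S23 z) \<one>\<^bsub>B\<^esub>" if "z \<in> carrier VVV" for z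
      using that ext_one[OF VVV_module VVV_module on12_End[OF G], of z]
        ext_one[OF VVV_module VVV_module on23_End[OF G], of z] by (simp_all add: on12 on23)
    have "tens F VVV B (S12 (S23 (S12 x))) \<one>\<^bsub>B\<^esub> = tens F VVV B (S23 (S12 (S23 x))) \<one>\<^bsub>B\<^esub>"
      using braid[of "tens F VVV B x \<one>\<^bsub>B\<^esub>"] x by (simp add: e12 e23 cl tens_closed VVV_module B_module)
    then show ?thesis
      using x nz by (intro tens_right_injective[OF \<open>field F\<close> VVV_module B_module _ nz]) (auto simp: cl)
  qed
  then show ?thesis by (simp add: YBE_def S12_def[symmetric] S23_def[symmetric] Let_def)
qed

theorem gauge_transform_YBE:
  assumes "field F" and nz: "\<one>\<^bsub>B\<^esub> \<noteq> \<zero>\<^bsub>B\<^esub>"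
    and R: "R \<in> dyn_hom F H B Vc Vc" and YB: "dyn_YBE F H B \<sigma> V R"
    and A: "A \<in> dyn_End V" and inv: "dyn_invertible F B V A"
    and scal: "gauge_transform F H B \<sigma> V A R ` carrier VV \<subseteq> scalar_part F B VV"
  shows "YBE F V (scalar_op F B VV (gauge_transform F H B \<sigma> V A R))"
proof -
  obtain J where J: "is_dyn_inverse F B V A J" using inv by (auto simp: dyn_invertible_def)
  have Rl: "R \<in> dyn_End VV"
    using R by (simp add: dyn_hom_def comodule_maps_def trivial_comodule_def)
  define J1 where "J1 = dyn_inv F B VV (first A)"
  define J2 where "J2 = dyn_inv F B VV (second A)"
  have inv1: "is_dyn_inverse F B VV (first A) J1" and inv2: "is_dyn_inverse F B VV (second A) J2"
    unfolding J1_def J2_def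
    by (rule is_dyn_inverse_dyn_inv[OF is_dyn_inverse_dtensor(1)[OF A J]],
        rule is_dyn_inverse_dyn_inv[OF is_dyn_inverse_dtensor(2)[OF A J]])
  then have Jl: "J1 \<in> dyn_End VV" "J2 \<in> dyn_End VV" by (auto simp: is_dyn_inverse_def)
  define G where "G = gauge_transform F H B \<sigma> V A R"
  let ?D = "dyn_comp F B VV"
  have G_eq: "G = ?D J2 (?D J1 (?D R (?D (first A) (second A))))"
    by (simp add: G_def gauge_transform_def J1_def J2_def dyn_1_def dyn_2_def Let_def)
  note l = first_End[OF A] second_End[OF A]
  note comp = dyn_comp_linear[OF VV_module VV_module]
  have RAA: "?D R (?D (first A) (second A)) \<in> dyn_End VV" by (rule comp[OF comp[OF l(2,1)] Rl])
  then have G: "G \<in> dyn_End VV" unfolding G_eq by (intro comp[OF comp[OF _ Jl(1)] Jl(2)])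
  have conj: "?D (first A) (?D (second A) G) x = ?D R (?D (first A) (second A)) x" if x: "x \<in> carrier VV" for x
  proof -
    have c: "?D R (?D (first A) (second A)) x \<in> carrier (tensor F VV B)" by (rule linear_closed[OF RAA x])
    have "ext VV (first A) (ext VV (second A) (ext VV J2 (ext VV J1 (?D R (?D (first A) (second A)) x)))) =
        ?D R (?D (first A) (second A)) x"
      by (simp add: ext_inverse[OF VV_module l(2) inv2] ext_inverse[OF VV_module l(1) inv1]
          ext_closed[OF VV_module VV_module Jl(1)] c)
    then show ?thesis by (simp add: dyn_comp_def G_eq)
  qed
  note sc = scalar_op_linear[OF \<open>field F\<close> nz VV_module G scal[folded G_def]]
  show ?thesis
    unfolding G_def[symmetric]
    by (rule scalar_YBE[OF \<open>field F\<close> nz G sc(2) sc(1) braid_conjugate[OF A J R YB G sc(2) sc(1) conj]])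
qed

end

theorem proposition3p3:
  fixes F :: "('f, 'm) ring_scheme"
    and H :: "('f, 'h, 'n) hopf_scheme"
    and B :: "('f, 'b, 'r) module_scheme"
    and \<sigma> :: "('h \<times> 'b \<Rightarrow> 'f) set \<Rightarrow> 'b"
    and V :: "('f, 'v, 'h, 'p) comodule_scheme"
    and R :: "('v \<times> 'v \<Rightarrow> 'f) set \<Rightarrow> (('v \<times> 'v \<Rightarrow> 'f) set \<times> 'b \<Rightarrow> 'f) set"
    and A :: "'v \<Rightarrow> ('v \<times> 'b \<Rightarrow> 'f) set"
  assumes "field F"
    and "comm_cocomm_hopf_algebra F H"
    and "module_algebra F H B \<sigma>"
    and B_comm: "\<forall>b\<in>carrier B. \<forall>c\<in>carrier B. b \<otimes>\<^bsub>B\<^esub> c = c \<otimes>\<^bsub>B\<^esub> b"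
    and B_nonzero: "\<one>\<^bsub>B\<^esub> \<noteq> \<zero>\<^bsub>B\<^esub>"
    and "right_comodule F H V"
    and R_hom: "R \<in> dyn_hom F H B (tensor_comodule F H V V) (tensor_comodule F H V V)"
    and R_YBE: "dyn_YBE F H B \<sigma> V R"
    and A_linear: "A \<in> linear_maps F V (tensor F V B)"
    and A_invertible: "dyn_invertible F B V A"
    and "gauge_transform F H B \<sigma> V A R ` carrier (tensor F V V) \<subseteq> scalar_part F B (tensor F V V)"
  shows "YBE F V (scalar_op F B (tensor F V V) (gauge_transform F H B \<sigma> V A R))"
proof -
  interpret dynamical_setting F H B \<sigma>
    using assms(2,3) B_comm by (intro dynamical_setting.intro) auto
  interpret dynamical_comodule F H B \<sigma> V
    by unfold_locales (rule half_braided_comodule[OF assms(6)])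
  show ?thesis
    by (rule gauge_transform_YBE[OF assms(1) B_nonzero R_hom R_YBE A_linear A_invertible assms(11)])
qed

end
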